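(* Assume the Riemann Hypothesis. Let $k$ be a positive even integer. Then the following two statements are equivalent. (i) For every fixed $\epsilon>0$, as $X\to\infty$, $$\int_{1}^{X} (\psi(x+h) - \psi(x) - h)^k\, dx \sim \mu_k\, h^{k/2+1} \int_{E}^{X/h} \Bigl(\log\frac{x}{E}\Bigr)^{k/2} dx$$ holds uniformly for $X^\epsilon \leq h \leq X^{1-\epsilon}$. (ii) For every fixed $\epsilon>0$, as $X\to\infty$, $$\int_{1}^{X} (\psi(x+\delta x) - \psi(x) - \delta x)^k\, dx \sim \frac{\mu_k}{\frac{k}{2}+1}\, X^{k/2+1} \delta^{k/2} \Bigl(\log\frac{1}{E \delta}\Bigr)^{k/2}$$ holds uniformly for $X^{-1+\epsilon} \leq \delta \leq X^{-\epsilon}$.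
   Context: $\psi(x)=\sum_{n\le x}\Lambda(n)$, where $\Lambda$ is the von Mangoldt function. For even $k$, $\mu_k = 1\cdot 3\cdot 5\cdots (k-1)$. $E=2\pi e^{C_0-1}$, where $C_0$ is Euler's constant. The relation $A(X,h)\sim B(X,h)$ uniformly for $h$ in a range depending on $X$ means that $A(X,h)/B(X,h)\to 1$ as $X\to\infty$, uniformly over all $h$ in that range (similarly with $\delta$ in place of $h$). *)

theory Defs
  imports "HOL-Complex_Analysis.Complex_Analysis" "HOL-Number_Theory.Prime_Powers"
begin

text \<open>The analytic continuation of \<open>\<Sum>n. n powr -s\<close> to the whole complex plane without \<open>1\<close>;
  the value at the pole \<open>1\<close> is an arbitrary convention that makes the description unique.\<close>

definition is_zeta :: "(complex \<Rightarrow> complex) \<Rightarrow> bool" where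
  "is_zeta f \<longleftrightarrow> f holomorphic_on (- {1}) \<and>
     (\<forall>s. Re s > 1 \<longrightarrow> (\<lambda>n. of_nat (Suc n) powr (- s)) sums f s) \<and> f 1 = 0"

definition zeta :: "complex \<Rightarrow> complex" where
  "zeta = (THE f. is_zeta f)"

lemma is_zeta_unique:
  assumes "is_zeta f" "is_zeta g"
  shows "f = g"
proof
  fix s
  have eq: "f z = g z" if "Re z > 1" for z
    using assms that unfolding is_zeta_def by (meson sums_unique2)
  show "f s = g s"
  proof (cases "s = 1")
    case False
    show ?thesis
    proof (rule analytic_continuation_open[of "{z. Re z > 1}" "- {1}" f g])
      show "connected (- {1::complex})"
        by (intro connected_punctured_universe) simp
      show "{z. Re z > 1} \<noteq> {}"
        by (auto intro!: exI[of _ 2])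
    qed (use assms False eq open_halfspace_Re_gt in \<open>auto simp: is_zeta_def\<close>)
  qed (use assms in \<open>simp add: is_zeta_def\<close>)
qed

text \<open>Existence: summing the order-\<open>K\<close> Taylor expansion of \<open>(n + 1) powr (1 - s)\<close> around \<open>n\<close>
  expresses \<open>(s - 1) * zeta s\<close> through its values at \<open>s + 1, \<dots>, s + K - 1\<close> and a remainder
  that is holomorphic for \<open>Re s > 1 - K\<close>, so one continues from half-plane to half-plane.\<close>

definition tay_rem :: "nat \<Rightarrow> nat \<Rightarrow> complex \<Rightarrow> complex" where
  "tay_rem K n s = of_nat (Suc (Suc n)) powr (1 - s) -
     (\<Sum>k\<le>K. ((1 - s) gchoose k) * of_nat (Suc n) powr (1 - s - of_nat k))"

lemma holomorphic_on_gchoose: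
  "(\<lambda>s. (1 - s) gchoose k) holomorphic_on (A :: complex set)"
  unfolding gbinomial_prod_rev by (intro holomorphic_intros) auto

lemma tay_rem_bound:
  assumes "Re s > - real K"
  shows "norm (tay_rem K n s) \<le>
           real (Suc K) * norm ((1 - s) gchoose (Suc K)) * real (Suc n) powr (- Re s - real K)"
proof -
  define a where "a = 1 - s"
  define f where "f = (\<lambda>i z. fact i * (a gchoose i) * z powr (a - of_nat i))"
  define w where "w = complex_of_real (real (Suc n))"
  define z where "z = complex_of_real (real (Suc (Suc n)))"
  let ?S = "complex_of_real ` {real (Suc n)..real (Suc (Suc n))}"
  define B where "B = norm (fact (Suc K) * (a gchoose Suc K)) * real (Suc n) powr (- Re s - real K)"
  have "norm (f 0 z - (\<Sum>i\<le>K. f i w * (z - w) ^ i / fact i)) \<le> B * norm (z - w) ^ Suc K / fact K"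
  proof (rule complex_Taylor)
    show "convex ?S"
      by (intro convex_linear_image convex_real_interval) (auto simp: linear_of_real)
  next
    fix i x assume "x \<in> ?S" "i \<le> K"
    then obtain r where r: "x = of_real r" "r \<ge> real (Suc n)" by auto
    have "x \<notin> \<real>\<^sub>\<le>\<^sub>0" using r by (auto simp: complex_nonpos_Reals_iff)
    hence "(f i has_field_derivative fact i * (a gchoose i) *
             ((a - of_nat i) * x powr (a - of_nat i - 1))) (at x)"
      unfolding f_def by (intro DERIV_cmult has_field_derivative_powr)
    moreover have "fact i * (a gchoose i) * ((a - of_nat i) * x powr (a - of_nat i - 1)) = f (Suc i) x"
    proof -
      have "(a - of_nat i) * (a gchoose i) = of_nat (Suc i) * (a gchoose Suc i)"
        using gbinomial_mult_1[of a i] by (simp add: algebra_simps)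
      moreover have "fact i * (a gchoose i) * ((a - of_nat i) * x powr (a - of_nat i - 1)) =
          fact i * ((a - of_nat i) * (a gchoose i)) * x powr (a - of_nat i - 1)"
        by (simp only: mult_ac)
      ultimately show ?thesis by (simp add: f_def algebra_simps)
    qed
    ultimately show "(f i has_field_derivative f (Suc i) x) (at x within ?S)"
      by (auto intro: has_field_derivative_at_within)
  next
    fix x assume "x \<in> ?S"
    then obtain r where r: "x = of_real r" "r \<ge> real (Suc n)" by auto
    have "norm (x powr (a - of_nat (Suc K))) = r powr (- Re s - real K)"
      using r by (subst norm_powr_real_powr) (auto simp: a_def)
    also have "\<dots> \<le> real (Suc n) powr (- Re s - real K)"
      using r assms by (intro powr_mono2') auto
    finally show "norm (f (Suc K) x) \<le> B"
      unfolding f_def B_def norm_mult by (intro mult_left_mono) auto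
  next
    show "w \<in> ?S" unfolding w_def by (rule imageI) simp
    show "z \<in> ?S" unfolding z_def by (rule imageI) simp
  qed
  moreover have "z - w = 1" by (simp add: z_def w_def)
  ultimately have *: "norm (f 0 z - (\<Sum>i\<le>K. f i w / fact i)) \<le> B / fact K" by simp
  have "f 0 z - (\<Sum>i\<le>K. f i w / fact i) = tay_rem K n s"
    unfolding tay_rem_def f_def by (simp add: a_def w_def z_def add_ac)
  moreover have "B / fact K = real (Suc K) * norm ((1 - s) gchoose (Suc K)) * real (Suc n) powr (- Re s - real K)"
    by (simp add: B_def a_def norm_mult norm_fact del: of_nat_Suc)
  ultimately show ?thesis using * by simp
qed

lemma sums_tay_rem_holomorphic:
  "(\<lambda>s. \<Sum>n. tay_rem K n s) holomorphic_on {s. Re s > 1 - real K}"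
proof (rule holomorphic_uniform_sequence)
  show "open {s. Re s > 1 - real K}" by (rule open_halfspace_Re_gt)
  show "(\<lambda>s. \<Sum>i<n. tay_rem K i s) holomorphic_on {s. Re s > 1 - real K}" for n
    unfolding tay_rem_def by (intro holomorphic_intros holomorphic_on_gchoose)
  fix s assume s: "s \<in> {s. Re s > 1 - real K}"
  define d where "d = (Re s - (1 - real K)) / 2"
  have d: "d > 0" "Re s - d > 1 - real K"
    using s by (auto simp: d_def field_simps)
  have Re: "Re z \<ge> Re s - d" if "z \<in> cball s d" for z
    using that abs_Re_le_cmod[of "s - z"] by (auto simp: dist_norm)
  have "compact ((\<lambda>s. (1 - s) gchoose (Suc K)) ` cball s d)"
    by (intro compact_continuous_image holomorphic_on_imp_continuous_on holomorphic_on_gchoose) auto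
  then obtain C where C: "\<And>z. z \<in> cball s d \<Longrightarrow> norm ((1 - z) gchoose (Suc K)) \<le> C"
    by (fastforce dest!: compact_imp_bounded simp: bounded_iff simp del: mem_cball)
  have "uniform_limit (cball s d) (\<lambda>n s. \<Sum>i<n. tay_rem K i s) (\<lambda>s. \<Sum>n. tay_rem K n s) sequentially"
  proof (rule Weierstrass_m_test)
    fix n z assume z: "z \<in> cball s d"
    have "norm (tay_rem K n z) \<le> real (Suc K) * norm ((1 - z) gchoose (Suc K)) * real (Suc n) powr (- Re z - real K)"
      using Re[OF z] d by (intro tay_rem_bound) auto
    also have "\<dots> \<le> real (Suc K) * C * real (Suc n) powr (- (Re s - d) - real K)"
      using Re[OF z] C[OF z] order_trans[OF norm_ge_zero C[OF z]]
      by (intro mult_mono powr_mono mult_nonneg_nonneg) auto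
    finally show "norm (tay_rem K n z) \<le> real (Suc K) * C * real (Suc n) powr (- (Re s - d) - real K)" .
  next
    have "summable (\<lambda>n. real n powr (- (Re s - d) - real K))"
      using d by (subst summable_real_powr_iff) auto
    thus "summable (\<lambda>n. real (Suc K) * C * real (Suc n) powr (- (Re s - d) - real K))"
      by (intro summable_mult) (subst summable_Suc_iff)
  qed
  moreover have "cball s d \<subseteq> {s. Re s > 1 - real K}" using Re d by force
  ultimately show "\<exists>d>0. cball s d \<subseteq> {s. Re s > 1 - real K} \<and>
      uniform_limit (cball s d) (\<lambda>n s. \<Sum>i<n. tay_rem K i s) (\<lambda>s. \<Sum>n. tay_rem K n s) sequentially"
    using d by blast
qed

lemma zeta_series_summable:
  assumes "Re s > 1"
  shows "summable (\<lambda>n. (of_nat (Suc n) :: complex) powr (- s))"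
proof (rule summable_norm_cancel)
  have "summable (\<lambda>n. real n powr (- Re s))" using assms by (subst summable_real_powr_iff) auto
  hence "summable (\<lambda>n. real (Suc n) powr (- Re s))" by (subst summable_Suc_iff)
  moreover have "norm ((of_nat (Suc n) :: complex) powr (- s)) = real (Suc n) powr (- Re s)" for n
    by (subst norm_powr_real_powr) auto
  ultimately show "summable (\<lambda>n. norm ((of_nat (Suc n) :: complex) powr (- s)))" by simp
qed

definition zeta_series :: "complex \<Rightarrow> complex" where
  "zeta_series s = (\<Sum>n. of_nat (Suc n) powr (- s))"

lemma zeta_series_recurrence:
  assumes "Re s > 1"
  shows "(s - 1) * zeta_series s = 1 + (\<Sum>n. tay_rem (Suc M) n s) -
           (\<Sum>j<M. ((1 - s) gchoose (Suc j)) / of_nat (j + 2) *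
              ((s + of_nat (Suc j) - 1) * zeta_series (s + of_nat (Suc j))))"
proof -
  define a where "a = 1 - s"
  have "(\<lambda>n. complex_of_real (real (Suc n) powr (1 - Re s))) \<longlonglongrightarrow> of_real 0"
    using assms by (intro tendsto_of_real tendsto_neg_powr filterlim_compose[OF filterlim_real_sequentially filterlim_Suc]) auto
  moreover have "norm ((of_nat (Suc n) :: complex) powr a) = norm (complex_of_real (real (Suc n) powr (1 - Re s)))" for n
    by (subst norm_powr_real_powr) (auto simp: a_def)
  ultimately have lim: "(\<lambda>n. (of_nat (Suc n) :: complex) powr a) \<longlonglongrightarrow> 0"
    by (metis (no_types, lifting) ext of_real_0 tendsto_norm_zero_iff)
  have tel: "(\<lambda>n. of_nat (Suc (Suc n)) powr a - (of_nat (Suc n) :: complex) powr a) sums (- 1)"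
    using telescope_sums[OF lim] by simp
  have pw: "a - of_nat (Suc k) = - (s + of_nat k)" for k by (simp add: a_def)
  have ser: "(\<lambda>n. (a gchoose Suc k) * (of_nat (Suc n) :: complex) powr (a - of_nat (Suc k)))
               sums ((a gchoose Suc k) * zeta_series (s + of_nat k))" for k
    unfolding zeta_series_def pw using assms
    by (intro sums_mult summable_sums zeta_series_summable) auto
  have "tay_rem (Suc M) n s = (of_nat (Suc (Suc n)) powr a - of_nat (Suc n) powr a) -
          (\<Sum>k<Suc M. (a gchoose Suc k) * of_nat (Suc n) powr (a - of_nat (Suc k)))" for n
    unfolding tay_rem_def lessThan_Suc_atMost[symmetric] 
    by (subst sum.lessThan_Suc_shift) (simp add: a_def del: of_nat_Suc sum.lessThan_Suc gbinomial_Suc)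
  hence "(\<lambda>n. tay_rem (Suc M) n s) sums
           (- 1 - (\<Sum>k<Suc M. (a gchoose Suc k) * zeta_series (s + of_nat k)))"
    by (simp only:) (intro sums_diff tel sums_sum ser)
  hence "(\<Sum>n. tay_rem (Suc M) n s) = 
           (- 1 - (\<Sum>k<Suc M. (a gchoose Suc k) * zeta_series (s + of_nat k)))"
    by (rule sums_unique[symmetric])
  also have "(\<Sum>k<Suc M. (a gchoose Suc k) * zeta_series (s + of_nat k)) =
     a * zeta_series s + (\<Sum>j<M. (a gchoose Suc (Suc j)) * zeta_series (s + of_nat (Suc j)))"
    by (subst sum.lessThan_Suc_shift) simp
  also have "(\<Sum>j<M. (a gchoose Suc (Suc j)) * zeta_series (s + of_nat (Suc j))) =
     - (\<Sum>j<M. (a gchoose (Suc j)) / of_nat (j + 2) *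
              ((s + of_nat (Suc j) - 1) * zeta_series (s + of_nat (Suc j))))"
    unfolding sum_negf[symmetric]
  proof (rule sum.cong)
    fix j
    have "(of_nat (j + 2) :: complex) \<noteq> 0" by (subst of_nat_eq_0_iff) simp
    moreover have "of_nat (j + 2) * (a gchoose Suc (Suc j)) = (a - of_nat (Suc j)) * (a gchoose Suc j)"
      using gbinomial_mult_1[of a "Suc j"] by (simp add: algebra_simps)
    ultimately have "(a gchoose Suc (Suc j)) = (a - of_nat (Suc j)) * (a gchoose Suc j) / of_nat (j + 2)"
      by (simp add: field_simps del: of_nat_add)
    moreover have "g * Z = - (p / N * (Q * Z))" if "g = u * p / N" "u = - Q" for g p N Q Z u :: complex
      using that by simp
    moreover have "a - of_nat (Suc j) = - (s + of_nat (Suc j) - 1)" by (simp add: a_def)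
    ultimately show "(a gchoose Suc (Suc j)) * zeta_series (s + of_nat (Suc j)) =
     - ((a gchoose (Suc j)) / of_nat (j + 2) *
              ((s + of_nat (Suc j) - 1) * zeta_series (s + of_nat (Suc j))))"
      by blast
  qed simp
  finally show ?thesis by (simp add: a_def algebra_simps)
qed

lemma zeta_continuation_halfplane:
  "\<exists>F. F holomorphic_on {s. Re s > - real M} \<and> (\<forall>s. Re s > 1 \<longrightarrow> F s = (s - 1) * zeta_series s)"
proof (induction M)
  case 0
  show ?case
    using sums_tay_rem_holomorphic[of 1] zeta_series_recurrence[of _ 0]
    by (intro exI[of _ "\<lambda>s. 1 + (\<Sum>n. tay_rem 1 n s)"]) (auto intro!: holomorphic_intros)
next
  case (Suc M)
  then obtain F where F: "F holomorphic_on {s. Re s > - real M}"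
    and eq: "\<And>s. Re s > 1 \<Longrightarrow> F s = (s - 1) * zeta_series s" by blast
  define G where "G = (\<lambda>s. 1 + (\<Sum>n. tay_rem (Suc (Suc M)) n s) -
      (\<Sum>j<Suc M. ((1 - s) gchoose (Suc j)) / of_nat (j + 2) * F (s + of_nat (Suc j))))"
  have "(F \<circ> (\<lambda>s. s + of_nat (Suc j))) holomorphic_on {s. Re s > - real (Suc M)}" for j
    by (rule holomorphic_on_compose_gen[OF _ F]) (auto intro!: holomorphic_intros)
  hence "(\<lambda>s. F (s + of_nat (Suc j))) holomorphic_on {s. Re s > - real (Suc M)}" for j
    by (simp add: o_def)
  moreover have "(\<lambda>s. \<Sum>n. tay_rem (Suc (Suc M)) n s) holomorphic_on {s. Re s > - real (Suc M)}"
    using sums_tay_rem_holomorphic[of "Suc (Suc M)"] by simp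
  ultimately have "G holomorphic_on {s. Re s > - real (Suc M)}"
    unfolding G_def by (intro holomorphic_intros holomorphic_on_gchoose) (auto simp del: of_nat_add)
  moreover have "G s = (s - 1) * zeta_series s" if "Re s > 1" for s
  proof -
    have "F (s + of_nat (Suc j)) = (s + of_nat (Suc j) - 1) * zeta_series (s + of_nat (Suc j))" for j
      using that by (intro eq) auto
    thus ?thesis using zeta_series_recurrence[OF that, of "Suc M"] unfolding G_def by simp
  qed
  ultimately show ?case by blast
qed

lemma is_zeta_exists: "\<exists>f. is_zeta f"
proof -
  obtain F where F: "\<And>M. F M holomorphic_on {s. Re s > - real M}"
    and eq: "\<And>M s. Re s > 1 \<Longrightarrow> F M s = (s - 1) * zeta_series s"
    using zeta_continuation_halfplane by metis
  have agree: "F M s = F N s" if "Re s > - real M" "M \<le> N" for M N s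
  proof (rule analytic_continuation_open[of "{z. Re z > 1}" "{z. Re z > - real M}" "F M" "F N"])
    show "connected {z. Re z > - real M}" by (intro convex_connected convex_halfspace_Re_gt)
    show "{z. Re z > 1} \<noteq> {}" by (auto intro!: exI[of _ 2])
    show "F N holomorphic_on {z. Re z > - real M}"
      using that by (intro holomorphic_on_subset[OF F[of N]]) auto
  qed (use that eq F open_halfspace_Re_gt in auto)
  define G where "G = (\<lambda>s. F (nat \<lceil>- Re s\<rceil> + 1) s)"
  have G: "G s = F M s" if "Re s > - real M" for M s
  proof -
    have "Re s > - real (nat \<lceil>- Re s\<rceil> + 1)" by linarith
    thus ?thesis unfolding G_def using agree that by (metis nat_le_linear)
  qed
  have "G holomorphic_on (\<Union>M. {s. Re s > - real M})"
  proof (rule holomorphic_on_UN_open)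
    show "G holomorphic_on {s. Re s > - real M}" for M
      by (rule holomorphic_transform[OF F[of M]]) (simp add: G)
  qed (auto intro: open_halfspace_Re_gt)
  also have "(\<Union>M. {s. Re s > - real M}) = UNIV"
  proof (intro equalityI subsetI)
    fix s :: complex
    obtain M :: nat where "- Re s < real M" using reals_Archimedean2 by blast
    thus "s \<in> (\<Union>M. {s. Re s > - real M})" by (auto intro!: exI[of _ M])
  qed auto
  finally have hol: "G holomorphic_on UNIV" .
  define f where "f = (\<lambda>s. if s = 1 then 0 else G s / (s - 1))"
  have "(\<lambda>s. G s / (s - 1)) holomorphic_on (- {1})"
    using holomorphic_on_subset[OF hol] by (intro holomorphic_intros) auto
  hence "f holomorphic_on (- {1})"
    by (rule holomorphic_transform) (auto simp: f_def)
  moreover have "(\<lambda>n. of_nat (Suc n) powr (- s)) sums f s" if "Re s > 1" for s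
  proof -
    have "f s = zeta_series s" using that G[of 0 s] eq[of s 0] by (auto simp: f_def)
    thus ?thesis using summable_sums[OF zeta_series_summable[OF that]] by (simp add: zeta_series_def)
  qed
  ultimately show ?thesis unfolding is_zeta_def f_def by auto
qed

lemma is_zeta_zeta: "is_zeta zeta"
  unfolding zeta_def using is_zeta_exists is_zeta_unique by (metis theI)

definition Riemann_Hypothesis :: bool where
  "Riemann_Hypothesis \<longleftrightarrow>
     (\<forall>s. 0 < Re s \<and> Re s < 1 \<and> zeta s = 0 \<longrightarrow> Re s = 1 / 2)"

definition chebyshev_psi :: "real \<Rightarrow> real" where
  "chebyshev_psi x = (\<Sum>n | 1 \<le> n \<and> real n \<le> x. mangoldt n)"

definition gauss_moment :: "nat \<Rightarrow> real" where
  "gauss_moment k = (\<Prod>j | j < k \<and> odd j. real j)"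

definition const_E :: real where
  "const_E = 2 * pi * exp (euler_mascheroni - 1)"

text \<open>\<open>A(X,h) \<sim> B(X,h)\<close> as \<open>X \<rightarrow> \<infinity>\<close>, uniformly for \<open>h\<close> in the range \<open>R X\<close>, which may
  depend on \<open>X\<close> (so \<open>uniform_limit\<close>, whose domain is fixed, does not apply).\<close>

definition asymp_equiv_uniformly ::
    "(real \<Rightarrow> real set) \<Rightarrow> (real \<Rightarrow> real \<Rightarrow> real) \<Rightarrow> (real \<Rightarrow> real \<Rightarrow> real) \<Rightarrow> bool" where
  "asymp_equiv_uniformly R A B \<longleftrightarrow>
     (\<forall>\<eta>>0. \<forall>\<^sub>F X in at_top. \<forall>h\<in>R X. \<bar>A X h / B X h - 1\<bar> < \<eta>)"

end

theory Submission
  imports Defs "HOL-Real_Asymp.Real_Asymp"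
begin

text \<open>
  Put \<open>R x = \<psi> x - x\<close> and \<open>k = 2 m\<close>. Both asymptotic formulas concern
  \<open>\<integral> (R (x + t x\<^sup>p) - R x)\<^sup>k dx\<close>, with \<open>p = 0\<close> for a fixed length and \<open>p = 1\<close> for a length
  proportional to \<open>x\<close>, and both main terms are integrals over \<open>x\<close> of one density
  \<open>\<mu> (s log (x / (E s)))\<^sup>m\<close> evaluated at the current length \<open>s = t x\<^sup>p\<close>. So both formulas say
  the same about a thin slice \<open>[Y, \<rho> Y]\<close>, namely that the moment over it is about
  \<open>(\<rho> - 1) Y\<close> times the density at \<open>(Y, s)\<close>. Taking differences of the long integrals gives the slice
  statement (\<open>moment_asymp_imp_slice_asymp\<close>), where the density varies slowly enough for the
  increments of the main term to be known. Conversely, geometric slices telescope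
  back to the long range without loss, because the error on each slice is a small multiple of the
  increment of the main term (\<open>slice_asymp_imp_moment_asymp\<close>).

  On a slice the lengths \<open>s\<close> and \<open>s (x / Y)\<close> differ by a factor between \<open>1\<close> and \<open>\<rho>\<close> only, but the
  integrand depends on the length in an uncontrolled way, so the two shapes cannot be compared
  for a single \<open>s\<close>. The comparison is made after averaging over
  \<open>\<sigma> \<in> [\<kappa> s, \<kappa>\<^sup>2 s]\<close>: the substitution that turns one shape into the other for fixed \<open>x\<close> only moves
  the ends of this interval, by factors that tend to \<open>1\<close> with \<open>\<rho>\<close>. The average
  is then compared with the value at \<open>s\<close> itself, since the intervals of lengths
  \<open>s\<close> and \<open>\<sigma>\<close> from \<open>x\<close> differ by an interval of length \<open>\<sigma> - s\<close>, which is small compared with \<open>s\<close>. The moment of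
  this difference is again an average of the same kind, now over lengths of order \<open>(\<kappa> - 1) s\<close>, and contributes a
  factor of order \<open>(\<kappa> - 1)\<^sup>m\<close> (\<open>slice_transfer\<close> and \<open>slice_asymp_transfer\<close>). The parameters are chosen in
  the order: weight \<open>c\<close> of the splitting, then \<open>\<kappa>\<close>, then \<open>\<rho>\<close>, then \<open>Y\<close>.

  What is left is the part of the long range where \<open>x\<close> is too small for the length to lie between
  \<open>x\<^sup>\<epsilon>\<close> and \<open>x powr (1 - \<epsilon>)\<close>. For \<open>p = 1\<close> the intervals there are so short that counting integers
  is enough (\<open>tail_negligible_1\<close>). For \<open>p = 0\<close> they are nearly as long as \<open>x\<close> or much longer, and one needs
  \<open>\<integral>\<^sub>1\<^sup>X R\<^sup>k = O(X powr (m + 1 + b))\<close> for every \<open>b > 0\<close>. This follows from the formula for \<open>p = 1\<close>: split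
  \<open>[x, 2 x]\<close> into about \<open>X\<^sup>e\<close> pieces \<open>[y, (1 + \<delta>) y]\<close> to bound the moment of \<open>R (2 x) - R x\<close>, then double \<open>X\<close>
  repeatedly (\<open>remainder_moment_growth\<close>, used in \<open>tail_negligible_0\<close>).
\<close>

section \<open>Elementary inequalities\<close>

lemma filterlim_power2_at_right_1: "filterlim (\<lambda>\<rho>::real. \<rho>\<^sup>2) (at_right 1) (at_right 1)"
  by real_asymp

lemma power_Suc_diff_bounds:
  fixes x y :: real
  assumes "0 \<le> y" "y \<le> x"
  shows "(x - y) * y ^ n \<le> (x ^ (n + 1) - y ^ (n + 1)) / (real n + 1)"
    and "(x ^ (n + 1) - y ^ (n + 1)) / (real n + 1) \<le> (x - y) * x ^ n"
proof -
  have eq: "x ^ (n + 1) - y ^ (n + 1) = (x - y) * (\<Sum>i<n + 1. y ^ (n + 1 - Suc i) * x ^ i)"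
    by (rule power_diff_sumr2)
  have between: "y ^ n \<le> y ^ (n + 1 - Suc i) * x ^ i" "y ^ (n + 1 - Suc i) * x ^ i \<le> x ^ n" if "i < n + 1" for i
  proof -
    have split: "z ^ n = z ^ (n + 1 - Suc i) * z ^ i" for z :: real
      using that by (simp add: power_add[symmetric])
    show "y ^ n \<le> y ^ (n + 1 - Suc i) * x ^ i"
      unfolding split[of y] using assms by (intro mult_left_mono power_mono) auto
    show "y ^ (n + 1 - Suc i) * x ^ i \<le> x ^ n"
      unfolding split[of x] using assms by (intro mult_right_mono power_mono) auto
  qed
  have "(\<Sum>i<n + 1. y ^ n) \<le> (\<Sum>i<n + 1. y ^ (n + 1 - Suc i) * x ^ i)"
    by (rule sum_mono) (rule between, simp)
  hence "(x - y) * ((real n + 1) * y ^ n) \<le> (x - y) * (\<Sum>i<n + 1. y ^ (n + 1 - Suc i) * x ^ i)"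
    using assms by (intro mult_left_mono) (auto simp: algebra_simps)
  thus "(x - y) * y ^ n \<le> (x ^ (n + 1) - y ^ (n + 1)) / (real n + 1)"
    unfolding eq by (simp add: field_simps)
  have "(\<Sum>i<n + 1. y ^ (n + 1 - Suc i) * x ^ i) \<le> (\<Sum>i<n + 1. x ^ n)"
    by (rule sum_mono) (rule between, simp)
  hence "(x - y) * (\<Sum>i<n + 1. y ^ (n + 1 - Suc i) * x ^ i) \<le> (x - y) * ((real n + 1) * x ^ n)"
    using assms by (intro mult_left_mono) (auto simp: algebra_simps)
  thus "(x ^ (n + 1) - y ^ (n + 1)) / (real n + 1) \<le> (x - y) * x ^ n"
    unfolding eq by (simp add: field_simps)
qed

lemma power_le_one_bounds:
  fixes \<rho> :: real assumes "1 \<le> \<rho>" "p \<le> (1::nat)" shows "1 \<le> \<rho> ^ p" "\<rho> ^ p \<le> \<rho>"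
  using assms by (cases p; auto)+

lemma relative_error_le:
  fixes J g \<eta> :: real
  assumes "\<bar>J / g - 1\<bar> < \<eta>" "\<eta> \<le> 1" "0 \<le> g"
  shows "\<bar>J - g\<bar> \<le> \<eta> * g"
proof -
  have "g \<noteq> 0" using assms by auto
  hence "J - g = (J / g - 1) * g" by (simp add: field_simps)
  hence "\<bar>J - g\<bar> = \<bar>J / g - 1\<bar> * g" using assms by (simp add: abs_mult)
  thus ?thesis using assms by (simp add: mult_right_mono)
qed

lemma root_two_bounds:
  assumes "0 < n"
  shows "ln 2 / real n \<le> 2 powr (1 / real n) - 1" "2 powr (1 / real n) - 1 \<le> 1 / real n"
proof -
  have "1 + ln 2 / real n \<le> exp (ln 2 / real n)" by (rule exp_ge_add_one_self)
  also have "exp (ln 2 / real n) = 2 powr (1 / real n)" by (simp add: powr_def)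
  finally show "ln 2 / real n \<le> 2 powr (1 / real n) - 1" by simp
  have "1 + real n * (1 / real n) \<le> (1 + 1 / real n) ^ n" by (rule Bernoulli_inequality) (simp add: order_trans[of _ 0])
  hence "2 \<le> (1 + 1 / real n) ^ n" using assms by simp
  hence "2 powr (1 / real n) \<le> ((1 + 1 / real n) ^ n) powr (1 / real n)" by (intro powr_mono2) auto
  also have "(1 + 1 / real n) ^ n = (1 + 1 / real n) powr real n"
    using assms by (intro powr_realpow[symmetric]) (simp add: add_pos_pos)
  also have "\<dots> powr (1 / real n) = 1 + 1 / real n" using assms by (simp add: powr_powr)
  finally show "2 powr (1 / real n) - 1 \<le> 1 / real n" by simp
qed

text \<open>A substitute for Minkowski's inequality that works pointwise: either \<open>b\<close> is small compared with \<open>a\<close>,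
  or \<open>a\<close> is at most \<open>b / c\<close>. With small \<open>c\<close> the term in \<open>a\<close> is kept almost without loss.\<close>

lemma even_power_add_le:
  fixes a b c :: real
  assumes "c > 0"
  shows "(a + b) ^ (2 * m) \<le> (1 + c) ^ (2 * m) * a ^ (2 * m) + (1 + 1 / c) ^ (2 * m) * b ^ (2 * m)"
proof -
  have even: "x ^ (2 * m) = \<bar>x\<bar> ^ (2 * m)" for x :: real
    by (simp add: power_even_abs)
  have nn: "0 \<le> (1 + c) ^ (2 * m) * a ^ (2 * m)" "0 \<le> (1 + 1 / c) ^ (2 * m) * b ^ (2 * m)"
    using assms by (auto intro!: mult_nonneg_nonneg simp: even[of a] even[of b])
  show ?thesis
  proof (cases "\<bar>b\<bar> \<le> c * \<bar>a\<bar>")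
    case True
    have "\<bar>a + b\<bar> \<le> (1 + c) * \<bar>a\<bar>" using True abs_triangle_ineq[of a b] by (simp add: algebra_simps)
    hence "\<bar>a + b\<bar> ^ (2 * m) \<le> ((1 + c) * \<bar>a\<bar>) ^ (2 * m)" by (intro power_mono) auto
    hence "(a + b) ^ (2 * m) \<le> (1 + c) ^ (2 * m) * a ^ (2 * m)"
      by (simp only: even[of "a + b"] even[of a] power_mult_distrib)
    thus ?thesis using nn by linarith
  next
    case False
    hence "\<bar>a\<bar> \<le> \<bar>b\<bar> / c" using assms by (simp add: field_simps)
    hence "\<bar>a + b\<bar> \<le> (1 + 1 / c) * \<bar>b\<bar>" using abs_triangle_ineq[of a b] by (simp add: algebra_simps)
    hence "\<bar>a + b\<bar> ^ (2 * m) \<le> ((1 + 1 / c) * \<bar>b\<bar>) ^ (2 * m)" by (intro power_mono) auto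
    hence "(a + b) ^ (2 * m) \<le> (1 + 1 / c) ^ (2 * m) * b ^ (2 * m)"
      by (simp only: even[of "a + b"] even[of b] power_mult_distrib)
    thus ?thesis using nn by linarith
  qed
qed

lemma even_power_sum_le:
  fixes a :: "nat \<Rightarrow> real"
  assumes "n > 0"
  shows "(\<Sum>j<n. a j) ^ (2 * m) \<le> real n ^ (2 * m) * (\<Sum>j<n. a j ^ (2 * m))"
proof -
  have "\<exists>j<n. \<forall>i<n. \<bar>a i\<bar> \<le> \<bar>a j\<bar>"
  proof -
    have "Max ((\<lambda>j. \<bar>a j\<bar>) ` {..<n}) \<in> (\<lambda>j. \<bar>a j\<bar>) ` {..<n}" using assms by (intro Max_in) auto
    then obtain j where "j < n" "\<bar>a j\<bar> = Max ((\<lambda>j. \<bar>a j\<bar>) ` {..<n})" by auto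
    thus ?thesis by (intro exI[of _ j]) auto
  qed
  then obtain j where j: "j < n" "\<And>i. i < n \<Longrightarrow> \<bar>a i\<bar> \<le> \<bar>a j\<bar>" by blast
  have even: "x ^ (2 * m) = \<bar>x\<bar> ^ (2 * m)" for x :: real by (simp add: power_even_abs)
  have "\<bar>\<Sum>j<n. a j\<bar> \<le> (\<Sum>i<n. \<bar>a i\<bar>)" by (rule sum_abs)
  also have "\<dots> \<le> (\<Sum>i<n. \<bar>a j\<bar>)" using j by (intro sum_mono) auto
  finally have "\<bar>\<Sum>j<n. a j\<bar> \<le> real n * \<bar>a j\<bar>" by simp
  hence "\<bar>\<Sum>j<n. a j\<bar> ^ (2 * m) \<le> (real n * \<bar>a j\<bar>) ^ (2 * m)" by (intro power_mono) auto
  also have "\<dots> = real n ^ (2 * m) * a j ^ (2 * m)" by (simp only: power_mult_distrib even[of "a j"])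
  also have "\<dots> \<le> real n ^ (2 * m) * (\<Sum>j<n. a j ^ (2 * m))"
    using j by (intro mult_left_mono member_le_sum) auto
  finally show ?thesis by (simp only: even[of "\<Sum>j<n. a j"])
qed

section \<open>Changes of variable in integrals\<close>

lemma nn_integral_eq_integral_interval:
  fixes f :: "real \<Rightarrow> real"
  assumes [measurable]: "f \<in> borel_measurable borel"
    and "\<And>x. x \<in> {a..b} \<Longrightarrow> 0 \<le> f x" "\<And>x. x \<in> {a..b} \<Longrightarrow> f x \<le> B"
  shows "f integrable_on {a..b}"
    and "(\<integral>\<^sup>+x. ennreal (f x) * indicator {a..b} x \<partial>lborel) = ennreal (integral {a..b} f)"
proof -
  have "set_integrable lborel {a..b} f"
    unfolding set_integrable_def
  proof (rule Bochner_Integration.integrable_bound)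
    show "integrable lborel (\<lambda>x. B * indicator {a..b} x :: real)"
      by (intro integrable_mult_right integrable_real_indicator) (auto simp: emeasure_lborel_Icc_eq)
    show "AE x in lborel. norm (indicator {a..b} x *\<^sub>R f x) \<le> norm (B * indicator {a..b} x :: real)"
      using assms(2,3) by (intro AE_I2) (force simp: indicator_def)
  qed auto
  thus int: "f integrable_on {a..b}" by (rule set_borel_integral_eq_integral(1))
  show "(\<integral>\<^sup>+x. ennreal (f x) * indicator {a..b} x \<partial>lborel) = ennreal (integral {a..b} f)"
    using assms(2) int by (intro nn_integral_has_integral_lebesgue' integrable_integral)
qed

lemma nn_integral_affine_interval:
  fixes G :: "real \<Rightarrow> ennreal"
  assumes [measurable]: "G \<in> borel_measurable borel" and r: "r > 0"
  shows "(\<integral>\<^sup>+\<tau>. G \<tau> * indicator {(\<alpha> - b) * r..(\<beta> - b) * r} \<tau> \<partial>lborel) =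
         ennreal r * (\<integral>\<^sup>+\<sigma>. G ((\<sigma> - b) * r) * indicator {\<alpha>..\<beta>} \<sigma> \<partial>lborel)"
proof -
  have "indicator {(\<alpha> - b) * r..(\<beta> - b) * r} (- b * r + r * \<sigma>) = (indicator {\<alpha>..\<beta>} \<sigma> :: ennreal)" for \<sigma>
  proof -
    have "- b * r + r * \<sigma> = (\<sigma> - b) * r" by (simp add: algebra_simps)
    thus ?thesis using r by (simp add: indicator_def mult_le_cancel_right)
  qed
  moreover have "- b * r + r * \<sigma> = (\<sigma> - b) * r" for \<sigma> by (simp add: algebra_simps)
  ultimately show ?thesis
    using r by (subst nn_integral_real_affine[of _ r "- b * r"]) (auto simp: algebra_simps)
qed

text \<open>Replacing the variable \<open>(\<sigma> - b) r\<close> by \<open>\<tau>\<close> costs at most a factor \<open>\<rho>\<close> and moves the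
  ends of the interval by at most a factor \<open>\<rho>\<close>, uniformly in the ratio \<open>r\<close>. The new range of
  integration no longer depends on \<open>r\<close>, which makes it possible to exchange the order of integration
  when \<open>r\<close> is a function of the other variable.\<close>

lemma nn_integral_dilate_le:
  fixes G :: "real \<Rightarrow> ennreal"
  assumes [measurable]: "G \<in> borel_measurable borel"
    and r: "1 / \<rho> \<le> r" "r \<le> \<rho>" "\<rho> > 0" and ab: "b \<le> \<alpha>" "\<alpha> \<le> \<beta>"
  shows "(\<integral>\<^sup>+\<sigma>. G ((\<sigma> - b) * r) * indicator {\<alpha>..\<beta>} \<sigma> \<partial>lborel) \<le>
         ennreal \<rho> * (\<integral>\<^sup>+\<tau>. G \<tau> * indicator {(\<alpha> - b) / \<rho>..(\<beta> - b) * \<rho>} \<tau> \<partial>lborel)"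
proof -
  have "0 < 1 / \<rho>" using r by simp
  hence r0: "r > 0" using r by linarith
  have le: "(\<alpha> - b) / \<rho> \<le> (\<alpha> - b) * r" "(\<beta> - b) * r \<le> (\<beta> - b) * \<rho>"
    using mult_left_mono[OF r(1), of "\<alpha> - b"] mult_left_mono[OF r(2), of "\<beta> - b"] ab by auto
  have "(\<integral>\<^sup>+\<sigma>. G ((\<sigma> - b) * r) * indicator {\<alpha>..\<beta>} \<sigma> \<partial>lborel) =
        ennreal (1 / r) * (ennreal r * (\<integral>\<^sup>+\<sigma>. G ((\<sigma> - b) * r) * indicator {\<alpha>..\<beta>} \<sigma> \<partial>lborel))"
    using r0 by (simp add: mult.assoc[symmetric] ennreal_mult[symmetric])
  also have "\<dots> = ennreal (1 / r) * (\<integral>\<^sup>+\<tau>. G \<tau> * indicator {(\<alpha> - b) * r..(\<beta> - b) * r} \<tau> \<partial>lborel)"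
    using r0 by (subst nn_integral_affine_interval) auto
  also have "\<dots> \<le> ennreal \<rho> * (\<integral>\<^sup>+\<tau>. G \<tau> * indicator {(\<alpha> - b) / \<rho>..(\<beta> - b) * \<rho>} \<tau> \<partial>lborel)"
  proof (intro mult_mono ennreal_leI nn_integral_mono)
    show "1 / r \<le> \<rho>" using r r0 by (simp add: field_simps)
    show "indicator {(\<alpha> - b) * r..(\<beta> - b) * r} x \<le> (indicator {(\<alpha> - b) / \<rho>..(\<beta> - b) * \<rho>} x :: ennreal)" for x
      using le by (auto simp: indicator_def)
  qed auto
  finally show ?thesis .
qed

lemma nn_integral_dilate_ge:
  fixes G :: "real \<Rightarrow> ennreal"
  assumes [measurable]: "G \<in> borel_measurable borel"
    and r: "1 / \<rho> \<le> r" "r \<le> \<rho>" "\<rho> > 0" and ab: "0 \<le> \<alpha>" "\<alpha> \<le> \<beta>"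
  shows "(\<integral>\<^sup>+\<tau>. G \<tau> * indicator {\<alpha> * \<rho>..\<beta> / \<rho>} \<tau> \<partial>lborel) \<le>
         ennreal \<rho> * (\<integral>\<^sup>+\<sigma>. G (\<sigma> * r) * indicator {\<alpha>..\<beta>} \<sigma> \<partial>lborel)"
proof -
  have "0 < 1 / \<rho>" using r by simp
  hence r0: "r > 0" using r by linarith
  have le: "\<alpha> * r \<le> \<alpha> * \<rho>" "\<beta> / \<rho> \<le> \<beta> * r"
    using mult_left_mono[OF r(2), of \<alpha>] mult_left_mono[OF r(1), of \<beta>] ab by auto
  have "(\<integral>\<^sup>+\<tau>. G \<tau> * indicator {\<alpha> * \<rho>..\<beta> / \<rho>} \<tau> \<partial>lborel) \<le>
        (\<integral>\<^sup>+\<tau>. G \<tau> * indicator {(\<alpha> - 0) * r..(\<beta> - 0) * r} \<tau> \<partial>lborel)"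
    using le by (intro nn_integral_mono mult_left_mono) (auto simp: indicator_def)
  also have "\<dots> = ennreal r * (\<integral>\<^sup>+\<sigma>. G ((\<sigma> - 0) * r) * indicator {\<alpha>..\<beta>} \<sigma> \<partial>lborel)"
    using r0 by (subst nn_integral_affine_interval) auto
  also have "\<dots> \<le> ennreal \<rho> * (\<integral>\<^sup>+\<sigma>. G ((\<sigma> - 0) * r) * indicator {\<alpha>..\<beta>} \<sigma> \<partial>lborel)"
    using r by (intro mult_right_mono ennreal_leI) auto
  finally show ?thesis by simp
qed

lemma nn_integral_expand_le:
  fixes f :: "real \<Rightarrow> ennreal"
  assumes [measurable]: "f \<in> borel_measurable borel" and c: "c \<ge> 1"
  shows "(\<integral>\<^sup>+x. f (d + c * x) \<partial>lborel) \<le> (\<integral>\<^sup>+y. f y \<partial>lborel)"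
proof -
  have "(\<integral>\<^sup>+y. f y \<partial>lborel) = ennreal c * (\<integral>\<^sup>+x. f (d + c * x) \<partial>lborel)"
    using c by (subst nn_integral_real_affine[of _ c d]) auto
  moreover have "1 * (\<integral>\<^sup>+x. f (d + c * x) \<partial>lborel) \<le> ennreal c * (\<integral>\<^sup>+x. f (d + c * x) \<partial>lborel)"
    using c by (intro mult_right_mono) (auto simp: ennreal_1[symmetric] simp del: ennreal_1)
  ultimately show ?thesis by simp
qed

lemma nn_integral_swap_interval:
  fixes K :: "real \<Rightarrow> real \<Rightarrow> ennreal"
  assumes K: "case_prod K \<in> borel_measurable (borel \<Otimes>\<^sub>M borel)"
  shows "(\<integral>\<^sup>+x. (\<integral>\<^sup>+\<tau>. K x \<tau> * indicator {c..d} \<tau> \<partial>lborel) * indicator {a..b} x \<partial>lborel) =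
         (\<integral>\<^sup>+\<tau>. (\<integral>\<^sup>+x. K x \<tau> * indicator {a..b} x \<partial>lborel) * indicator {c..d} \<tau> \<partial>lborel)"
proof -
  have [measurable]: "case_prod K \<in> borel_measurable (lborel \<Otimes>\<^sub>M lborel)"
    using K by (simp cong: measurable_cong_sets sets_pair_measure_cong)
  have [measurable]: "(\<lambda>\<tau>. K x \<tau>) \<in> borel_measurable lborel" "(\<lambda>y. K y \<tau>) \<in> borel_measurable lborel" for x \<tau>
    by measurable
  have "(\<integral>\<^sup>+x. (\<integral>\<^sup>+\<tau>. K x \<tau> * indicator {c..d} \<tau> \<partial>lborel) * indicator {a..b} x \<partial>lborel) =
        (\<integral>\<^sup>+x. (\<integral>\<^sup>+\<tau>. K x \<tau> * indicator {c..d} \<tau> * indicator {a..b} x \<partial>lborel) \<partial>lborel)"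
    by (intro nn_integral_cong nn_integral_multc[symmetric]) measurable
  also have "\<dots> = (\<integral>\<^sup>+\<tau>. (\<integral>\<^sup>+x. K x \<tau> * indicator {c..d} \<tau> * indicator {a..b} x \<partial>lborel) \<partial>lborel)"
    by (rule lborel_pair.Fubini'[symmetric]) measurable
  also have "\<dots> = (\<integral>\<^sup>+\<tau>. (\<integral>\<^sup>+x. K x \<tau> * indicator {a..b} x * indicator {c..d} \<tau> \<partial>lborel) \<partial>lborel)"
    by (intro nn_integral_cong) (simp add: mult_ac)
  also have "\<dots> = (\<integral>\<^sup>+\<tau>. (\<integral>\<^sup>+x. K x \<tau> * indicator {a..b} x \<partial>lborel) * indicator {c..d} \<tau> \<partial>lborel)"
    by (intro nn_integral_cong nn_integral_multc) measurable
  finally show ?thesis .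
qed

lemma nn_integral_const_interval:
  fixes a b A :: real
  assumes "a \<le> b" "0 \<le> A"
  shows "(\<integral>\<^sup>+x. ennreal A * indicator {a..b} x \<partial>lborel) = ennreal ((b - a) * A)"
  using assms by (subst nn_integral_cmult_indicator) (auto simp: ennreal_mult mult.commute)

lemma integral_affine_real:
  fixes f :: "real \<Rightarrow> real"
  assumes f: "f integrable_on {c * a + d..c * b + d}" and c: "0 < c"
  shows "(\<lambda>x. f (c * x + d)) integrable_on {a..b}"
    and "c * integral {a..b} (\<lambda>x. f (c * x + d)) = integral {c * a + d..c * b + d} f"
proof -
  have img: "(\<lambda>x. (1 / c) *\<^sub>R x + - ((1 / c) *\<^sub>R d)) ` cbox (c * a + d) (c * b + d) = {a..b}"
  proof (intro equalityI subsetI)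
    fix y assume "y \<in> {a..b}"
    thus "y \<in> (\<lambda>x. (1 / c) *\<^sub>R x + - ((1 / c) *\<^sub>R d)) ` cbox (c * a + d) (c * b + d)"
      using c by (intro image_eqI[of _ _ "c * y + d"]) (auto simp: field_simps)
  qed (use c in \<open>auto simp: field_simps\<close>)
  have "(f has_integral integral {c * a + d..c * b + d} f) (cbox (c * a + d) (c * b + d))"
    using f by (simp add: integrable_integral)
  from has_integral_affinity[OF this, of c d] c
  have *: "((\<lambda>x. f (c * x + d)) has_integral integral {c * a + d..c * b + d} f / c) {a..b}"
    unfolding img by simp
  thus "(\<lambda>x. f (c * x + d)) integrable_on {a..b}" by blast
  have "integral {a..b} (\<lambda>x. f (c * x + d)) = integral {c * a + d..c * b + d} f / c"
    using * by (rule integral_unique)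
  thus "c * integral {a..b} (\<lambda>x. f (c * x + d)) = integral {c * a + d..c * b + d} f" using c by simp
qed

section \<open>Moments of increments over short intervals\<close>

text \<open>Only two properties of \<open>R x = \<psi> x - x\<close> enter: measurability and a trivial bound for its increments.
  The constants \<open>\<mu>\<close> and \<open>E\<close> are arbitrary.\<close>

locale short_increments =
  fixes R :: "real \<Rightarrow> real" and m :: nat and \<mu> E :: real
  assumes R_borel [measurable]: "R \<in> borel_measurable borel"
    and R_increment: "\<And>x h. 1 \<le> x \<Longrightarrow> 0 \<le> h \<Longrightarrow> \<bar>R (x + h) - R x\<bar> \<le> (1 + h) * (1 + ln (x + h))"
    and m_pos: "m > 0" and \<mu>_pos: "\<mu> > 0" and E_pos: "E > 0"
begin

definition incr :: "real \<Rightarrow> real \<Rightarrow> real" where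
  "incr x h = (R (x + h) - R x) ^ (2 * m)"

text \<open>The exponent \<open>p\<close> selects the problem: the interval at \<open>x\<close> has length \<open>t\<close> for \<open>p = 0\<close> and
  \<open>t x\<close> for \<open>p = 1\<close>.\<close>

definition moment :: "nat \<Rightarrow> real \<Rightarrow> real \<Rightarrow> real \<Rightarrow> real" where
  "moment p t a b = integral {a..b} (\<lambda>x. incr x (t * x ^ p))"

lemma incr_nonneg: "0 \<le> incr x h"
  by (simp add: incr_def)

lemma incr_measurable [measurable]:
  assumes [measurable]: "f \<in> borel_measurable M" "g \<in> borel_measurable M"
  shows "(\<lambda>x. incr (f x) (g x)) \<in> borel_measurable M"
  unfolding incr_def by measurable

lemma incr_le:
  assumes "1 \<le> x" "0 \<le> h"
  shows "incr x h \<le> ((1 + h) * (1 + ln (x + h))) ^ (2 * m)"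
proof -
  have "incr x h = \<bar>R (x + h) - R x\<bar> ^ (2 * m)" by (simp add: incr_def power_even_abs)
  thus ?thesis using R_increment[OF assms] by (auto intro: power_mono)
qed

lemma incr_bounded:
  assumes "1 \<le> a" "0 \<le> t" "x \<in> {a..b}"
  shows "incr x (t * x ^ p) \<le> ((1 + t * b ^ p) * (1 + ln (b + t * b ^ p))) ^ (2 * m)"
proof -
  have x: "1 \<le> x" "x \<le> b" using assms by auto
  have "t * x ^ p \<le> t * b ^ p" using x assms by (intro mult_left_mono power_mono) auto
  moreover have "0 \<le> t * x ^ p" using x assms by auto
  moreover have "0 \<le> ln (x + t * x ^ p)" using x \<open>0 \<le> t * x ^ p\<close> by (intro ln_ge_zero) auto
  moreover have "ln (x + t * x ^ p) \<le> ln (b + t * b ^ p)"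
    using x \<open>t * x ^ p \<le> t * b ^ p\<close> \<open>0 \<le> t * x ^ p\<close> by (subst ln_le_cancel_iff) auto
  ultimately have "((1 + t * x ^ p) * (1 + ln (x + t * x ^ p))) ^ (2 * m) \<le>
                   ((1 + t * b ^ p) * (1 + ln (b + t * b ^ p))) ^ (2 * m)"
    using x assms by (intro power_mono mult_mono add_mono) (auto intro!: mult_nonneg_nonneg)
  thus ?thesis using incr_le[OF x(1) \<open>0 \<le> t * x ^ p\<close>] by linarith
qed

lemma
  assumes "1 \<le> a" "0 \<le> t"
  shows incr_integrable: "(\<lambda>x. incr x (t * x ^ p)) integrable_on {a..b}"
    and nn_integral_incr: "(\<integral>\<^sup>+x. ennreal (incr x (t * x ^ p)) * indicator {a..b} x \<partial>lborel) = ennreal (moment p t a b)"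
proof -
  have *: "(\<lambda>x. incr x (t * x ^ p)) \<in> borel_measurable borel" by measurable
  note nn_integral_eq_integral_interval[OF *, of a b "((1 + t * b ^ p) * (1 + ln (b + t * b ^ p))) ^ (2 * m)"]
  thus "(\<lambda>x. incr x (t * x ^ p)) integrable_on {a..b}"
    "(\<integral>\<^sup>+x. ennreal (incr x (t * x ^ p)) * indicator {a..b} x \<partial>lborel) = ennreal (moment p t a b)"
    using incr_nonneg incr_bounded[OF assms] by (auto simp: moment_def)
qed

lemma moment_nonneg: "1 \<le> a \<Longrightarrow> 0 \<le> t \<Longrightarrow> 0 \<le> moment p t a b"
  unfolding moment_def by (intro integral_nonneg incr_integrable incr_nonneg)

lemma moment_combine:
  assumes "1 \<le> a" "a \<le> b" "b \<le> c" "0 \<le> t"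
  shows "moment p t a b + moment p t b c = moment p t a c"
  unfolding moment_def using assms by (intro Henstock_Kurzweil_Integration.integral_combine incr_integrable)

lemma moment_mono:
  assumes "1 \<le> a" "a \<le> b" "b \<le> c" "0 \<le> t"
  shows "moment p t a b \<le> moment p t a c"
  using moment_combine[OF assms, of p] moment_nonneg[of b t p c] assms by simp

text \<open>Slices are parametrised by the interval length \<open>s\<close> at their left end \<open>Y\<close>, so that
  the two shapes \<open>s\<close> and \<open>s (x / Y)\<close> can be compared for the same \<open>s\<close>.\<close>

definition slice :: "nat \<Rightarrow> real \<Rightarrow> real \<Rightarrow> real \<Rightarrow> real" where
  "slice p Y \<rho> s = moment p (s / Y ^ p) Y (\<rho> * Y)"

lemma slice_nonneg: "1 \<le> Y \<Longrightarrow> 0 \<le> s \<Longrightarrow> 0 \<le> slice p Y \<rho> s"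
  unfolding slice_def by (intro moment_nonneg) auto

lemma nn_integral_slice:
  assumes "1 \<le> Y" "0 \<le> s"
  shows "(\<integral>\<^sup>+x. ennreal (incr x (s * (x / Y) ^ p)) * indicator {Y..\<rho> * Y} x \<partial>lborel) = ennreal (slice p Y \<rho> s)"
  using nn_integral_incr[of Y "s / Y ^ p" p "\<rho> * Y"] assms
  by (simp add: slice_def power_divide)

section \<open>Changing the shape of the interval length by averaging\<close>

lemma slice_average_eq:
  assumes "1 \<le> Y" "0 \<le> c"
  shows "(\<integral>\<^sup>+x. (\<integral>\<^sup>+\<tau>. ennreal (incr x (\<tau> * (x / Y) ^ p)) * indicator {c..d} \<tau> \<partial>lborel) * indicator {Y..\<rho> * Y} x \<partial>lborel) =
         (\<integral>\<^sup>+\<tau>. ennreal (slice p Y \<rho> \<tau>) * indicator {c..d} \<tau> \<partial>lborel)"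
  using assms by (subst nn_integral_swap_interval, measurable)
    (auto intro!: nn_integral_cong simp: indicator_def nn_integral_slice[symmetric])

text \<open>On a slice the shapes for \<open>p\<close> and \<open>q\<close> are within a factor close to \<open>1\<close> of each other. The second
  point \<open>y\<close> is needed for the remainder interval, which starts at \<open>y = x + s (x / Y)\<^sup>q\<close>.\<close>

lemma ratio_bounds:
  fixes x y Y \<rho> \<rho>' :: real
  assumes "0 < Y" "Y \<le> x" "x \<le> \<rho> * Y" "Y \<le> y" "y \<le> \<rho>' * Y" "p \<le> 1" "q \<le> (1::nat)"
  shows "1 / \<rho>' \<le> (x / Y) ^ q / (y / Y) ^ p" "(x / Y) ^ q / (y / Y) ^ p \<le> \<rho>"
proof -
  have x: "1 \<le> x / Y" "x / Y \<le> \<rho>" and y: "1 \<le> y / Y" "y / Y \<le> \<rho>'"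
    using assms by (auto simp: field_simps)
  have xq: "1 \<le> (x / Y) ^ q" "(x / Y) ^ q \<le> \<rho>"
    using x assms(7) by (cases q; auto)+
  have yp: "1 \<le> (y / Y) ^ p" "(y / Y) ^ p \<le> \<rho>'"
    using y assms(6) by (cases p; auto)+
  have "1 / \<rho>' \<le> 1 / (y / Y) ^ p" using yp by (intro divide_left_mono) (auto intro: mult_pos_pos)
  also have "\<dots> \<le> (x / Y) ^ q / (y / Y) ^ p" using yp xq by (intro divide_right_mono) auto
  finally show "1 / \<rho>' \<le> (x / Y) ^ q / (y / Y) ^ p" .
  have "(x / Y) ^ q / (y / Y) ^ p \<le> (x / Y) ^ q / 1" using yp xq by (intro divide_left_mono) auto
  thus "(x / Y) ^ q / (y / Y) ^ p \<le> \<rho>" using xq by simp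
qed

text \<open>For each \<open>x\<close> the substitution \<open>\<tau> = \<sigma> (x / Y)\<^sup>q / (x / Y)\<^sup>p\<close> changes shape \<open>q\<close> into
  shape \<open>p\<close>; after the exchange of integrals the inner one is a slice of shape \<open>p\<close>.\<close>

lemma average_le:
  assumes Y: "1 \<le> Y" and \<rho>: "1 < \<rho>" and pq: "p \<le> 1" "q \<le> 1" and ab: "0 \<le> \<alpha>" "\<alpha> \<le> \<beta>"
    and A: "0 \<le> A" "\<And>\<tau>. \<tau> \<in> {\<alpha> / \<rho>..\<beta> * \<rho>} \<Longrightarrow> slice p Y \<rho> \<tau> \<le> A"
  shows "(\<integral>\<^sup>+x. (\<integral>\<^sup>+\<sigma>. ennreal (incr x (\<sigma> * (x / Y) ^ q)) * indicator {\<alpha>..\<beta>} \<sigma> \<partial>lborel) * indicator {Y..\<rho> * Y} x \<partial>lborel)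
         \<le> ennreal (\<rho> * ((\<beta> * \<rho> - \<alpha> / \<rho>) * A))"
proof -
  have le: "\<alpha> / \<rho> \<le> \<beta> * \<rho>"
  proof -
    have "\<alpha> / \<rho> \<le> \<alpha> / 1" using \<rho> ab by (intro divide_left_mono) auto
    also have "\<dots> \<le> \<beta> * 1" using ab by simp
    also have "\<dots> \<le> \<beta> * \<rho>" using \<rho> ab by (intro mult_left_mono) auto
    finally show ?thesis .
  qed
  have "(\<integral>\<^sup>+x. (\<integral>\<^sup>+\<sigma>. ennreal (incr x (\<sigma> * (x / Y) ^ q)) * indicator {\<alpha>..\<beta>} \<sigma> \<partial>lborel) * indicator {Y..\<rho> * Y} x \<partial>lborel)
    \<le> (\<integral>\<^sup>+x. ennreal \<rho> * ((\<integral>\<^sup>+\<tau>. ennreal (incr x (\<tau> * (x / Y) ^ p)) * indicator {\<alpha> / \<rho>..\<beta> * \<rho>} \<tau> \<partial>lborel) * indicator {Y..\<rho> * Y} x) \<partial>lborel)"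
  proof (intro nn_integral_mono)
    fix x
    show "(\<integral>\<^sup>+\<sigma>. ennreal (incr x (\<sigma> * (x / Y) ^ q)) * indicator {\<alpha>..\<beta>} \<sigma> \<partial>lborel) * indicator {Y..\<rho> * Y} x
      \<le> ennreal \<rho> * ((\<integral>\<^sup>+\<tau>. ennreal (incr x (\<tau> * (x / Y) ^ p)) * indicator {\<alpha> / \<rho>..\<beta> * \<rho>} \<tau> \<partial>lborel) * indicator {Y..\<rho> * Y} x)"
    proof (cases "x \<in> {Y..\<rho> * Y}")
      case True
      define r where "r = (x / Y) ^ q / (x / Y) ^ p"
      have r: "1 / \<rho> \<le> r" "r \<le> \<rho>"
        unfolding r_def using True Y pq by (intro ratio_bounds; auto)+
      have eq: "\<sigma> * r * (x / Y) ^ p = \<sigma> * (x / Y) ^ q" for \<sigma> using True Y by (simp add: r_def)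
      show ?thesis
        using nn_integral_dilate_le[of "\<lambda>\<tau>. ennreal (incr x (\<tau> * (x / Y) ^ p))" \<rho> r 0 \<alpha> \<beta>] r \<rho> ab True
        by (simp add: eq)
    qed simp
  qed
  also have "\<dots> = ennreal \<rho> * (\<integral>\<^sup>+\<tau>. ennreal (slice p Y \<rho> \<tau>) * indicator {\<alpha> / \<rho>..\<beta> * \<rho>} \<tau> \<partial>lborel)"
    using Y ab \<rho> by (subst nn_integral_cmult, measurable) (simp add: slice_average_eq)
  also have "\<dots> \<le> ennreal \<rho> * (\<integral>\<^sup>+\<tau>. ennreal A * indicator {\<alpha> / \<rho>..\<beta> * \<rho>} \<tau> \<partial>lborel)"
    using A by (intro mult_left_mono nn_integral_mono) (auto simp: indicator_def intro: ennreal_leI)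
  also have "\<dots> = ennreal (\<rho> * ((\<beta> * \<rho> - \<alpha> / \<rho>) * A))"
    using A(1) le \<rho> by (subst nn_integral_const_interval) (auto simp: ennreal_mult)
  finally show ?thesis .
qed

lemma average_ge:
  assumes Y: "1 \<le> Y" and \<rho>: "1 < \<rho>" and pq: "p \<le> 1" "q \<le> 1" and ab: "0 \<le> \<alpha>" "\<alpha> * \<rho> \<le> \<beta> / \<rho>"
    and A: "0 \<le> A" "\<And>\<tau>. \<tau> \<in> {\<alpha> * \<rho>..\<beta> / \<rho>} \<Longrightarrow> A \<le> slice p Y \<rho> \<tau>"
  shows "ennreal ((\<beta> / \<rho> - \<alpha> * \<rho>) * A) \<le> ennreal \<rho> *
    (\<integral>\<^sup>+x. (\<integral>\<^sup>+\<sigma>. ennreal (incr x (\<sigma> * (x / Y) ^ q)) * indicator {\<alpha>..\<beta>} \<sigma> \<partial>lborel) * indicator {Y..\<rho> * Y} x \<partial>lborel)"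
proof -
  have le: "\<alpha> \<le> \<beta>"
  proof -
    have "\<alpha> * 1 \<le> \<alpha> * \<rho>" using ab \<rho> by (intro mult_left_mono) auto
    moreover have "0 \<le> \<beta> / \<rho>" using ab \<rho> mult_nonneg_nonneg[of \<alpha> \<rho>] by linarith
    hence "0 \<le> \<beta>" using \<rho> by (simp add: zero_le_divide_iff)
    hence "\<beta> / \<rho> \<le> \<beta> / 1" using \<rho> by (intro divide_left_mono) auto
    ultimately show ?thesis using ab by simp
  qed
  have "ennreal ((\<beta> / \<rho> - \<alpha> * \<rho>) * A) = (\<integral>\<^sup>+\<tau>. ennreal A * indicator {\<alpha> * \<rho>..\<beta> / \<rho>} \<tau> \<partial>lborel)"
    using A(1) ab by (subst nn_integral_const_interval) auto
  also have "\<dots> \<le> (\<integral>\<^sup>+\<tau>. ennreal (slice p Y \<rho> \<tau>) * indicator {\<alpha> * \<rho>..\<beta> / \<rho>} \<tau> \<partial>lborel)"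
    using A by (intro nn_integral_mono) (auto simp: indicator_def intro: ennreal_leI)
  also have "\<dots> = (\<integral>\<^sup>+x. (\<integral>\<^sup>+\<tau>. ennreal (incr x (\<tau> * (x / Y) ^ p)) * indicator {\<alpha> * \<rho>..\<beta> / \<rho>} \<tau> \<partial>lborel) * indicator {Y..\<rho> * Y} x \<partial>lborel)"
    using Y ab \<rho> by (subst slice_average_eq) auto
  also have "\<dots> \<le> (\<integral>\<^sup>+x. ennreal \<rho> * ((\<integral>\<^sup>+\<sigma>. ennreal (incr x (\<sigma> * (x / Y) ^ q)) * indicator {\<alpha>..\<beta>} \<sigma> \<partial>lborel) * indicator {Y..\<rho> * Y} x) \<partial>lborel)"
  proof (intro nn_integral_mono)
    fix x
    show "(\<integral>\<^sup>+\<tau>. ennreal (incr x (\<tau> * (x / Y) ^ p)) * indicator {\<alpha> * \<rho>..\<beta> / \<rho>} \<tau> \<partial>lborel) * indicator {Y..\<rho> * Y} x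
      \<le> ennreal \<rho> * ((\<integral>\<^sup>+\<sigma>. ennreal (incr x (\<sigma> * (x / Y) ^ q)) * indicator {\<alpha>..\<beta>} \<sigma> \<partial>lborel) * indicator {Y..\<rho> * Y} x)"
    proof (cases "x \<in> {Y..\<rho> * Y}")
      case True
      define r where "r = (x / Y) ^ q / (x / Y) ^ p"
      have r: "1 / \<rho> \<le> r" "r \<le> \<rho>"
        unfolding r_def using True Y pq by (intro ratio_bounds; auto)+
      have eq: "\<sigma> * r * (x / Y) ^ p = \<sigma> * (x / Y) ^ q" for \<sigma> using True Y by (simp add: r_def)
      show ?thesis
        using nn_integral_dilate_ge[of "\<lambda>\<tau>. ennreal (incr x (\<tau> * (x / Y) ^ p))" \<rho> r \<alpha> \<beta>] r \<rho> ab le True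
        by (simp add: eq)
    qed simp
  qed
  also have "\<dots> = ennreal \<rho> * (\<integral>\<^sup>+x. (\<integral>\<^sup>+\<sigma>. ennreal (incr x (\<sigma> * (x / Y) ^ q)) * indicator {\<alpha>..\<beta>} \<sigma> \<partial>lborel) * indicator {Y..\<rho> * Y} x \<partial>lborel)"
    by (subst nn_integral_cmult) measurable
  finally show ?thesis .
qed

text \<open>The remainder interval starts at \<open>y = x + s (x / Y)\<^sup>q\<close>, which may lie beyond the slice but stays below
  \<open>\<rho>\<^sup>2 Y\<close>; hence the slice of ratio \<open>\<rho>\<^sup>2\<close>.\<close>

lemma average_remainder_le:
  assumes Y: "1 \<le> Y" and \<rho>: "1 < \<rho>" and pq: "p \<le> 1" "q \<le> 1"
    and s: "0 \<le> s" "s \<le> (\<rho> - 1) * Y" and ab: "s \<le> \<alpha>" "\<alpha> \<le> \<beta>"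
    and B: "0 \<le> B" "\<And>\<tau>. \<tau> \<in> {(\<alpha> - s) / \<rho>\<^sup>2..(\<beta> - s) * \<rho>\<^sup>2} \<Longrightarrow> slice p Y (\<rho>\<^sup>2) \<tau> \<le> B"
  shows "(\<integral>\<^sup>+x. (\<integral>\<^sup>+\<sigma>. ennreal (incr (x + s * (x / Y) ^ q) ((\<sigma> - s) * (x / Y) ^ q)) * indicator {\<alpha>..\<beta>} \<sigma> \<partial>lborel)
            * indicator {Y..\<rho> * Y} x \<partial>lborel)
         \<le> ennreal (\<rho>\<^sup>2 * (((\<beta> - s) * \<rho>\<^sup>2 - (\<alpha> - s) / \<rho>\<^sup>2) * B))"
proof -
  have \<rho>2: "1 < \<rho>\<^sup>2" using \<rho> by (simp add: one_less_power)
  have le: "(\<alpha> - s) / \<rho>\<^sup>2 \<le> (\<beta> - s) * \<rho>\<^sup>2"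
  proof -
    have "(\<alpha> - s) / \<rho>\<^sup>2 \<le> (\<alpha> - s) / 1" using \<rho>2 ab by (intro divide_left_mono) auto
    also have "\<dots> \<le> (\<beta> - s) * 1" using ab by simp
    also have "\<dots> \<le> (\<beta> - s) * \<rho>\<^sup>2" using \<rho>2 ab by (intro mult_left_mono) auto
    finally show ?thesis .
  qed
  \<comment> \<open>The map \<open>x \<mapsto> x + s (x / Y)\<^sup>q\<close> is affine with slope at least \<open>1\<close> because \<open>q \<le> 1\<close>.\<close>
  obtain c d where cd: "c \<ge> 1" "\<And>x. x + s * (x / Y) ^ q = d + c * x"
  proof (cases "q = 0")
    case True
    thus ?thesis using that[of 1 s] by simp
  next
    case False
    hence "q = 1" using pq by simp
    thus ?thesis using that[of "1 + s / Y" 0] s Y by (simp add: algebra_simps)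
  qed
  define F where "F = (\<lambda>y. (\<integral>\<^sup>+\<tau>. ennreal (incr y (\<tau> * (y / Y) ^ p)) * indicator {(\<alpha> - s) / \<rho>\<^sup>2..(\<beta> - s) * \<rho>\<^sup>2} \<tau> \<partial>lborel)
                          * indicator {Y..\<rho>\<^sup>2 * Y} y :: ennreal)"
  have F [measurable]: "F \<in> borel_measurable borel" unfolding F_def by measurable
  have "(\<integral>\<^sup>+x. (\<integral>\<^sup>+\<sigma>. ennreal (incr (x + s * (x / Y) ^ q) ((\<sigma> - s) * (x / Y) ^ q)) * indicator {\<alpha>..\<beta>} \<sigma> \<partial>lborel)
            * indicator {Y..\<rho> * Y} x \<partial>lborel) \<le> (\<integral>\<^sup>+x. ennreal (\<rho>\<^sup>2) * F (x + s * (x / Y) ^ q) \<partial>lborel)"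
  proof (intro nn_integral_mono)
    fix x
    show "(\<integral>\<^sup>+\<sigma>. ennreal (incr (x + s * (x / Y) ^ q) ((\<sigma> - s) * (x / Y) ^ q)) * indicator {\<alpha>..\<beta>} \<sigma> \<partial>lborel)
            * indicator {Y..\<rho> * Y} x \<le> ennreal (\<rho>\<^sup>2) * F (x + s * (x / Y) ^ q)"
    proof (cases "x \<in> {Y..\<rho> * Y}")
      case True
      define y where "y = x + s * (x / Y) ^ q"
      have "1 \<le> x / Y" "x / Y \<le> \<rho>" using True Y by (auto simp: field_simps)
      hence xq: "0 \<le> (x / Y) ^ q" "(x / Y) ^ q \<le> \<rho>" using pq \<rho> by (cases q; auto)+
      have "s * (x / Y) ^ q \<le> (\<rho> - 1) * Y * \<rho>" using s xq Y by (intro mult_mono) auto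
      hence "y \<le> \<rho> * Y + (\<rho> - 1) * Y * \<rho>" using True by (simp add: y_def)
      also have "\<dots> = \<rho>\<^sup>2 * Y" by (simp add: power2_eq_square algebra_simps)
      finally have y2: "y \<le> \<rho>\<^sup>2 * Y" .
      have "0 \<le> s * (x / Y) ^ q" using s xq by (intro mult_nonneg_nonneg)
      hence y1: "Y \<le> y" using True by (simp add: y_def)
      define r where "r = (x / Y) ^ q / (y / Y) ^ p"
      have "1 / \<rho>\<^sup>2 \<le> r" "r \<le> \<rho>"
        unfolding r_def using True Y pq y1 y2 by (intro ratio_bounds; auto)+
      moreover have "\<rho> \<le> \<rho>\<^sup>2" using \<rho> by (simp add: power2_eq_square)
      ultimately have r: "1 / \<rho>\<^sup>2 \<le> r" "r \<le> \<rho>\<^sup>2" by auto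
      have eq: "(\<sigma> - s) * r * (y / Y) ^ p = (\<sigma> - s) * (x / Y) ^ q" for \<sigma>
        using y1 Y by (simp add: r_def)
      show ?thesis
        using nn_integral_dilate_le[of "\<lambda>\<tau>. ennreal (incr y (\<tau> * (y / Y) ^ p))" "\<rho>\<^sup>2" r s \<alpha> \<beta>] r \<rho> \<rho>2 ab True y1 y2
        by (simp add: F_def y_def[symmetric] eq)
    qed simp
  qed
  also have "\<dots> = ennreal (\<rho>\<^sup>2) * (\<integral>\<^sup>+x. F (x + s * (x / Y) ^ q) \<partial>lborel)"
    by (rule nn_integral_cmult) measurable
  also have "\<dots> = ennreal (\<rho>\<^sup>2) * (\<integral>\<^sup>+x. F (d + c * x) \<partial>lborel)" by (simp add: cd)
  also have "\<dots> \<le> ennreal (\<rho>\<^sup>2) * (\<integral>\<^sup>+y. F y \<partial>lborel)"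
    using cd by (intro mult_left_mono nn_integral_expand_le) auto
  also have "(\<integral>\<^sup>+y. F y \<partial>lborel) = (\<integral>\<^sup>+\<tau>. ennreal (slice p Y (\<rho>\<^sup>2) \<tau>) * indicator {(\<alpha> - s) / \<rho>\<^sup>2..(\<beta> - s) * \<rho>\<^sup>2} \<tau> \<partial>lborel)"
    unfolding F_def using Y ab by (intro slice_average_eq) auto
  also have "ennreal (\<rho>\<^sup>2) * \<dots> \<le> ennreal (\<rho>\<^sup>2) * (\<integral>\<^sup>+\<tau>. ennreal B * indicator {(\<alpha> - s) / \<rho>\<^sup>2..(\<beta> - s) * \<rho>\<^sup>2} \<tau> \<partial>lborel)"
    using B by (intro mult_left_mono nn_integral_mono) (auto simp: indicator_def intro: ennreal_leI)
  also have "\<dots> = ennreal (\<rho>\<^sup>2 * (((\<beta> - s) * \<rho>\<^sup>2 - (\<alpha> - s) / \<rho>\<^sup>2) * B))"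
    using B(1) le by (subst nn_integral_const_interval) (auto simp: ennreal_mult)
  finally show ?thesis .
qed

text \<open>The single length \<open>s\<close> of shape \<open>q\<close> is reached from the average over \<open>\<sigma> \<in> [\<alpha>, \<beta>]\<close> through the identity
  \<open>R (x + \<sigma> v) - R x = (R (x + s v) - R x) + (R (x + \<sigma> v) - R (x + s v))\<close>, read in
  both directions with \<open>even_power_add_le\<close>.\<close>

lemma slice_transfer:
  assumes Y: "1 \<le> Y" and \<rho>: "1 < \<rho>" and pq: "p \<le> 1" "q \<le> 1" and c: "0 < c"
    and s: "0 \<le> s" "s \<le> (\<rho> - 1) * Y" and ab: "s \<le> \<alpha>" "\<alpha> \<le> \<beta>"
    and B: "0 \<le> B" "\<And>\<tau>. \<tau> \<in> {(\<alpha> - s) / \<rho>\<^sup>2..(\<beta> - s) * \<rho>\<^sup>2} \<Longrightarrow> slice p Y (\<rho>\<^sup>2) \<tau> \<le> B"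
  defines "V \<equiv> (1 + 1 / c) ^ (2 * m) * (\<rho>\<^sup>2 * (((\<beta> - s) * \<rho>\<^sup>2 - (\<alpha> - s) / \<rho>\<^sup>2) * B))"
  shows slice_transfer_upper:
      "\<And>A. 0 \<le> A \<Longrightarrow> (\<And>\<tau>. \<tau> \<in> {\<alpha> / \<rho>..\<beta> * \<rho>} \<Longrightarrow> slice p Y \<rho> \<tau> \<le> A) \<Longrightarrow>
        (\<beta> - \<alpha>) * slice q Y \<rho> s \<le> (1 + c) ^ (2 * m) * (\<rho> * ((\<beta> * \<rho> - \<alpha> / \<rho>) * A)) + V"
    and slice_transfer_lower:
      "\<And>A. 0 \<le> A \<Longrightarrow> \<alpha> * \<rho> \<le> \<beta> / \<rho> \<Longrightarrow> (\<And>\<tau>. \<tau> \<in> {\<alpha> * \<rho>..\<beta> / \<rho>} \<Longrightarrow> A \<le> slice p Y \<rho> \<tau>) \<Longrightarrow>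
        (\<beta> / \<rho> - \<alpha> * \<rho>) * A \<le> \<rho> * ((1 + c) ^ (2 * m) * ((\<beta> - \<alpha>) * slice q Y \<rho> s) + V)"
proof -
  let ?I = "\<lambda>f. (\<integral>\<^sup>+x. (\<integral>\<^sup>+\<sigma>. ennreal (f x \<sigma>) * indicator {\<alpha>..\<beta>} \<sigma> \<partial>lborel) * indicator {Y..\<rho> * Y} x \<partial>lborel)"
  let ?c = "(1 + c) ^ (2 * m)" and ?d = "(1 + 1 / c) ^ (2 * m)"
  define main where "main = ?I (\<lambda>x \<sigma>. incr x (\<sigma> * (x / Y) ^ q))"
  define err where "err = ?I (\<lambda>x \<sigma>. incr (x + s * (x / Y) ^ q) ((\<sigma> - s) * (x / Y) ^ q))"
  define target where "target = ?I (\<lambda>x \<sigma>. incr x (s * (x / Y) ^ q))"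
  have cd: "0 \<le> ?c" "0 \<le> ?d" using c by auto
  have lin: "ennreal ?c * ?I f + ennreal ?d * ?I g = ?I (\<lambda>x \<sigma>. ?c * f x \<sigma> + ?d * g x \<sigma>)"
    if [measurable]: "case_prod f \<in> borel_measurable (borel \<Otimes>\<^sub>M borel)" "case_prod g \<in> borel_measurable (borel \<Otimes>\<^sub>M borel)"
      and "\<And>x \<sigma>. 0 \<le> f x \<sigma>" "\<And>x \<sigma>. 0 \<le> g x \<sigma>" for f g :: "real \<Rightarrow> real \<Rightarrow> real"
  proof -
    have "?I (\<lambda>x \<sigma>. ?c * f x \<sigma> + ?d * g x \<sigma>) =
      (\<integral>\<^sup>+x. (\<integral>\<^sup>+\<sigma>. ennreal ?c * (ennreal (f x \<sigma>) * indicator {\<alpha>..\<beta>} \<sigma>) + ennreal ?d * (ennreal (g x \<sigma>) * indicator {\<alpha>..\<beta>} \<sigma>) \<partial>lborel) * indicator {Y..\<rho> * Y} x \<partial>lborel)"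
      using that(3,4) cd by (intro nn_integral_cong arg_cong2[of _ _ _ _ "(*)"]) (auto simp: ennreal_mult ennreal_plus algebra_simps simp del: power_mult)
    also have "\<dots> = (\<integral>\<^sup>+x. ennreal ?c * ((\<integral>\<^sup>+\<sigma>. ennreal (f x \<sigma>) * indicator {\<alpha>..\<beta>} \<sigma> \<partial>lborel) * indicator {Y..\<rho> * Y} x) +
       ennreal ?d * ((\<integral>\<^sup>+\<sigma>. ennreal (g x \<sigma>) * indicator {\<alpha>..\<beta>} \<sigma> \<partial>lborel) * indicator {Y..\<rho> * Y} x) \<partial>lborel)"
      by (subst nn_integral_add, measurable, subst nn_integral_cmult, measurable, subst nn_integral_cmult, measurable)
         (simp add: algebra_simps)
    also have "\<dots> = ennreal ?c * ?I f + ennreal ?d * ?I g"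
      by (subst nn_integral_add, measurable, subst nn_integral_cmult, measurable, subst nn_integral_cmult, measurable)
    finally show ?thesis by simp
  qed
  have target: "target = ennreal ((\<beta> - \<alpha>) * slice q Y \<rho> s)"
  proof -
    have "target = (\<integral>\<^sup>+x. (ennreal (incr x (s * (x / Y) ^ q)) * indicator {Y..\<rho> * Y} x) * ennreal (\<beta> - \<alpha>) \<partial>lborel)"
      unfolding target_def using ab
      by (subst nn_integral_cmult_indicator) (auto simp: mult_ac)
    also have "\<dots> = ennreal (slice q Y \<rho> s) * ennreal (\<beta> - \<alpha>)"
      using Y s by (subst nn_integral_multc, measurable) (simp add: nn_integral_slice)
    finally show ?thesis using ab slice_nonneg[of Y s q \<rho>] Y s by (simp add: ennreal_mult mult.commute)
  qed
  have err: "ennreal ?d * err \<le> ennreal V"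
  proof -
    have "ennreal ?d * err \<le> ennreal ?d * ennreal (\<rho>\<^sup>2 * (((\<beta> - s) * \<rho>\<^sup>2 - (\<alpha> - s) / \<rho>\<^sup>2) * B))"
      unfolding err_def using assms by (intro mult_left_mono average_remainder_le) auto
    thus ?thesis using cd by (simp add: V_def ennreal_mult' del: power_mult)
  qed
  \<comment> \<open>The interval of length \<open>s v\<close> is the difference of the intervals of length \<open>\<sigma> v\<close> and \<open>(\<sigma> - s) v\<close>.\<close>
  have split: "R (x + \<sigma> * v) - R x = (R (x + s * v) - R x) + (R (x + s * v + (\<sigma> - s) * v) - R (x + s * v))" for x \<sigma> v
    by (simp add: algebra_simps)
  have pt1: "incr x (s * v) \<le> ?c * incr x (\<sigma> * v) + ?d * incr (x + s * v) ((\<sigma> - s) * v)" for x \<sigma> v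
  proof -
    have "incr x (s * v) = ((R (x + \<sigma> * v) - R x) + - (R (x + s * v + (\<sigma> - s) * v) - R (x + s * v))) ^ (2 * m)"
      unfolding split[of x \<sigma> v] incr_def by (rule arg_cong[of _ _ "\<lambda>z. z ^ (2 * m)"]) (simp add: algebra_simps)
    also have "\<dots> \<le> ?c * (R (x + \<sigma> * v) - R x) ^ (2 * m) + ?d * (- (R (x + s * v + (\<sigma> - s) * v) - R (x + s * v))) ^ (2 * m)"
      by (rule even_power_add_le[OF c])
    also have "(- (R (x + s * v + (\<sigma> - s) * v) - R (x + s * v))) ^ (2 * m) = incr (x + s * v) ((\<sigma> - s) * v)"
      unfolding incr_def by (rule power_minus_even)  simp
    finally show ?thesis by (simp add: incr_def)
  qed
  have pt2: "incr x (\<sigma> * v) \<le> ?c * incr x (s * v) + ?d * incr (x + s * v) ((\<sigma> - s) * v)" for x \<sigma> v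
    unfolding incr_def split[of x \<sigma> v] by (rule even_power_add_le[OF c])
  have up: "target \<le> ennreal ?c * main + ennreal ?d * err"
    unfolding target_def main_def err_def
    by (subst lin, measurable, intro incr_nonneg, intro incr_nonneg)
       (intro nn_integral_mono mult_right_mono ennreal_leI pt1 zero_le)
  have low: "main \<le> ennreal ?c * target + ennreal ?d * err"
    unfolding target_def main_def err_def
    by (subst lin, measurable, intro incr_nonneg, intro incr_nonneg)
       (intro nn_integral_mono mult_right_mono ennreal_leI pt2 zero_le)
  have V0: "0 \<le> V"
  proof -
    have "1 \<le> \<rho>\<^sup>2" using \<rho> by (simp add: one_le_power)
    hence "(\<alpha> - s) / \<rho>\<^sup>2 \<le> (\<alpha> - s) / 1" "(\<beta> - s) * 1 \<le> (\<beta> - s) * \<rho>\<^sup>2"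
      using ab by (intro divide_left_mono mult_left_mono; auto)+
    hence "0 \<le> (\<beta> - s) * \<rho>\<^sup>2 - (\<alpha> - s) / \<rho>\<^sup>2" using ab by simp
    thus ?thesis unfolding V_def using B(1) cd(2) by (intro mult_nonneg_nonneg) auto
  qed
  show "(\<beta> - \<alpha>) * slice q Y \<rho> s \<le> ?c * (\<rho> * ((\<beta> * \<rho> - \<alpha> / \<rho>) * A)) + V"
    if A: "0 \<le> A" "\<And>\<tau>. \<tau> \<in> {\<alpha> / \<rho>..\<beta> * \<rho>} \<Longrightarrow> slice p Y \<rho> \<tau> \<le> A" for A
  proof -
    have "main \<le> ennreal (\<rho> * ((\<beta> * \<rho> - \<alpha> / \<rho>) * A))"
      unfolding main_def using A Y \<rho> pq s ab by (intro average_le) auto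
    hence "target \<le> ennreal ?c * ennreal (\<rho> * ((\<beta> * \<rho> - \<alpha> / \<rho>) * A)) + ennreal V"
      using up err by (meson add_mono mult_left_mono order_trans zero_le)
    also have "\<dots> = ennreal (?c * (\<rho> * ((\<beta> * \<rho> - \<alpha> / \<rho>) * A)) + V)"
    proof -
      have "\<alpha> / \<rho> \<le> \<alpha> / 1" "\<beta> * 1 \<le> \<beta> * \<rho>" using \<rho> ab s by (intro divide_left_mono mult_left_mono; auto)+
      hence "0 \<le> \<beta> * \<rho> - \<alpha> / \<rho>" using ab by simp
      hence "0 \<le> \<rho> * ((\<beta> * \<rho> - \<alpha> / \<rho>) * A)" using A \<rho> by (intro mult_nonneg_nonneg) auto
      thus ?thesis using cd V0 by (simp add: ennreal_mult ennreal_plus del: power_mult)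
    qed
    finally have le: "ennreal ((\<beta> - \<alpha>) * slice q Y \<rho> s) \<le> ennreal (?c * (\<rho> * ((\<beta> * \<rho> - \<alpha> / \<rho>) * A)) + V)"
      unfolding target .
    have "0 \<le> ?c * (\<rho> * ((\<beta> * \<rho> - \<alpha> / \<rho>) * A)) + V"
    proof -
      have "\<alpha> / \<rho> \<le> \<alpha> / 1" "\<beta> * 1 \<le> \<beta> * \<rho>" using \<rho> ab s by (intro divide_left_mono mult_left_mono; auto)+
      hence "0 \<le> \<beta> * \<rho> - \<alpha> / \<rho>" using ab by simp
      thus ?thesis using A \<rho> cd V0 by (intro add_nonneg_nonneg mult_nonneg_nonneg) auto
    qed
    thus ?thesis using le by (simp only: ennreal_le_iff)
  qed
  show "(\<beta> / \<rho> - \<alpha> * \<rho>) * A \<le> \<rho> * (?c * ((\<beta> - \<alpha>) * slice q Y \<rho> s) + V)"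
    if A: "0 \<le> A" "\<alpha> * \<rho> \<le> \<beta> / \<rho>" "\<And>\<tau>. \<tau> \<in> {\<alpha> * \<rho>..\<beta> / \<rho>} \<Longrightarrow> A \<le> slice p Y \<rho> \<tau>" for A
  proof -
    have nn: "0 \<le> (\<beta> - \<alpha>) * slice q Y \<rho> s" using ab slice_nonneg[of Y s q \<rho>] Y s by auto
    have "ennreal ((\<beta> / \<rho> - \<alpha> * \<rho>) * A) \<le> ennreal \<rho> * main"
      unfolding main_def using A Y \<rho> pq s ab by (intro average_ge) auto
    also have "\<dots> \<le> ennreal \<rho> * (ennreal ?c * ennreal ((\<beta> - \<alpha>) * slice q Y \<rho> s) + ennreal V)"
      using low err unfolding target by (meson add_left_mono mult_left_mono order_trans zero_le)
    also have "\<dots> = ennreal (\<rho> * (?c * ((\<beta> - \<alpha>) * slice q Y \<rho> s) + V))"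
      using nn cd V0 \<rho> by (simp add: ennreal_mult ennreal_plus del: power_mult)
    finally have le: "ennreal ((\<beta> / \<rho> - \<alpha> * \<rho>) * A) \<le> ennreal (\<rho> * (?c * ((\<beta> - \<alpha>) * slice q Y \<rho> s) + V))" .
    have "0 \<le> \<rho> * (?c * ((\<beta> - \<alpha>) * slice q Y \<rho> s) + V)"
      using ab slice_nonneg[of Y s q \<rho>] Y s cd V0 \<rho>
      by (intro mult_nonneg_nonneg add_nonneg_nonneg) auto
    thus ?thesis using le by (simp only: ennreal_le_iff)
  qed
qed

text \<open>The density of both main terms at the point \<open>Y\<close>, as a function of the interval length \<open>s\<close> there.\<close>

definition model_density :: "real \<Rightarrow> real \<Rightarrow> real" where
  "model_density Y s = \<mu> * (s * ln (Y / (E * s))) ^ m"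

text \<open>The relative width \<open>\<rho> - 1\<close> of the slice tends to \<open>0\<close> only after \<open>Y\<close> has tended to infinity. For \<open>p = 1\<close>
  the density is not constant along a slice, so the right-hand side is correct only in the limit \<open>\<rho> \<rightarrow> 1\<close>.\<close>

definition slice_asymp :: "nat \<Rightarrow> bool" where
  "slice_asymp p \<longleftrightarrow> (\<forall>\<epsilon>>0. \<forall>\<eta>>0. \<forall>\<^sub>F \<rho> in at_right 1. \<forall>\<^sub>F Y in at_top. \<forall>s\<in>{Y powr \<epsilon>..Y powr (1 - \<epsilon>)}.
     (1 - \<eta>) * ((\<rho> - 1) * Y * model_density Y s) \<le> slice p Y \<rho> s \<and>
     slice p Y \<rho> s \<le> (1 + \<eta>) * ((\<rho> - 1) * Y * model_density Y s))"

lemma model_density_le: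
  assumes "0 < s" "0 < a" "\<tau> \<le> b * s" "a * s \<le> \<tau>" "0 < Y" "ln (Y / (E * s)) - ln a \<le> d * ln (Y / (E * s))"
    and "0 \<le> ln (Y / (E * \<tau>))"
  shows "model_density Y \<tau> \<le> (b * d) ^ m * model_density Y s"
proof -
  have \<tau>: "0 < \<tau>" using assms by (meson less_le_trans mult_pos_pos)
  have "ln (Y / (E * \<tau>)) \<le> ln (Y / (E * (a * s)))"
    using assms \<tau> E_pos by (subst ln_le_cancel_iff) (auto intro!: divide_left_mono mult_left_mono mult_pos_pos)
  also have "\<dots> = ln (Y / (E * s)) - ln a"
    using assms E_pos by (simp add: ln_div ln_mult)
  also note assms(6)
  finally have "\<tau> * ln (Y / (E * \<tau>)) \<le> (b * s) * (d * ln (Y / (E * s)))"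
    using assms \<tau> by (intro mult_mono) auto
  hence "(\<tau> * ln (Y / (E * \<tau>))) ^ m \<le> (b * d * (s * ln (Y / (E * s)))) ^ m"
    using assms \<tau> by (intro power_mono) (auto simp: mult_ac)
  thus ?thesis
    using \<mu>_pos by (simp add: model_density_def power_mult_distrib mult_ac)
qed

lemma model_density_ge:
  assumes "0 < s" "0 < b" "\<tau> \<le> b * s" "s \<le> \<tau>" "0 < Y" "d * ln (Y / (E * s)) \<le> ln (Y / (E * s)) - ln b"
    and "0 \<le> ln (Y / (E * s))" "0 \<le> d"
  shows "d ^ m * model_density Y s \<le> model_density Y \<tau>"
proof -
  have \<tau>: "0 < \<tau>" using assms by linarith
  note assms(6)
  also have "ln (Y / (E * s)) - ln b = ln (Y / (E * (b * s)))"
    using assms E_pos by (simp add: ln_div ln_mult)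
  also have "\<dots> \<le> ln (Y / (E * \<tau>))"
    using assms \<tau> E_pos by (subst ln_le_cancel_iff) (auto intro!: divide_left_mono mult_left_mono mult_pos_pos)
  finally have "s * (d * ln (Y / (E * s))) \<le> \<tau> * ln (Y / (E * \<tau>))"
    using assms \<tau> by (intro mult_mono) auto
  hence "(d * (s * ln (Y / (E * s)))) ^ m \<le> (\<tau> * ln (Y / (E * \<tau>))) ^ m"
    using assms by (intro power_mono) (auto simp: mult_ac)
  thus ?thesis
    using \<mu>_pos by (simp add: model_density_def power_mult_distrib mult_ac)
qed

text \<open>The contribution of the lengths \<open>\<sigma> - s\<close>, relative to the main term of the slice. As \<open>\<rho> \<rightarrow> 1\<close> it tends to
  a quantity that contains the factor \<open>(\<kappa>\<^sup>2 - 1)\<^sup>m\<close> and so vanishes as \<open>\<kappa> \<rightarrow> 1\<close>.\<close>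

definition transfer_error :: "real \<Rightarrow> real \<Rightarrow> real \<Rightarrow> real" where
  "transfer_error c \<kappa> \<rho> = (1 + 1 / c) ^ (2 * m) *
     (\<rho>\<^sup>2 * ((((\<kappa>\<^sup>2 - 1) * \<rho>\<^sup>2 - (\<kappa> - 1) / \<rho>\<^sup>2) / (\<kappa>\<^sup>2 - \<kappa>)) * ((1 + c) * ((\<rho> + 1) * ((\<kappa>\<^sup>2 - 1) * \<rho>\<^sup>2 * 2) ^ m))))"

text \<open>The case \<open>\<alpha> = \<kappa> s\<close>, \<open>\<beta> = \<kappa>\<^sup>2 s\<close> of \<open>slice_transfer\<close>, with the slices of shape \<open>p\<close> replaced by their expected size.
  The two hypotheses on the logarithm make \<open>log (Y / (E \<tau>))\<close> comparable with \<open>log (Y / (E s))\<close>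
  for the shortest and for the longest \<open>\<tau>\<close> that occur.\<close>

lemma slice_transfer_density:
  assumes Y: "1 \<le> Y" and \<rho>: "1 < \<rho>" "\<rho>\<^sup>2 \<le> \<kappa>" and pq: "p \<le> 1" "q \<le> 1" and c: "0 < c" "c < 1"
    and s: "0 < s" "s \<le> (\<rho> - 1) * Y"
    and L: "ln (\<rho>\<^sup>2 / (\<kappa> - 1)) \<le> ln (Y / (E * s))" "ln (\<kappa>\<^sup>2) \<le> c * ln (Y / (E * s))"
    and big: "E * (\<kappa>\<^sup>2 * \<rho>\<^sup>2 * s) \<le> Y"
    and T1: "\<And>\<tau>. (\<kappa> - 1) / \<rho>\<^sup>2 * s \<le> \<tau> \<Longrightarrow> \<tau> \<le> \<kappa>\<^sup>2 * \<rho>\<^sup>2 * s \<Longrightarrow>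
      (1 - c) * ((\<rho> - 1) * Y * model_density Y \<tau>) \<le> slice p Y \<rho> \<tau> \<and>
      slice p Y \<rho> \<tau> \<le> (1 + c) * ((\<rho> - 1) * Y * model_density Y \<tau>)"
    and T2: "\<And>\<tau>. (\<kappa> - 1) / \<rho>\<^sup>2 * s \<le> \<tau> \<Longrightarrow> \<tau> \<le> \<kappa>\<^sup>2 * \<rho>\<^sup>2 * s \<Longrightarrow>
      slice p Y (\<rho>\<^sup>2) \<tau> \<le> (1 + c) * ((\<rho>\<^sup>2 - 1) * Y * model_density Y \<tau>)"
  shows "slice q Y \<rho> s \<le> ((1 + c) ^ (2 * m) * (\<rho> * ((\<kappa>\<^sup>2 * \<rho> - \<kappa> / \<rho>) / (\<kappa>\<^sup>2 - \<kappa>) * ((1 + c) * (\<kappa>\<^sup>2 * \<rho>) ^ m)))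
            + transfer_error c \<kappa> \<rho>) * ((\<rho> - 1) * Y * model_density Y s)"
    and "(((\<kappa>\<^sup>2 / \<rho> - \<kappa> * \<rho>) / (\<kappa>\<^sup>2 - \<kappa>) * ((1 - c) * (1 - c) ^ m)) / \<rho> - transfer_error c \<kappa> \<rho>) / (1 + c) ^ (2 * m)
            * ((\<rho> - 1) * Y * model_density Y s) \<le> slice q Y \<rho> s"
proof -
  define \<Phi> where "\<Phi> = (\<rho> - 1) * Y * model_density Y s"
  define L0 where "L0 = ln (Y / (E * s))"
  have \<rho>\<rho>: "\<rho> < \<rho>\<^sup>2" "1 < \<rho>\<^sup>2" using \<rho> by (auto simp: power2_eq_square intro: less_1_mult)
  have \<kappa>: "1 < \<kappa>" "\<rho> < \<kappa>" using \<rho> \<rho>\<rho> by linarith+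
  have \<kappa>\<kappa>: "\<kappa> < \<kappa>\<^sup>2" "1 < \<kappa>\<^sup>2" using \<kappa> by (auto simp: power2_eq_square intro: less_1_mult)
  have L0: "0 \<le> L0"
  proof -
    have "0 \<le> ln (\<kappa>\<^sup>2)" using \<kappa>\<kappa> by (intro ln_ge_zero) auto
    hence "0 \<le> c * L0" using L(2) by (simp add: L0_def)
    thus ?thesis using c by (simp add: zero_le_mult_iff)
  qed
  have lnpos: "0 \<le> ln (Y / (E * \<tau>))" if "0 < \<tau>" "\<tau> \<le> \<kappa>\<^sup>2 * \<rho>\<^sup>2 * s" for \<tau>
  proof -
    have "E * \<tau> \<le> E * (\<kappa>\<^sup>2 * \<rho>\<^sup>2 * s)" using that E_pos by (intro mult_left_mono) auto
    hence "E * \<tau> \<le> Y" using big by linarith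
    thus ?thesis using that E_pos by (intro ln_ge_zero) (auto simp: field_simps)
  qed
  have dens0: "0 \<le> model_density Y s" using L0 s \<mu>_pos by (simp add: model_density_def L0_def)
  have \<Phi>0: "0 \<le> \<Phi>" unfolding \<Phi>_def using \<rho> Y dens0 by auto
  have eqs: "(\<kappa> * s - s) / \<rho>\<^sup>2 = (\<kappa> - 1) / \<rho>\<^sup>2 * s" "(\<kappa>\<^sup>2 * s - s) * \<rho>\<^sup>2 = (\<kappa>\<^sup>2 - 1) * \<rho>\<^sup>2 * s"
    by (auto simp: algebra_simps diff_divide_distrib)
  define B where "B = (1 + c) * ((\<rho> + 1) * ((\<kappa>\<^sup>2 - 1) * \<rho>\<^sup>2 * 2) ^ m) * \<Phi>"
  have B: "slice p Y (\<rho>\<^sup>2) \<tau> \<le> B" if \<tau>: "\<tau> \<in> {(\<kappa> * s - s) / \<rho>\<^sup>2..(\<kappa>\<^sup>2 * s - s) * \<rho>\<^sup>2}" for \<tau>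
  proof -
    have \<tau>': "(\<kappa> - 1) / \<rho>\<^sup>2 * s \<le> \<tau>" "\<tau> \<le> (\<kappa>\<^sup>2 - 1) * \<rho>\<^sup>2 * s" using \<tau> eqs by auto
    have "(\<kappa>\<^sup>2 - 1) * \<rho>\<^sup>2 * s \<le> \<kappa>\<^sup>2 * \<rho>\<^sup>2 * s" using s by (intro mult_right_mono) auto
    hence \<tau>2: "\<tau> \<le> \<kappa>\<^sup>2 * \<rho>\<^sup>2 * s" using \<tau>' by linarith
    have "0 < (\<kappa> - 1) / \<rho>\<^sup>2" using \<kappa> \<rho> by simp
    hence \<tau>0: "0 < \<tau>" using \<tau>'(1) s by (meson less_le_trans mult_pos_pos)
    have "model_density Y \<tau> \<le> ((\<kappa>\<^sup>2 - 1) * \<rho>\<^sup>2 * 2) ^ m * model_density Y s"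
    proof (rule model_density_le)
      have "ln (\<rho>\<^sup>2 / (\<kappa> - 1)) = - ln ((\<kappa> - 1) / \<rho>\<^sup>2)" using \<rho> \<kappa> by (simp add: ln_div)
      thus "ln (Y / (E * s)) - ln ((\<kappa> - 1) / \<rho>\<^sup>2) \<le> 2 * ln (Y / (E * s))" using L(1) by linarith
    qed (use s \<tau>' \<tau>2 \<tau>0 Y lnpos \<rho> \<kappa> in auto)
    hence "(1 + c) * ((\<rho>\<^sup>2 - 1) * Y * model_density Y \<tau>) \<le> (1 + c) * ((\<rho>\<^sup>2 - 1) * Y * (((\<kappa>\<^sup>2 - 1) * \<rho>\<^sup>2 * 2) ^ m * model_density Y s))"
      using c \<rho>\<rho> Y by (intro mult_left_mono) auto
    also have "\<dots> = B" by (simp add: B_def \<Phi>_def power2_eq_square algebra_simps)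
    finally show ?thesis using T2[OF \<tau>'(1) \<tau>2] by linarith
  qed
  have B0: "0 \<le> B" unfolding B_def using c \<rho> \<kappa>\<kappa> \<Phi>0 by (intro mult_nonneg_nonneg) auto
  define V where "V = (1 + 1 / c) ^ (2 * m) * (\<rho>\<^sup>2 * (((\<kappa>\<^sup>2 * s - s) * \<rho>\<^sup>2 - (\<kappa> * s - s) / \<rho>\<^sup>2) * B))"
  define W where "W = (\<kappa>\<^sup>2 - \<kappa>) * s"
  have W: "0 < W" unfolding W_def using \<kappa>\<kappa> s by simp
  have Wmult: "W * (N / (\<kappa>\<^sup>2 - \<kappa>)) = s * N" for N
    using \<kappa>\<kappa> by (simp add: W_def)
  have Veq: "V = W * (transfer_error c \<kappa> \<rho> * \<Phi>)"
  proof -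
    have "(\<kappa>\<^sup>2 * s - s) * \<rho>\<^sup>2 - (\<kappa> * s - s) / \<rho>\<^sup>2 = W * (((\<kappa>\<^sup>2 - 1) * \<rho>\<^sup>2 - (\<kappa> - 1) / \<rho>\<^sup>2) / (\<kappa>\<^sup>2 - \<kappa>))"
      unfolding Wmult eqs by (simp only: right_diff_distrib mult_ac)
    thus ?thesis unfolding V_def B_def transfer_error_def by (simp only: mult_ac)
  qed
  have \<kappa>s: "s \<le> \<kappa> * s" "\<kappa> * s \<le> \<kappa>\<^sup>2 * s" using \<kappa> \<kappa>\<kappa> s by auto
  note tr = Y \<rho>(1) pq c(1) less_imp_le[OF s(1)] s(2) \<kappa>s B0 B
  have \<kappa>1: "(\<kappa> - 1) / \<rho>\<^sup>2 * s \<le> \<kappa> / \<rho> * s"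
  proof -
    have "(\<kappa> - 1) / \<rho>\<^sup>2 \<le> \<kappa> / \<rho>\<^sup>2" using \<rho> by (intro divide_right_mono) auto
    also have "\<dots> \<le> \<kappa> / \<rho>" using \<rho>\<rho> \<rho> \<kappa> by (intro divide_left_mono) auto
    finally show ?thesis using s by (intro mult_right_mono) auto
  qed
  show "slice q Y \<rho> s \<le> ((1 + c) ^ (2 * m) * (\<rho> * ((\<kappa>\<^sup>2 * \<rho> - \<kappa> / \<rho>) / (\<kappa>\<^sup>2 - \<kappa>) * ((1 + c) * (\<kappa>\<^sup>2 * \<rho>) ^ m)))
            + transfer_error c \<kappa> \<rho>) * ((\<rho> - 1) * Y * model_density Y s)"
  proof -
    define A where "A = (1 + c) * (\<kappa>\<^sup>2 * \<rho>) ^ m * \<Phi>"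
    have A0: "0 \<le> A" unfolding A_def using c \<rho> \<Phi>0 by auto
    have A: "slice p Y \<rho> \<tau> \<le> A" if \<tau>: "\<tau> \<in> {\<kappa> * s / \<rho>..\<kappa>\<^sup>2 * s * \<rho>}" for \<tau>
    proof -
      have "1 \<le> \<kappa> / \<rho>" using \<kappa> \<rho> by simp
      hence "1 * s \<le> \<kappa> / \<rho> * s" using s by (intro mult_right_mono) auto
      hence \<tau>s: "s \<le> \<tau>" using \<tau> by simp
      have "\<kappa>\<^sup>2 * \<rho> * s \<le> \<kappa>\<^sup>2 * \<rho>\<^sup>2 * s" using s \<rho>\<rho> by (intro mult_right_mono mult_left_mono) auto
      hence \<tau>2: "\<tau> \<le> \<kappa>\<^sup>2 * \<rho>\<^sup>2 * s" using \<tau> by (simp add: mult_ac)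
      have "model_density Y \<tau> \<le> (\<kappa>\<^sup>2 * \<rho> * 1) ^ m * model_density Y s"
      proof (rule model_density_le[of _ 1])
        show "0 \<le> ln (Y / (E * \<tau>))" using \<tau>s s by (intro lnpos \<tau>2) auto
        show "\<tau> \<le> \<kappa>\<^sup>2 * \<rho> * s" using \<tau> by (simp add: mult_ac)
      qed (use s \<tau>s Y in auto)
      hence "(1 + c) * ((\<rho> - 1) * Y * model_density Y \<tau>) \<le> (1 + c) * ((\<rho> - 1) * Y * ((\<kappa>\<^sup>2 * \<rho>) ^ m * model_density Y s))"
        using c \<rho> Y by (intro mult_left_mono) auto
      also have "\<dots> = A" by (simp add: A_def \<Phi>_def)
      finally show ?thesis using T1[of \<tau>] \<tau>2 \<kappa>1 \<tau> by simp
    qed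
    have "(\<kappa>\<^sup>2 * s - \<kappa> * s) * slice q Y \<rho> s \<le> (1 + c) ^ (2 * m) * (\<rho> * ((\<kappa>\<^sup>2 * s * \<rho> - \<kappa> * s / \<rho>) * A)) + V"
      unfolding V_def by (rule slice_transfer_upper[OF tr A0 A]) auto
    also have "\<kappa>\<^sup>2 * s * \<rho> - \<kappa> * s / \<rho> = W * ((\<kappa>\<^sup>2 * \<rho> - \<kappa> / \<rho>) / (\<kappa>\<^sup>2 - \<kappa>))"
      unfolding Wmult right_diff_distrib by (simp add: mult_ac)
    also have "(1 + c) ^ (2 * m) * (\<rho> * (W * ((\<kappa>\<^sup>2 * \<rho> - \<kappa> / \<rho>) / (\<kappa>\<^sup>2 - \<kappa>)) * A)) + V =
      W * (((1 + c) ^ (2 * m) * (\<rho> * ((\<kappa>\<^sup>2 * \<rho> - \<kappa> / \<rho>) / (\<kappa>\<^sup>2 - \<kappa>) * ((1 + c) * (\<kappa>\<^sup>2 * \<rho>) ^ m)))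
            + transfer_error c \<kappa> \<rho>) * \<Phi>)"
      unfolding Veq A_def by (simp only: distrib_left distrib_right mult_ac)
    also have "\<kappa>\<^sup>2 * s - \<kappa> * s = W" by (simp add: W_def algebra_simps)
    finally show ?thesis using W by (simp add: \<Phi>_def)
  qed
  show "(((\<kappa>\<^sup>2 / \<rho> - \<kappa> * \<rho>) / (\<kappa>\<^sup>2 - \<kappa>) * ((1 - c) * (1 - c) ^ m)) / \<rho> - transfer_error c \<kappa> \<rho>) / (1 + c) ^ (2 * m)
            * ((\<rho> - 1) * Y * model_density Y s) \<le> slice q Y \<rho> s"
  proof -
    define A where "A = (1 - c) * (1 - c) ^ m * \<Phi>"
    have A0: "0 \<le> A" unfolding A_def using c \<Phi>0 by auto
    have A: "A \<le> slice p Y \<rho> \<tau>" if \<tau>: "\<tau> \<in> {\<kappa> * s * \<rho>..\<kappa>\<^sup>2 * s / \<rho>}" for \<tau>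
    proof -
      have "\<kappa> * s * 1 \<le> \<kappa> * s * \<rho>" using s \<rho> \<kappa> by (intro mult_left_mono) auto
      hence \<tau>\<kappa>: "\<kappa> * s \<le> \<tau>" using \<tau> by simp
      have \<tau>s: "s \<le> \<tau>" using \<tau>\<kappa> \<kappa>s by linarith
      have "\<kappa>\<^sup>2 * s / \<rho> \<le> \<kappa>\<^sup>2 * s / 1" using s \<rho> by (intro divide_left_mono) auto
      hence \<tau>1: "\<tau> \<le> \<kappa>\<^sup>2 * s" using \<tau> by simp
      have "\<kappa>\<^sup>2 * s * 1 \<le> \<kappa>\<^sup>2 * s * \<rho>\<^sup>2" using s \<rho>\<rho> by (intro mult_left_mono) auto
      hence \<tau>2: "\<tau> \<le> \<kappa>\<^sup>2 * \<rho>\<^sup>2 * s" using \<tau>1 by (simp add: mult_ac)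
      have "(\<kappa> - 1) / \<rho>\<^sup>2 * s \<le> \<kappa> * s"
      proof -
        have "\<kappa> / \<rho> \<le> \<kappa> / 1" using \<rho> \<kappa> by (intro divide_left_mono) auto
        hence "\<kappa> / \<rho> * s \<le> \<kappa> * s" using s by (intro mult_right_mono) auto
        thus ?thesis using \<kappa>1 by linarith
      qed
      hence \<tau>3: "(\<kappa> - 1) / \<rho>\<^sup>2 * s \<le> \<tau>" using \<tau>\<kappa> by linarith
      have "(1 - c) ^ m * model_density Y s \<le> model_density Y \<tau>"
        by (rule model_density_ge[of _ "\<kappa>\<^sup>2"]) (use s \<tau>s \<tau>1 Y c \<kappa> L(2) L0 in \<open>auto simp: L0_def algebra_simps\<close>)
      hence "(1 - c) * ((\<rho> - 1) * Y * ((1 - c) ^ m * model_density Y s)) \<le> (1 - c) * ((\<rho> - 1) * Y * model_density Y \<tau>)"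
        using c \<rho> Y by (intro mult_left_mono) auto
      moreover have "(1 - c) * ((\<rho> - 1) * Y * ((1 - c) ^ m * model_density Y s)) = A" by (simp add: A_def \<Phi>_def)
      ultimately show ?thesis using T1[OF \<tau>3 \<tau>2] by linarith
    qed
    have le: "\<kappa> * s * \<rho> \<le> \<kappa>\<^sup>2 * s / \<rho>"
    proof -
      have "\<kappa> * (\<rho> * \<rho>) \<le> \<kappa> * \<kappa>" using \<rho>(2) \<kappa> by (intro mult_left_mono) (auto simp: power2_eq_square)
      hence "\<kappa> * (\<rho> * \<rho>) * s \<le> \<kappa> * \<kappa> * s" using s by (intro mult_right_mono) auto
      thus ?thesis using \<rho> by (simp add: field_simps power2_eq_square)
    qed
    have "(\<kappa>\<^sup>2 * s / \<rho> - \<kappa> * s * \<rho>) * A \<le> \<rho> * ((1 + c) ^ (2 * m) * ((\<kappa>\<^sup>2 * s - \<kappa> * s) * slice q Y \<rho> s) + V)"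
      unfolding V_def by (rule slice_transfer_lower[OF tr A0 le A]) auto
    also have "\<kappa>\<^sup>2 * s / \<rho> - \<kappa> * s * \<rho> = W * ((\<kappa>\<^sup>2 / \<rho> - \<kappa> * \<rho>) / (\<kappa>\<^sup>2 - \<kappa>))"
      unfolding Wmult right_diff_distrib by (simp add: mult_ac)
    also have "\<kappa>\<^sup>2 * s - \<kappa> * s = W" by (simp add: W_def algebra_simps)
    also have "\<rho> * ((1 + c) ^ (2 * m) * (W * slice q Y \<rho> s) + V) =
        W * (\<rho> * ((1 + c) ^ (2 * m) * slice q Y \<rho> s + transfer_error c \<kappa> \<rho> * \<Phi>))"
      unfolding Veq by (simp only: distrib_left mult_ac)
    finally have "(\<kappa>\<^sup>2 / \<rho> - \<kappa> * \<rho>) / (\<kappa>\<^sup>2 - \<kappa>) * A \<le> \<rho> * ((1 + c) ^ (2 * m) * slice q Y \<rho> s + transfer_error c \<kappa> \<rho> * \<Phi>)"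
      using W by (simp only: mult.assoc mult_le_cancel_left_pos)
    hence "((\<kappa>\<^sup>2 / \<rho> - \<kappa> * \<rho>) / (\<kappa>\<^sup>2 - \<kappa>) * A) / \<rho> \<le> (1 + c) ^ (2 * m) * slice q Y \<rho> s + transfer_error c \<kappa> \<rho> * \<Phi>"
      using \<rho> by (simp only: divide_le_eq mult.commute) simp
    moreover have "((\<kappa>\<^sup>2 / \<rho> - \<kappa> * \<rho>) / (\<kappa>\<^sup>2 - \<kappa>) * A) / \<rho> = (((\<kappa>\<^sup>2 / \<rho> - \<kappa> * \<rho>) / (\<kappa>\<^sup>2 - \<kappa>) * ((1 - c) * (1 - c) ^ m)) / \<rho>) * \<Phi>"
      by (simp add: A_def)
    ultimately have "((((\<kappa>\<^sup>2 / \<rho> - \<kappa> * \<rho>) / (\<kappa>\<^sup>2 - \<kappa>) * ((1 - c) * (1 - c) ^ m)) / \<rho>) - transfer_error c \<kappa> \<rho>) * \<Phi> \<le> (1 + c) ^ (2 * m) * slice q Y \<rho> s"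
      unfolding left_diff_distrib by linarith
    moreover have "0 < (1 + c) ^ (2 * m)" using c by simp
    ultimately show ?thesis unfolding \<Phi>_def[symmetric]
      by (simp only: times_divide_eq_left divide_le_eq) (simp add: mult.commute)
  qed
qed

text \<open>Three limits are taken in turn: first \<open>c \<rightarrow> 0\<close>, which removes the weight of the splitting, then \<open>\<kappa> \<rightarrow> 1\<close>,
  which makes the transfer error small although its factor \<open>(1 + 1 / c) ^ (2 * m)\<close> is large, and then \<open>\<rho> \<rightarrow> 1\<close>.\<close>

theorem slice_asymp_transfer:
  assumes p: "slice_asymp p" and pq: "p \<le> 1" "q \<le> 1"
  shows "slice_asymp q"
  unfolding slice_asymp_def
proof safe
  fix \<epsilon> \<eta> :: real
  assume \<epsilon>: "\<epsilon> > 0" and \<eta>: "\<eta> > 0"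
  have "\<forall>\<^sub>F c in at_right (0::real). 0 < c \<and> c < 1 \<and> (1 + c) ^ (2 * m) * (1 + c) < 1 + \<eta> \<and>
          (1 - \<eta>) < (1 - c) * (1 - c) ^ m / (1 + c) ^ (2 * m)"
  proof (intro eventually_conj)
    show "\<forall>\<^sub>F c in at_right (0::real). 0 < c" by (simp add: eventually_at_right_less)
    show "\<forall>\<^sub>F c in at_right (0::real). c < 1"
      by (rule order_tendstoD(2)[of _ 0]) auto
    show "\<forall>\<^sub>F c in at_right (0::real). (1 + c) ^ (2 * m) * (1 + c) < 1 + \<eta>"
      by (rule order_tendstoD(2)[of _ 1]) (use \<eta> in \<open>auto intro!: tendsto_eq_intros\<close>)
    show "\<forall>\<^sub>F c in at_right (0::real). (1 - \<eta>) < (1 - c) * (1 - c) ^ m / (1 + c) ^ (2 * m)"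
      by (rule order_tendstoD(1)[of _ 1]) (use \<eta> in \<open>auto intro!: tendsto_eq_intros\<close>)
  qed
  then obtain c :: real where c: "0 < c" "c < 1" and c1: "(1 + c) ^ (2 * m) * (1 + c) < 1 + \<eta>"
    and c2: "(1 - \<eta>) < (1 - c) * (1 - c) ^ m / (1 + c) ^ (2 * m)"
    using eventually_happens[of _ "at_right (0::real)"] trivial_limit_at_right_real by blast
  have cpos: "0 < (1 + c) ^ (2 * m)" using c by simp
  \<comment> \<open>The limit of the transfer error as \<open>\<rho> \<rightarrow> 1\<close>.\<close>
  define D where "D = (\<lambda>\<kappa>::real. (1 + 1 / c) ^ (2 * m) * ((1 + c) * (2 * ((\<kappa>\<^sup>2 - 1) * 2) ^ m)))"
  have D: "(D \<longlongrightarrow> 0) (at_right 1)"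
    unfolding D_def using m_pos by (auto intro!: tendsto_eq_intros)
  have "\<forall>\<^sub>F \<kappa> in at_right (1::real). 1 < \<kappa> \<and> (1 + c) ^ (2 * m) * ((1 + c) * (\<kappa>\<^sup>2) ^ m) + D \<kappa> < 1 + \<eta> \<and>
          1 - \<eta> < ((1 - c) * (1 - c) ^ m - D \<kappa>) / (1 + c) ^ (2 * m)"
  proof (intro eventually_conj)
    show "\<forall>\<^sub>F c in at_right (1::real). 1 < c" by (simp add: eventually_at_right_less)
    show "\<forall>\<^sub>F \<kappa> in at_right (1::real). (1 + c) ^ (2 * m) * ((1 + c) * (\<kappa>\<^sup>2) ^ m) + D \<kappa> < 1 + \<eta>"
      by (rule order_tendstoD(2)[of _ "(1 + c) ^ (2 * m) * (1 + c)"]) (use c1 in \<open>auto intro!: tendsto_eq_intros D\<close>)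
    show "\<forall>\<^sub>F \<kappa> in at_right (1::real). 1 - \<eta> < ((1 - c) * (1 - c) ^ m - D \<kappa>) / (1 + c) ^ (2 * m)"
      by (rule order_tendstoD(1)[of _ "((1 - c) * (1 - c) ^ m - 0) / (1 + c) ^ (2 * m)"])
         (use c2 cpos in \<open>auto intro!: tendsto_eq_intros D simp del: power_mult\<close>)
  qed
  then obtain \<kappa> :: real where \<kappa>: "1 < \<kappa>" and \<kappa>1: "(1 + c) ^ (2 * m) * ((1 + c) * (\<kappa>\<^sup>2) ^ m) + D \<kappa> < 1 + \<eta>"
    and \<kappa>2: "1 - \<eta> < ((1 - c) * (1 - c) ^ m - D \<kappa>) / (1 + c) ^ (2 * m)"
    using eventually_happens[of _ "at_right (1::real)"] trivial_limit_at_right_real by blast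
  have \<kappa>\<kappa>: "0 < \<kappa>\<^sup>2 - \<kappa>" using \<kappa> by (simp add: power2_eq_square)
  have err: "(transfer_error c \<kappa> \<longlongrightarrow> D \<kappa>) (at_right 1)"
  proof -
    have "(transfer_error c \<kappa> \<longlongrightarrow> (1 + 1 / c) ^ (2 * m) * (1\<^sup>2 * ((((\<kappa>\<^sup>2 - 1) * 1\<^sup>2 - (\<kappa> - 1) / 1\<^sup>2) / (\<kappa>\<^sup>2 - \<kappa>)) *
            ((1 + c) * ((1 + 1) * ((\<kappa>\<^sup>2 - 1) * 1\<^sup>2 * 2) ^ m))))) (at_right 1)"
      unfolding transfer_error_def[abs_def] by (intro tendsto_intros) (use \<kappa>\<kappa> in auto)
    moreover have "((\<kappa>\<^sup>2 - 1) * 1\<^sup>2 - (\<kappa> - 1) / 1\<^sup>2) / (\<kappa>\<^sup>2 - \<kappa>) = 1" using \<kappa>\<kappa> by simp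
    ultimately show ?thesis by (simp add: D_def del: power_mult)
  qed
  define U where "U = (\<lambda>\<rho>. (1 + c) ^ (2 * m) * (\<rho> * ((\<kappa>\<^sup>2 * \<rho> - \<kappa> / \<rho>) / (\<kappa>\<^sup>2 - \<kappa>) * ((1 + c) * (\<kappa>\<^sup>2 * \<rho>) ^ m))) + transfer_error c \<kappa> \<rho>)"
  define L where "L = (\<lambda>\<rho>. (((\<kappa>\<^sup>2 / \<rho> - \<kappa> * \<rho>) / (\<kappa>\<^sup>2 - \<kappa>) * ((1 - c) * (1 - c) ^ m)) / \<rho> - transfer_error c \<kappa> \<rho>) / (1 + c) ^ (2 * m))"
  have \<kappa>_ne: "\<kappa>\<^sup>2 - \<kappa> \<noteq> 0" using \<kappa>\<kappa> by simp
  have U: "(U \<longlongrightarrow> (1 + c) ^ (2 * m) * (1 * ((\<kappa>\<^sup>2 * 1 - \<kappa> / 1) / (\<kappa>\<^sup>2 - \<kappa>) * ((1 + c) * (\<kappa>\<^sup>2 * 1) ^ m))) + D \<kappa>) (at_right 1)"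
    unfolding U_def by (intro tendsto_intros err) (use \<kappa>_ne in auto)
  have L: "(L \<longlongrightarrow> (((\<kappa>\<^sup>2 / 1 - \<kappa> * 1) / (\<kappa>\<^sup>2 - \<kappa>) * ((1 - c) * (1 - c) ^ m)) / 1 - D \<kappa>) / (1 + c) ^ (2 * m)) (at_right 1)"
    unfolding L_def by (intro tendsto_intros err) (use \<kappa>_ne c in auto)
  have "\<forall>\<^sub>F \<rho> in at_right 1. U \<rho> < 1 + \<eta>"
    by (rule order_tendstoD(2)[OF U]) (use \<kappa>_ne \<kappa>1 in simp)
  moreover have "\<forall>\<^sub>F \<rho> in at_right 1. 1 - \<eta> < L \<rho>"
    by (rule order_tendstoD(1)[OF L]) (use \<kappa>_ne \<kappa>2 in simp)
  moreover have "\<forall>\<^sub>F \<rho> in at_right 1. \<rho>\<^sup>2 < min \<kappa> 4"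
    by (rule order_tendstoD(2)[of _ "1\<^sup>2"]) (use \<kappa> in \<open>auto intro!: tendsto_eq_intros\<close>)
  moreover have "\<forall>\<^sub>F \<rho> in at_right (1::real). 1 < \<rho>" by (simp add: eventually_at_right_less)
  moreover have ev: "\<forall>\<^sub>F \<rho> in at_right 1. \<forall>\<^sub>F Y in at_top. \<forall>s\<in>{Y powr (\<epsilon> / 2)..Y powr (1 - \<epsilon> / 2)}.
     (1 - c) * ((\<rho> - 1) * Y * model_density Y s) \<le> slice p Y \<rho> s \<and>
     slice p Y \<rho> s \<le> (1 + c) * ((\<rho> - 1) * Y * model_density Y s)"
    using p \<epsilon> c unfolding slice_asymp_def by (meson half_gt_zero)
  moreover note eventually_compose_filterlim[OF ev filterlim_power2_at_right_1]
  ultimately show "\<forall>\<^sub>F \<rho> in at_right 1. \<forall>\<^sub>F Y in at_top. \<forall>s\<in>{Y powr \<epsilon>..Y powr (1 - \<epsilon>)}.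
     (1 - \<eta>) * ((\<rho> - 1) * Y * model_density Y s) \<le> slice q Y \<rho> s \<and>
     slice q Y \<rho> s \<le> (1 + \<eta>) * ((\<rho> - 1) * Y * model_density Y s)"
  proof eventually_elim
    case (elim \<rho>)
    have \<rho>: "1 < \<rho>" "\<rho>\<^sup>2 \<le> \<kappa>" "\<rho>\<^sup>2 \<le> 4" using elim by auto
    \<comment> \<open>The logarithm in the density must be large in terms of \<open>c\<close>, \<open>\<kappa>\<close> and \<open>\<rho>\<close>.\<close>
    define K where "K = max (ln (\<rho>\<^sup>2 / (\<kappa> - 1))) (ln (\<kappa>\<^sup>2) / c)"
    have "\<forall>\<^sub>F Y in at_top. (1::real) \<le> Y" by (rule eventually_ge_at_top)
    moreover have "\<forall>\<^sub>F Y in at_top. Y powr (1 - \<epsilon>) \<le> (\<rho> - 1) * Y" using \<epsilon> \<rho> by real_asymp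
    moreover have "\<forall>\<^sub>F Y in at_top. K \<le> ln (Y / (E * Y powr (1 - \<epsilon>)))" using \<epsilon> E_pos by real_asymp
    moreover have "\<forall>\<^sub>F Y in at_top. E * (\<kappa>\<^sup>2 * \<rho>\<^sup>2 * Y powr (1 - \<epsilon>)) \<le> Y" using \<epsilon> \<rho> \<kappa> E_pos by real_asymp
    moreover have "\<forall>\<^sub>F Y in at_top. Y powr (\<epsilon> / 2) \<le> (\<kappa> - 1) / \<rho>\<^sup>2 * Y powr \<epsilon>" using \<epsilon> \<rho> \<kappa> by real_asymp
    moreover have "\<forall>\<^sub>F Y in at_top. \<kappa>\<^sup>2 * \<rho>\<^sup>2 * Y powr (1 - \<epsilon>) \<le> Y powr (1 - \<epsilon> / 2)" using \<epsilon> \<rho> \<kappa> by real_asymp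
    moreover note elim(5) elim(6)
    ultimately show ?case
    proof eventually_elim
      case (elim Y)
      note T1 = elim(7) and T2 = elim(8)
      show ?case
      proof
        fix s assume s: "s \<in> {Y powr \<epsilon>..Y powr (1 - \<epsilon>)}"
        have "0 < Y powr \<epsilon>" using elim(1) by simp
        hence s0: "0 < s" using s by (metis atLeastAtMost_iff less_le_trans)
        have Klog: "K \<le> ln (Y / (E * s))"
        proof -
          have "ln (Y / (E * Y powr (1 - \<epsilon>))) \<le> ln (Y / (E * s))"
            using s s0 elim(1) E_pos by (subst ln_le_cancel_iff) (auto intro!: divide_left_mono mult_pos_pos)
          thus ?thesis using elim(3) by linarith
        qed
        have range: "\<tau> \<in> {Y powr (\<epsilon> / 2)..Y powr (1 - \<epsilon> / 2)}"
          if "(\<kappa> - 1) / \<rho>\<^sup>2 * s \<le> \<tau>" "\<tau> \<le> \<kappa>\<^sup>2 * \<rho>\<^sup>2 * s" for \<tau>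
        proof -
          have "(\<kappa> - 1) / \<rho>\<^sup>2 * Y powr \<epsilon> \<le> (\<kappa> - 1) / \<rho>\<^sup>2 * s" using s \<kappa> by (intro mult_left_mono) auto
          moreover have "\<kappa>\<^sup>2 * \<rho>\<^sup>2 * s \<le> \<kappa>\<^sup>2 * \<rho>\<^sup>2 * Y powr (1 - \<epsilon>)" using s by (intro mult_left_mono) auto
          ultimately show ?thesis using that elim(5,6) by auto
        qed
        have big: "E * (\<kappa>\<^sup>2 * \<rho>\<^sup>2 * s) \<le> Y"
        proof -
          have "E * (\<kappa>\<^sup>2 * \<rho>\<^sup>2 * s) \<le> E * (\<kappa>\<^sup>2 * \<rho>\<^sup>2 * Y powr (1 - \<epsilon>))"
            using s E_pos by (intro mult_left_mono) auto
          thus ?thesis using elim(4) by linarith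
        qed
        have L: "ln (\<rho>\<^sup>2 / (\<kappa> - 1)) \<le> ln (Y / (E * s))" "ln (\<kappa>\<^sup>2) \<le> c * ln (Y / (E * s))"
          using Klog c by (auto simp: K_def field_simps)
        have sY: "s \<le> (\<rho> - 1) * Y" using s elim(2) by auto
        note tr = slice_transfer_density[OF elim(1) \<rho>(1,2) pq c s0 sY L big T1[rule_format, OF range] conjunct2[OF T2[rule_format, OF range]]]
        have lnnn: "0 \<le> ln (Y / (E * s))"
        proof -
          have "0 \<le> ln (\<kappa>\<^sup>2)" using \<kappa> by (intro ln_ge_zero) (simp add: one_le_power)
          thus ?thesis using L(2) c by (meson order_trans zero_le_mult_iff not_less)
        qed
        have "0 \<le> (\<rho> - 1) * Y * model_density Y s"
          using \<rho> elim(1) lnnn s0 \<mu>_pos by (simp add: model_density_def)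
        hence "U \<rho> * ((\<rho> - 1) * Y * model_density Y s) \<le> (1 + \<eta>) * ((\<rho> - 1) * Y * model_density Y s)"
          "(1 - \<eta>) * ((\<rho> - 1) * Y * model_density Y s) \<le> L \<rho> * ((\<rho> - 1) * Y * model_density Y s)"
          using \<open>U \<rho> < 1 + \<eta>\<close> \<open>1 - \<eta> < L \<rho>\<close> by (intro mult_right_mono; simp)+
        moreover have "slice q Y \<rho> s \<le> U \<rho> * ((\<rho> - 1) * Y * model_density Y s)"
          unfolding U_def by (rule tr(1)) assumption+
        moreover have "L \<rho> * ((\<rho> - 1) * Y * model_density Y s) \<le> slice q Y \<rho> s"
          unfolding L_def by (rule tr(2)) assumption+
        ultimately show "(1 - \<eta>) * ((\<rho> - 1) * Y * model_density Y s) \<le> slice q Y \<rho> s \<and>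
            slice q Y \<rho> s \<le> (1 + \<eta>) * ((\<rho> - 1) * Y * model_density Y s)" by linarith
      qed
    qed
  qed
qed

section \<open>Main terms\<close>

text \<open>For \<open>p = 0\<close> and \<open>p = 1\<close> the main terms of the two formulas. Both are primitives of
  \<open>x \<mapsto> model_density x (t x\<^sup>p)\<close>, which is what \<open>model_increment\<close> exploits.\<close>

definition model :: "nat \<Rightarrow> real \<Rightarrow> real \<Rightarrow> real" where
  "model p X t = (if p = 0 then \<mu> * t ^ (m + 1) * integral {E..X / t} (\<lambda>x. ln (x / E) ^ m)
     else \<mu> / (real m + 1) * X ^ (m + 1) * t ^ m * ln (1 / (E * t)) ^ m)"

definition moment_asymp :: "nat \<Rightarrow> bool" where
  "moment_asymp p \<longleftrightarrow> (\<forall>\<epsilon>>0. \<forall>\<eta>>0. \<forall>\<^sub>F X in at_top. \<forall>t. t * X ^ p \<in> {X powr \<epsilon>..X powr (1 - \<epsilon>)} \<longrightarrow>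
     \<bar>moment p t 1 X / model p X t - 1\<bar> < \<eta>)"

lemma ln_pow_integral_bounds:
  assumes "E \<le> a" "a \<le> b"
  shows "(b - a) * ln (a / E) ^ m \<le> integral {a..b} (\<lambda>x. ln (x / E) ^ m)"
    and "integral {a..b} (\<lambda>x. ln (x / E) ^ m) \<le> (b - a) * ln (b / E) ^ m"
    and "(\<lambda>x. ln (x / E) ^ m) integrable_on {a..b}"
proof -
  have cont: "continuous_on {a..b} (\<lambda>x. ln (x / E) ^ m)"
    using assms E_pos by (intro continuous_intros) auto
  show int: "(\<lambda>x. ln (x / E) ^ m) integrable_on {a..b}"
    using cont by (rule integrable_continuous_real)
  have mono: "ln (x / E) ^ m \<le> ln (y / E) ^ m" if "E \<le> x" "x \<le> y" for x y
  proof (rule power_mono)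
    show "0 \<le> ln (x / E)" using that E_pos by (intro ln_ge_zero) auto
    show "ln (x / E) \<le> ln (y / E)" using that E_pos by (subst ln_le_cancel_iff) (auto simp: divide_right_mono)
  qed
  have "integral {a..b} (\<lambda>x. ln (a / E) ^ m) \<le> integral {a..b} (\<lambda>x. ln (x / E) ^ m)"
    using assms mono int by (intro integral_le) auto
  thus "(b - a) * ln (a / E) ^ m \<le> integral {a..b} (\<lambda>x. ln (x / E) ^ m)" using assms by simp
  have "integral {a..b} (\<lambda>x. ln (x / E) ^ m) \<le> integral {a..b} (\<lambda>x. ln (b / E) ^ m)"
    using assms mono int by (intro integral_le) auto
  thus "integral {a..b} (\<lambda>x. ln (x / E) ^ m) \<le> (b - a) * ln (b / E) ^ m" using assms by simp
qed

lemma model_increment: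
  assumes "0 < Y" "Y \<le> X" "0 < t" "p \<le> 1" "E * (t * Y ^ p) \<le> Y"
  shows "(X - Y) * model_density Y (t * Y ^ p) \<le> model p X t - model p Y t"
    and "model p X t - model p Y t \<le> (X - Y) * model_density X (t * X ^ p)"
proof -
  have X: "0 < X" using assms by simp
  have "(X - Y) * model_density Y (t * Y ^ p) \<le> model p X t - model p Y t \<and>
    model p X t - model p Y t \<le> (X - Y) * model_density X (t * X ^ p)"
  proof (cases "p = 0")
    case True
    have E: "E \<le> Y / t" "Y / t \<le> X / t" using True assms by (auto simp: field_simps)
    have "integral {E..Y / t} (\<lambda>x. ln (x / E) ^ m) + integral {Y / t..X / t} (\<lambda>x. ln (x / E) ^ m) =
          integral {E..X / t} (\<lambda>x. ln (x / E) ^ m)"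
      using E by (intro Henstock_Kurzweil_Integration.integral_combine ln_pow_integral_bounds(3)) auto
    hence eq: "model p X t - model p Y t = \<mu> * t ^ (m + 1) * integral {Y / t..X / t} (\<lambda>x. ln (x / E) ^ m)"
      using True by (simp add: model_def right_diff_distrib[symmetric])
    have dens: "(X - Y) * model_density Z t = \<mu> * t ^ (m + 1) * ((X / t - Y / t) * ln (Z / t / E) ^ m)" for Z
      using assms by (simp add: model_density_def power_mult_distrib diff_divide_distrib[symmetric] mult_ac)
    have c: "0 \<le> \<mu> * t ^ (m + 1)" using assms \<mu>_pos by simp
    show ?thesis unfolding eq using True
      by (simp only: power_0 mult_1_right dens)
         (intro conjI mult_left_mono c ln_pow_integral_bounds E)
  next
    case False
    hence p: "p = 1" using assms by simp
    have Et: "E * t \<le> 1" using assms p by simp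
    hence L: "0 \<le> ln (1 / (E * t))" using assms E_pos by (intro ln_ge_zero) auto
    define c where "c = \<mu> * (t * ln (1 / (E * t))) ^ m"
    have c: "0 \<le> c" using L assms \<mu>_pos by (simp add: c_def)
    have dens: "(X - Y) * model_density Z (t * Z ^ p) = c * ((X - Y) * Z ^ m)" if "0 < Z" for Z
      using that p by (simp add: c_def model_density_def power_mult_distrib mult_ac)
    have eq: "model p X t - model p Y t = c * ((X ^ (m + 1) - Y ^ (m + 1)) / (real m + 1))"
      using p by (simp add: model_def c_def power_mult_distrib diff_divide_distrib right_diff_distrib mult_ac)
    show ?thesis unfolding eq dens[OF assms(1)] dens[OF X]
      using c assms by (intro conjI mult_left_mono power_Suc_diff_bounds) auto
  qed
  thus "(X - Y) * model_density Y (t * Y ^ p) \<le> model p X t - model p Y t"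
    and "model p X t - model p Y t \<le> (X - Y) * model_density X (t * X ^ p)" by auto
qed

lemma model_density_nonneg: "0 < s \<Longrightarrow> E * s \<le> Y \<Longrightarrow> 0 \<le> model_density Y s"
  using E_pos \<mu>_pos by (auto simp: model_density_def intro!: mult_nonneg_nonneg zero_le_power ln_ge_zero)

lemma model_bounds:
  assumes "0 < X" "0 < t" "p \<le> 1" "E * (t * X ^ p) \<le> X"
  shows "0 \<le> model p X t" and "model p X t \<le> X * model_density X (t * X ^ p)"
proof -
  have "0 \<le> model p X t \<and> model p X t \<le> X * model_density X (t * X ^ p)"
  proof (cases "p = 0")
    case True
    have E: "E \<le> X / t" using True assms by (auto simp: field_simps)
    define c where "c = \<mu> * t ^ (m + 1)"
    have c: "0 \<le> c" using assms \<mu>_pos by (simp add: c_def)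
    have "1 \<le> X / t / E" using E E_pos by (simp only: le_divide_eq_1_pos)
    hence L: "0 \<le> ln (X / t / E)" by (rule ln_ge_zero)
    have eq: "model p X t = c * integral {E..X / t} (\<lambda>x. ln (x / E) ^ m)"
      using True by (simp add: model_def c_def)
    have dens: "X * model_density X (t * X ^ p) = c * (X / t * ln (X / t / E) ^ m)"
      using assms True by (simp add: c_def model_density_def power_mult_distrib mult_ac)
    have "integral {E..X / t} (\<lambda>x. ln (x / E) ^ m) \<le> (X / t - E) * ln (X / t / E) ^ m"
      using E by (intro ln_pow_integral_bounds) auto
    also have "\<dots> \<le> X / t * ln (X / t / E) ^ m" using L E_pos by (intro mult_right_mono) auto
    finally have le: "integral {E..X / t} (\<lambda>x. ln (x / E) ^ m) \<le> X / t * ln (X / t / E) ^ m" .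
    have "0 \<le> (X / t - E) * ln (E / E) ^ m" using E E_pos by simp
    also have "\<dots> \<le> integral {E..X / t} (\<lambda>x. ln (x / E) ^ m)"
      using E by (intro ln_pow_integral_bounds) auto
    finally have "0 \<le> integral {E..X / t} (\<lambda>x. ln (x / E) ^ m)" .
    thus ?thesis unfolding eq dens by (intro conjI mult_nonneg_nonneg mult_left_mono c le)
  next
    case False
    hence p: "p = 1" using assms by simp
    have Et: "E * t \<le> 1" using assms p by simp
    hence L: "0 \<le> ln (1 / (E * t))" using assms E_pos by (intro ln_ge_zero) auto
    define c where "c = \<mu> * (t * ln (1 / (E * t))) ^ m * X ^ (m + 1)"
    have c: "0 \<le> c" using L assms \<mu>_pos by (simp add: c_def)
    have dens: "X * model_density X (t * X ^ p) = c"
      using assms p by (simp add: c_def model_density_def power_mult_distrib mult_ac)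
    have eq: "model p X t = c / (real m + 1)"
      using p by (simp add: model_def c_def power_mult_distrib mult_ac)
    have "c / (real m + 1) \<le> c / 1" using c by (intro divide_left_mono) auto
    thus ?thesis unfolding eq dens using c by auto
  qed
  thus "0 \<le> model p X t" and "model p X t \<le> X * model_density X (t * X ^ p)" by auto
qed

text \<open>The main term grows at least linearly, because its derivative increases.\<close>

lemma model_ratio:
  assumes "0 < Y" "Y \<le> X" "0 < t" "p \<le> 1" "E * (t * Y ^ p) \<le> Y"
  shows "(X - Y) * model p Y t \<le> Y * model p X t"
proof -
  have "(X - Y) * model p Y t \<le> (X - Y) * (Y * model_density Y (t * Y ^ p))"
    using assms by (intro mult_left_mono model_bounds) auto
  also have "\<dots> \<le> Y * (model p X t - model p Y t)"
    using assms model_increment(1)[OF assms] by simp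
  also have "\<dots> \<le> Y * model p X t"
    using model_bounds(1)[of Y t p] assms by (intro mult_left_mono) auto
  finally show ?thesis .
qed

text \<open>Along a thin slice the density changes by a factor at most \<open>(\<rho> (1 + log \<rho>))\<^sup>m\<close>, once the logarithm in it is at least \<open>1\<close>.\<close>

lemma slice_model_increment:
  assumes "0 < Y" "1 < \<rho>" "0 < s" "p \<le> 1" "1 \<le> ln (Y / (E * s))" "E * (\<rho> * s) \<le> Y"
    and "(\<rho> * (1 + ln \<rho>)) ^ m \<le> 1 + \<eta>"
  shows "(\<rho> - 1) * Y * model_density Y s \<le> model p (\<rho> * Y) (s / Y ^ p) - model p Y (s / Y ^ p)"
    and "model p (\<rho> * Y) (s / Y ^ p) - model p Y (s / Y ^ p) \<le> (1 + \<eta>) * ((\<rho> - 1) * Y * model_density Y s)"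
    and "0 \<le> model p Y (s / Y ^ p)"
    and "model p (\<rho> * Y) (s / Y ^ p) \<le> \<rho> * Y * ((1 + \<eta>) * model_density Y s)"
proof -
  define t where "t = s / Y ^ p"
  have t: "0 < t" using assms by (simp add: t_def)
  have tY: "t * Y ^ p = s" using assms by (simp add: t_def)
  have tX: "t * (\<rho> * Y) ^ p = \<rho> ^ p * s" using assms by (simp add: t_def power_mult_distrib)
  note \<rho>p = power_le_one_bounds[of \<rho> p]
  have "s \<le> \<rho> * s" using assms by simp
  hence Es: "E * s \<le> Y" using assms E_pos by (meson mult_left_mono less_imp_le order_trans)
  have "E * (\<rho> ^ p * s) \<le> E * (\<rho> * s)" using \<rho>p assms E_pos by (intro mult_left_mono mult_right_mono) auto
  moreover have "Y \<le> \<rho> * Y" using assms by simp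
  ultimately have EsX: "E * (\<rho> ^ p * s) \<le> \<rho> * Y" using assms by linarith
  have densX: "model_density (\<rho> * Y) (\<rho> ^ p * s) \<le> (1 + \<eta>) * model_density Y s"
  proof -
    have ln\<rho>: "0 \<le> ln \<rho>" using assms by simp
    have "ln (\<rho> * Y / (E * (\<rho> ^ p * s))) \<le> ln (\<rho> * (Y / (E * s)))"
    proof (subst ln_le_cancel_iff)
      have "\<rho> * Y / (E * (\<rho> ^ p * s)) \<le> \<rho> * Y / (E * (1 * s))"
        using \<rho>p assms E_pos by (intro divide_left_mono mult_left_mono mult_right_mono mult_pos_pos) auto
      thus "\<rho> * Y / (E * (\<rho> ^ p * s)) \<le> \<rho> * (Y / (E * s))" by simp
    qed (use assms E_pos in auto)
    also have "\<dots> = ln \<rho> + ln (Y / (E * s))" by (subst ln_mult) (use assms E_pos in auto)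
    also have "\<dots> \<le> (1 + ln \<rho>) * ln (Y / (E * s))"
      using mult_left_mono[OF assms(5) ln\<rho>] by (simp add: algebra_simps)
    finally have "(\<rho> ^ p * s) * ln (\<rho> * Y / (E * (\<rho> ^ p * s))) \<le> (\<rho> * s) * ((1 + ln \<rho>) * ln (Y / (E * s)))"
      using assms \<rho>p EsX E_pos by (intro mult_mono ln_ge_zero) auto
    hence "((\<rho> ^ p * s) * ln (\<rho> * Y / (E * (\<rho> ^ p * s)))) ^ m \<le> ((\<rho> * s) * ((1 + ln \<rho>) * ln (Y / (E * s)))) ^ m"
      using assms \<rho>p EsX E_pos by (intro power_mono mult_nonneg_nonneg ln_ge_zero) auto
    hence "model_density (\<rho> * Y) (\<rho> ^ p * s) \<le> (\<rho> * (1 + ln \<rho>)) ^ m * model_density Y s"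
      using \<mu>_pos by (simp add: model_density_def power_mult_distrib mult_ac)
    also have "\<dots> \<le> (1 + \<eta>) * model_density Y s"
      using assms Es by (intro mult_right_mono model_density_nonneg) auto
    finally show ?thesis .
  qed
  note inc = model_increment[of Y "\<rho> * Y" t p, unfolded tY tX]
  have Y\<rho>: "(\<rho> - 1) * Y = \<rho> * Y - Y" by (simp add: algebra_simps)
  show "(\<rho> - 1) * Y * model_density Y s \<le> model p (\<rho> * Y) (s / Y ^ p) - model p Y (s / Y ^ p)"
    unfolding Y\<rho> t_def[symmetric] using assms t Es by (intro inc) auto
  have "model p (\<rho> * Y) t - model p Y t \<le> (\<rho> * Y - Y) * model_density (\<rho> * Y) (\<rho> ^ p * s)"
    using assms t Es by (intro inc) auto
  also have "\<dots> \<le> (\<rho> * Y - Y) * ((1 + \<eta>) * model_density Y s)"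
    using densX assms by (intro mult_left_mono) auto
  finally show "model p (\<rho> * Y) (s / Y ^ p) - model p Y (s / Y ^ p) \<le> (1 + \<eta>) * ((\<rho> - 1) * Y * model_density Y s)"
    unfolding Y\<rho> t_def[symmetric] by (simp add: mult_ac)
  show "0 \<le> model p Y (s / Y ^ p)"
    unfolding t_def[symmetric] using assms t Es tY by (intro model_bounds) auto
  have "model p (\<rho> * Y) t \<le> \<rho> * Y * model_density (\<rho> * Y) (t * (\<rho> * Y) ^ p)"
    using assms t EsX tX by (intro model_bounds) auto
  also have "\<dots> \<le> \<rho> * Y * ((1 + \<eta>) * model_density Y s)"
    unfolding tX using densX assms by (intro mult_left_mono) auto
  finally show "model p (\<rho> * Y) (s / Y ^ p) \<le> \<rho> * Y * ((1 + \<eta>) * model_density Y s)"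
    by (simp add: t_def)
qed

lemma eventually_small_ratio:
  fixes \<eta> :: real
  assumes "\<eta> > 0"
  shows "\<forall>\<^sub>F \<rho> in at_right (1::real). (\<rho> * (1 + ln \<rho>)) ^ m \<le> 1 + \<eta>"
proof -
  have "((\<lambda>\<rho>::real. (\<rho> * (1 + ln \<rho>)) ^ m) \<longlongrightarrow> (1 * (1 + ln 1)) ^ m) (at_right 1)"
    by (intro tendsto_intros) auto
  hence "\<forall>\<^sub>F \<rho> in at_right 1. (\<rho> * (1 + ln \<rho>)) ^ m < 1 + \<eta>"
    by (rule order_tendstoD(2)) (use assms in simp)
  thus ?thesis by eventually_elim simp
qed

section \<open>From long ranges to thin slices and back\<close>

text \<open>The errors of the two long integrals are relative to integrals over \<open>[1, Y]\<close>, hence larger by a factor of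
  order \<open>1 / (\<rho> - 1)\<close> than what the slice allows; this is harmless since \<open>\<rho>\<close> is fixed before \<open>Y\<close>.\<close>

lemma moment_asymp_imp_slice_asymp:
  assumes P: "moment_asymp p" and p: "p \<le> 1"
  shows "slice_asymp p"
  unfolding slice_asymp_def
proof safe
  fix \<epsilon> \<eta> :: real
  assume \<epsilon>: "\<epsilon> > 0" and \<eta>: "\<eta> > 0"
  have "\<forall>\<^sub>F \<rho> in at_right (1::real). 1 < \<rho>" by (simp add: eventually_at_right_less)
  moreover have "\<forall>\<^sub>F \<rho> in at_right (1::real). \<rho> < 2"
    by (rule order_tendstoD(2)[of _ 1]) auto
  moreover have "\<forall>\<^sub>F \<rho> in at_right 1. (\<rho> * (1 + ln \<rho>)) ^ m \<le> 1 + \<eta> / 2"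
    using \<eta> by (intro eventually_small_ratio) auto
  ultimately show "\<forall>\<^sub>F \<rho> in at_right 1. \<forall>\<^sub>F Y in at_top. \<forall>s\<in>{Y powr \<epsilon>..Y powr (1 - \<epsilon>)}.
     (1 - \<eta>) * ((\<rho> - 1) * Y * model_density Y s) \<le> slice p Y \<rho> s \<and>
     slice p Y \<rho> s \<le> (1 + \<eta>) * ((\<rho> - 1) * Y * model_density Y s)"
  proof eventually_elim
    case (elim \<rho>)
    note \<rho> = elim
    \<comment> \<open>The factor \<open>\<rho> - 1\<close> makes the error of the long integrals small on the scale of one slice.\<close>
    define \<eta>' where "\<eta>' = min 1 (\<eta> * (\<rho> - 1) / (8 * (1 + \<eta> / 2)))"
    have \<eta>': "0 < \<eta>'" "\<eta>' \<le> 1" unfolding \<eta>'_def using \<eta> \<rho> by auto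
    have "\<eta>' \<le> \<eta> * (\<rho> - 1) / (8 * (1 + \<eta> / 2))" by (simp add: \<eta>'_def)
    hence \<eta>'2: "2 * \<eta>' * (2 * (1 + \<eta> / 2)) \<le> \<eta> / 2 * (\<rho> - 1)" using \<eta> by (simp add: field_simps)
    have ev: "\<forall>\<^sub>F X in at_top. \<forall>t. t * X ^ p \<in> {X powr (\<epsilon> / 2)..X powr (1 - \<epsilon> / 2)} \<longrightarrow>
       \<bar>moment p t 1 X / model p X t - 1\<bar> < \<eta>'"
      using P \<epsilon> \<eta>' unfolding moment_asymp_def by (meson half_gt_zero)
    have lim: "filterlim (\<lambda>Y. \<rho> * Y) at_top at_top" using \<rho> by real_asymp
    note eventually_compose_filterlim[OF ev lim]
    moreover note ev
    moreover have "\<forall>\<^sub>F Y in at_top. (1::real) \<le> Y" by (rule eventually_ge_at_top)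
    moreover have "\<forall>\<^sub>F Y in at_top. 1 \<le> ln (Y / (E * Y powr (1 - \<epsilon>)))" using \<epsilon> E_pos by real_asymp
    moreover have "\<forall>\<^sub>F Y in at_top. E * (\<rho> * Y powr (1 - \<epsilon>)) \<le> Y" using \<epsilon> \<rho> E_pos by real_asymp
    moreover have "\<forall>\<^sub>F Y in at_top. (\<rho> * Y) powr (\<epsilon> / 2) \<le> Y powr \<epsilon>" using \<epsilon> \<rho> by real_asymp
    moreover have "\<forall>\<^sub>F Y in at_top. Y powr (\<epsilon> / 2) \<le> Y powr \<epsilon>" using \<epsilon> by real_asymp
    moreover have "\<forall>\<^sub>F Y in at_top. Y powr (1 - \<epsilon>) \<le> Y powr (1 - \<epsilon> / 2)" using \<epsilon> by real_asymp
    moreover have "\<forall>\<^sub>F Y in at_top. \<rho> * Y powr (1 - \<epsilon>) \<le> (\<rho> * Y) powr (1 - \<epsilon> / 2)" using \<epsilon> \<rho> by real_asymp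
    ultimately show ?case
    proof eventually_elim
      case (elim Y)
      show ?case
      proof
        fix s assume s: "s \<in> {Y powr \<epsilon>..Y powr (1 - \<epsilon>)}"
        have "0 < Y powr \<epsilon>" using elim(3) by simp
        hence s0: "0 < s" using s by (metis atLeastAtMost_iff less_le_trans)
        have L: "1 \<le> ln (Y / (E * s))"
        proof -
          have "ln (Y / (E * Y powr (1 - \<epsilon>))) \<le> ln (Y / (E * s))"
            using s s0 elim(3) E_pos by (subst ln_le_cancel_iff) (auto intro!: divide_left_mono mult_pos_pos)
          thus ?thesis using elim(4) by linarith
        qed
        have "E * (\<rho> * s) \<le> E * (\<rho> * Y powr (1 - \<epsilon>))" using s \<rho> E_pos by (intro mult_left_mono) auto
        hence Es: "E * (\<rho> * s) \<le> Y" using elim(5) by linarith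
        have Y: "0 < Y" using elim(3) by simp
        note inc = slice_model_increment[OF Y \<rho>(1) s0 p L Es \<rho>(3)]
        define t where "t = s / Y ^ p"
        have t: "0 < t" using s0 Y by (simp add: t_def)
        define gX gY where "gX = model p (\<rho> * Y) t" and "gY = model p Y t"
        define \<Phi> where "\<Phi> = Y * model_density Y s"
        have "E * s \<le> E * (\<rho> * s)" using s0 \<rho> E_pos by (intro mult_left_mono) auto
        hence \<Phi>: "0 \<le> \<Phi>" unfolding \<Phi>_def using Y s0 Es by (intro mult_nonneg_nonneg model_density_nonneg) auto
        have i: "(\<rho> - 1) * \<Phi> \<le> gX - gY" "gX - gY \<le> (1 + \<eta> / 2) * ((\<rho> - 1) * \<Phi>)" "0 \<le> gY"
            "gX \<le> \<rho> * ((1 + \<eta> / 2) * \<Phi>)"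
          using inc by (auto simp: gX_def gY_def \<Phi>_def t_def mult_ac)
        have "0 \<le> (\<rho> - 1) * \<Phi>" using \<rho> \<Phi> by simp
        have gX0: "0 \<le> gX" "gY \<le> gX"
          using i(1,3) \<open>0 \<le> (\<rho> - 1) * \<Phi>\<close> by linarith+
        have "t * Y ^ p = s" using Y by (simp add: t_def)
        hence "\<bar>moment p t 1 Y / gY - 1\<bar> < \<eta>'"
          using elim(2) s elim(7,8) by (auto simp: gY_def)
        hence eY: "\<bar>moment p t 1 Y - gY\<bar> \<le> \<eta>' * gY" using \<eta>' i by (intro relative_error_le) auto
        have tX: "t * (\<rho> * Y) ^ p = \<rho> ^ p * s" using Y by (simp add: t_def power_mult_distrib)
        have \<rho>p: "1 \<le> \<rho> ^ p" "\<rho> ^ p \<le> \<rho>" using power_le_one_bounds[of \<rho> p] \<rho> p by auto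
        have "1 * s \<le> \<rho> ^ p * s" "\<rho> ^ p * s \<le> \<rho> * Y powr (1 - \<epsilon>)"
          using s s0 \<rho>p \<rho> by (intro mult_mono; auto)+
        hence "t * (\<rho> * Y) ^ p \<in> {(\<rho> * Y) powr (\<epsilon> / 2)..(\<rho> * Y) powr (1 - \<epsilon> / 2)}"
          unfolding tX using s elim(6,9) by auto
        hence "\<bar>moment p t 1 (\<rho> * Y) / gX - 1\<bar> < \<eta>'"
          using elim(1) by (simp add: gX_def)
        hence eX: "\<bar>moment p t 1 (\<rho> * Y) - gX\<bar> \<le> \<eta>' * gX" using \<eta>' gX0 by (intro relative_error_le) auto
        have "moment p t 1 Y + moment p t Y (\<rho> * Y) = moment p t 1 (\<rho> * Y)"
          using elim(3) \<rho> t by (intro moment_combine) auto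
        hence sl: "slice p Y \<rho> s = moment p t 1 (\<rho> * Y) - moment p t 1 Y" by (simp add: slice_def t_def)
        have eqs: "(1 + \<eta> / 2) * P = P + \<eta> / 2 * P" "(1 + \<eta>) * P = P + 2 * (\<eta> / 2 * P)"
          "(1 - \<eta>) * P = P - 2 * (\<eta> / 2 * P)" for P :: real by (auto simp: algebra_simps)
        have "\<eta>' * gY \<le> \<eta>' * gX" using \<eta>' gX0 by (intro mult_left_mono) auto
        hence d: "\<bar>slice p Y \<rho> s - (gX - gY)\<bar> \<le> 2 * \<eta>' * gX" using eX eY sl by linarith
        also have "\<dots> \<le> 2 * \<eta>' * (2 * ((1 + \<eta> / 2) * \<Phi>))"
        proof (intro mult_left_mono)
          have "\<rho> * ((1 + \<eta> / 2) * \<Phi>) \<le> 2 * ((1 + \<eta> / 2) * \<Phi>)" using \<rho> \<Phi> \<eta> by (intro mult_right_mono) auto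
          thus "gX \<le> 2 * ((1 + \<eta> / 2) * \<Phi>)" using i(4) by linarith
        qed (use \<eta>' in auto)
        also have "\<dots> = (2 * \<eta>' * (2 * (1 + \<eta> / 2))) * \<Phi>" by simp
        also have "\<dots> \<le> (\<eta> / 2 * (\<rho> - 1)) * \<Phi>" using \<eta>'2 \<Phi> by (intro mult_right_mono) auto
        finally have "\<bar>slice p Y \<rho> s - (gX - gY)\<bar> \<le> \<eta> / 2 * ((\<rho> - 1) * \<Phi>)" by simp
        moreover have "0 \<le> \<eta> / 2 * ((\<rho> - 1) * \<Phi>)" using \<eta> \<rho> \<Phi> by auto
        ultimately have "(1 - \<eta>) * ((\<rho> - 1) * \<Phi>) \<le> slice p Y \<rho> s \<and> slice p Y \<rho> s \<le> (1 + \<eta>) * ((\<rho> - 1) * \<Phi>)"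
          using i(1,2) unfolding eqs by linarith
        thus "(1 - \<eta>) * ((\<rho> - 1) * Y * model_density Y s) \<le> slice p Y \<rho> s \<and>
            slice p Y \<rho> s \<le> (1 + \<eta>) * ((\<rho> - 1) * Y * model_density Y s)"
          by (simp add: \<Phi>_def mult.assoc)
      qed
    qed
  qed
qed

text \<open>The quantity that decides where the admissible slices begin: in both problems
  the length \<open>t Y\<^sup>p\<close> lies between \<open>Y\<^sup>\<epsilon>\<close> and \<open>Y powr (1 - \<epsilon>)\<close> if and only if \<open>scale p t\<close> does.\<close>

definition scale :: "nat \<Rightarrow> real \<Rightarrow> real" where
  "scale p t = (if p = 0 then t else 1 / t)"

text \<open>The range up to \<open>2 * scale p t powr (1 + a)\<close> contains all \<open>x\<close> whose slices are not
  admissible; the factor \<open>2\<close> leaves room for the left end of the last admissible slice.\<close>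

definition tail_negligible :: "nat \<Rightarrow> bool" where
  "tail_negligible p \<longleftrightarrow> (\<forall>\<epsilon>>0. \<exists>a>0. a \<le> 1 \<and> a \<le> \<epsilon> \<and>
     (\<forall>\<eta>>0. \<forall>\<^sub>F X in at_top. \<forall>t. t * X ^ p \<in> {X powr \<epsilon>..X powr (1 - \<epsilon>)} \<longrightarrow>
       moment p t 1 (2 * scale p t powr (1 + a)) \<le> \<eta> * model p X t))"

lemma scale_range:
  assumes "0 < Y" "p \<le> 1"
  shows "t * Y ^ p \<in> {Y powr \<epsilon>..Y powr (1 - \<epsilon>)} \<longleftrightarrow> scale p t \<in> {Y powr \<epsilon>..Y powr (1 - \<epsilon>)}"
proof (cases "p = 0")
  case False
  hence p: "p = 1" using assms by simp
  have pos: "0 < Y powr \<epsilon>" "0 < Y powr (1 - \<epsilon>)" using assms by auto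
  have eq: "Y powr (1 - \<epsilon>) = Y / Y powr \<epsilon>" using assms by (simp add: powr_diff)
  show ?thesis
  proof (cases "0 < t")
    case True
    have "Y powr \<epsilon> \<le> t * Y \<longleftrightarrow> 1 / t \<le> Y powr (1 - \<epsilon>)" "t * Y \<le> Y powr (1 - \<epsilon>) \<longleftrightarrow> Y powr \<epsilon> \<le> 1 / t"
      unfolding eq using True pos assms by (auto simp: field_simps)
    thus ?thesis using p by (auto simp: scale_def)
  next
    case False
    hence "t * Y \<le> 0" "1 / t \<le> 0" using assms by (auto simp: mult_nonpos_nonneg divide_nonneg_nonpos)
    hence "\<not> Y powr \<epsilon> \<le> t * Y" "\<not> Y powr \<epsilon> \<le> 1 / t" using pos by linarith+
    thus ?thesis using p by (simp add: scale_def)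
  qed
qed (simp add: scale_def)

text \<open>Errors relative to increments of the main term add up to an error relative to the main term, however many slices there are.\<close>

lemma telescoping_slices:
  assumes "1 \<le> Y" "1 < \<rho>" "0 < t" "0 \<le> \<eta>"
    and "\<And>i. i < n \<Longrightarrow> \<bar>slice p (Y * \<rho> ^ i) \<rho> (t * (Y * \<rho> ^ i) ^ p) -
            (model p (Y * \<rho> ^ Suc i) t - model p (Y * \<rho> ^ i) t)\<bar> \<le> \<eta> * (model p (Y * \<rho> ^ Suc i) t - model p (Y * \<rho> ^ i) t)"
  shows "\<bar>moment p t 1 (Y * \<rho> ^ n) - moment p t 1 Y - (model p (Y * \<rho> ^ n) t - model p Y t)\<bar>
           \<le> \<eta> * (model p (Y * \<rho> ^ n) t - model p Y t)"
  using assms(5)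
proof (induction n)
  case (Suc n)
  define Z where "Z = Y * \<rho> ^ n"
  have "1 * 1 \<le> Y * \<rho> ^ n" using assms by (intro mult_mono) (auto intro: one_le_power)
  hence Z: "1 \<le> Z" by (simp add: Z_def)
  have sl: "slice p Z \<rho> (t * Z ^ p) = moment p t Z (\<rho> * Z)"
    using Z by (simp add: slice_def)
  have "moment p t 1 Z + moment p t Z (\<rho> * Z) = moment p t 1 (\<rho> * Z)"
    using Z assms by (intro moment_combine) auto
  moreover have "\<rho> * Z = Y * \<rho> ^ Suc n" by (simp add: Z_def)
  ultimately have m: "moment p t 1 (Y * \<rho> ^ Suc n) = moment p t 1 (Y * \<rho> ^ n) + slice p (Y * \<rho> ^ n) \<rho> (t * (Y * \<rho> ^ n) ^ p)"
    using sl unfolding Z_def by metis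
  have IH: "\<bar>moment p t 1 (Y * \<rho> ^ n) - moment p t 1 Y - (model p (Y * \<rho> ^ n) t - model p Y t)\<bar>
           \<le> \<eta> * (model p (Y * \<rho> ^ n) t - model p Y t)"
    using Suc.prems by (intro Suc.IH) auto
  have "\<bar>slice p (Y * \<rho> ^ n) \<rho> (t * (Y * \<rho> ^ n) ^ p) - (model p (Y * \<rho> ^ Suc n) t - model p (Y * \<rho> ^ n) t)\<bar>
      \<le> \<eta> * (model p (Y * \<rho> ^ Suc n) t - model p (Y * \<rho> ^ n) t)"
    using Suc.prems by simp
  thus ?case using IH unfolding m right_diff_distrib by linarith
qed simp

text \<open>The slices \<open>[Y \<rho>\<^sup>i, Y \<rho>\<^sup>i\<^sup>+\<^sup>1]\<close> start at \<open>Y\<close> between \<open>Z\<close> and \<open>2 Z\<close>, where \<open>Z = scale p t powr (1 + a)\<close>, and end exactly at \<open>X\<close>.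
  Since \<open>Z\<close> is smaller than \<open>X\<close> by a power of \<open>X\<close>, the main term at \<open>Y\<close> is negligible.\<close>

lemma slice_asymp_imp_moment_asymp:
  assumes S: "slice_asymp p" and p: "p \<le> 1" and tail: "tail_negligible p"
  shows "moment_asymp p"
  unfolding moment_asymp_def
proof (intro allI impI)
  fix \<epsilon> \<eta> :: real
  assume \<epsilon>: "\<epsilon> > 0" and \<eta>: "\<eta> > 0"
  obtain a where a: "0 < a" "a \<le> 1" "a \<le> \<epsilon>"
    and tail': "\<And>\<eta>. \<eta> > 0 \<Longrightarrow> \<forall>\<^sub>F X in at_top. \<forall>t. t * X ^ p \<in> {X powr \<epsilon>..X powr (1 - \<epsilon>)} \<longrightarrow>
       moment p t 1 (2 * scale p t powr (1 + a)) \<le> \<eta> * model p X t"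
    using tail[unfolded tail_negligible_def, rule_format, OF \<epsilon>] by blast
  define \<eta>' where "\<eta>' = min 1 (\<eta> / 8)"
  have \<eta>': "0 < \<eta>'" "\<eta>' \<le> 1" "\<eta>' \<le> \<eta> / 8" using \<eta> by (auto simp: \<eta>'_def)
  \<comment> \<open>Then \<open>(1 + a) (1 - e) \<ge> 1\<close>, so \<open>Y \<ge> u powr (1 + a)\<close> implies \<open>u \<le> Y powr (1 - e)\<close>.\<close>
  define e where "e = min (a / 2) \<epsilon>"
  have e: "0 < e" "e \<le> a / 2" "e \<le> \<epsilon>" using a \<epsilon> by (auto simp: e_def)
  have "\<forall>\<^sub>F \<rho> in at_right (1::real). 1 < \<rho>" by (simp add: eventually_at_right_less)
  moreover have "\<forall>\<^sub>F \<rho> in at_right (1::real). \<rho> < 2"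
    by (rule order_tendstoD(2)[of _ 1]) auto
  moreover have "\<forall>\<^sub>F \<rho> in at_right 1. (\<rho> * (1 + ln \<rho>)) ^ m \<le> 1 + \<eta>'"
    using \<eta>' by (intro eventually_small_ratio)
  moreover have "\<forall>\<^sub>F \<rho> in at_right 1. \<forall>\<^sub>F Y in at_top. \<forall>s\<in>{Y powr e..Y powr (1 - e)}.
     (1 - \<eta>') * ((\<rho> - 1) * Y * model_density Y s) \<le> slice p Y \<rho> s \<and>
     slice p Y \<rho> s \<le> (1 + \<eta>') * ((\<rho> - 1) * Y * model_density Y s)"
    using S[unfolded slice_asymp_def, rule_format, OF e(1) \<eta>'(1)] .
  ultimately have "\<forall>\<^sub>F \<rho> in at_right 1. 1 < \<rho> \<and> \<rho> < 2 \<and> (\<rho> * (1 + ln \<rho>)) ^ m \<le> 1 + \<eta>' \<and>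
    (\<forall>\<^sub>F Y in at_top. \<forall>s\<in>{Y powr e..Y powr (1 - e)}.
     (1 - \<eta>') * ((\<rho> - 1) * Y * model_density Y s) \<le> slice p Y \<rho> s \<and>
     slice p Y \<rho> s \<le> (1 + \<eta>') * ((\<rho> - 1) * Y * model_density Y s))"
    by eventually_elim auto
  then obtain \<rho> :: real where \<rho>: "1 < \<rho>" "\<rho> < 2" "(\<rho> * (1 + ln \<rho>)) ^ m \<le> 1 + \<eta>'"
    and ev: "\<forall>\<^sub>F Y in at_top. \<forall>s\<in>{Y powr e..Y powr (1 - e)}.
     (1 - \<eta>') * ((\<rho> - 1) * Y * model_density Y s) \<le> slice p Y \<rho> s \<and>
     slice p Y \<rho> s \<le> (1 + \<eta>') * ((\<rho> - 1) * Y * model_density Y s)"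
    using eventually_happens[of _ "at_right (1::real)"] trivial_limit_at_right_real by blast
  have "\<forall>\<^sub>F Y in at_top. 1 \<le> ln (Y / (E * Y powr (1 - e)))" using e E_pos by real_asymp
  moreover have "\<forall>\<^sub>F Y in at_top. E * (\<rho> * Y powr (1 - e)) \<le> Y" using e \<rho> E_pos by real_asymp
  ultimately have "\<forall>\<^sub>F Y in at_top. (\<forall>s\<in>{Y powr e..Y powr (1 - e)}.
     (1 - \<eta>') * ((\<rho> - 1) * Y * model_density Y s) \<le> slice p Y \<rho> s \<and>
     slice p Y \<rho> s \<le> (1 + \<eta>') * ((\<rho> - 1) * Y * model_density Y s)) \<and>
     1 \<le> ln (Y / (E * Y powr (1 - e))) \<and> E * (\<rho> * Y powr (1 - e)) \<le> Y"
    using ev by eventually_elim auto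
  then obtain Y0 where Y0: "\<And>Y s. Y0 \<le> Y \<Longrightarrow> s \<in> {Y powr e..Y powr (1 - e)} \<Longrightarrow>
     (1 - \<eta>') * ((\<rho> - 1) * Y * model_density Y s) \<le> slice p Y \<rho> s \<and>
     slice p Y \<rho> s \<le> (1 + \<eta>') * ((\<rho> - 1) * Y * model_density Y s)"
     "\<And>Y. Y0 \<le> Y \<Longrightarrow> 1 \<le> ln (Y / (E * Y powr (1 - e)))" "\<And>Y. Y0 \<le> Y \<Longrightarrow> E * (\<rho> * Y powr (1 - e)) \<le> Y"
    unfolding eventually_at_top_linorder by meson
  have step: "\<bar>slice p Y \<rho> (t * Y ^ p) - (model p (\<rho> * Y) t - model p Y t)\<bar> \<le> 2 * \<eta>' * (model p (\<rho> * Y) t - model p Y t) \<and>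
       E * (t * Y ^ p) < Y"
    if Y: "1 \<le> Y" "Y0 \<le> Y" and t: "0 < t" and range: "t * Y ^ p \<in> {Y powr e..Y powr (1 - e)}" for Y t
  proof -
    define s where "s = t * Y ^ p"
    have s: "0 < s" "s \<in> {Y powr e..Y powr (1 - e)}" using range t Y by (auto simp: s_def)
    have L: "1 \<le> ln (Y / (E * s))"
    proof -
      have "ln (Y / (E * Y powr (1 - e))) \<le> ln (Y / (E * s))"
        using s Y E_pos by (subst ln_le_cancel_iff) (auto intro!: divide_left_mono mult_pos_pos)
      thus ?thesis using Y0(2)[OF Y(2)] by linarith
    qed
    have "E * (\<rho> * s) \<le> E * (\<rho> * Y powr (1 - e))" using s \<rho> E_pos by (intro mult_left_mono) auto
    hence Es: "E * (\<rho> * s) \<le> Y" using Y0(3)[OF Y(2)] by linarith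
    have Es': "E * s < E * (\<rho> * s)" using E_pos s \<rho> by simp
    have st: "s / Y ^ p = t" using Y by (simp add: s_def)
    have "0 < Y" using Y by simp
    note inc = slice_model_increment[OF this \<rho>(1) s(1) p L Es \<rho>(3), unfolded st]
    define \<Phi> where "\<Phi> = (\<rho> - 1) * Y * model_density Y s"
    have "0 \<le> \<Phi>" unfolding \<Phi>_def using Y s Es Es' \<rho> by (intro mult_nonneg_nonneg model_density_nonneg) auto
    have eqs: "(1 - \<eta>') * \<Phi> = \<Phi> - \<eta>' * \<Phi>" "(1 + \<eta>') * \<Phi> = \<Phi> + \<eta>' * \<Phi>"
      by (auto simp: algebra_simps)
    have sl: "\<Phi> - \<eta>' * \<Phi> \<le> slice p Y \<rho> s" "slice p Y \<rho> s \<le> \<Phi> + \<eta>' * \<Phi>"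
      using Y0(1)[OF Y(2) s(2)] unfolding \<Phi>_def[symmetric] eqs by auto
    have i: "\<Phi> \<le> model p (\<rho> * Y) t - model p Y t" "model p (\<rho> * Y) t - model p Y t \<le> \<Phi> + \<eta>' * \<Phi>"
      using inc(1,2) unfolding \<Phi>_def[symmetric] eqs by auto
    have "\<eta>' * \<Phi> \<le> \<eta>' * (model p (\<rho> * Y) t - model p Y t)" using i \<eta>' by (intro mult_left_mono) auto
    hence "\<bar>slice p Y \<rho> s - (model p (\<rho> * Y) t - model p Y t)\<bar> \<le> 2 * (\<eta>' * (model p (\<rho> * Y) t - model p Y t))"
      using sl i by linarith
    thus ?thesis using Es Es' by (simp add: s_def)
  qed
  have "\<forall>\<^sub>F X in at_top. \<forall>t. t * X ^ p \<in> {X powr \<epsilon>..X powr (1 - \<epsilon>)} \<longrightarrow>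
       moment p t 1 (2 * scale p t powr (1 + a)) \<le> \<eta>' * model p X t"
    using tail' \<eta>' by blast
  moreover have "\<forall>\<^sub>F X in at_top. (1::real) < X" by (rule eventually_gt_at_top)
  moreover have "\<forall>\<^sub>F X in at_top. Y0 \<le> X powr \<epsilon>" using \<epsilon> by real_asymp
  moreover have "\<forall>\<^sub>F X in at_top. (1 + 1 / \<eta>') * (2 * X powr (1 - \<epsilon>\<^sup>2)) \<le> X" using \<epsilon> \<eta>' by real_asymp
  ultimately show "\<forall>\<^sub>F X in at_top. \<forall>t. t * X ^ p \<in> {X powr \<epsilon>..X powr (1 - \<epsilon>)} \<longrightarrow>
     \<bar>moment p t 1 X / model p X t - 1\<bar> < \<eta>"
  proof eventually_elim
    case (elim X)
    show ?case
    proof (intro allI impI)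
      fix t assume range: "t * X ^ p \<in> {X powr \<epsilon>..X powr (1 - \<epsilon>)}"
      have X: "1 < X" "0 < X" using elim by auto
      define u where "u = scale p t"
      have u: "X powr \<epsilon> \<le> u" "u \<le> X powr (1 - \<epsilon>)"
        using range scale_range[OF X(2) p] by (auto simp: u_def)
      have "1 < X powr \<epsilon>" using X \<epsilon> by (simp add: gr_one_powr)
      hence u1: "1 < u" using u by simp
      have t: "0 < t"
      proof (rule ccontr)
        assume "\<not> 0 < t"
        hence "t \<le> 0" "1 / t \<le> 0" by (auto simp: divide_nonneg_nonpos)
        moreover have "u = t \<or> u = 1 / t" by (simp add: u_def scale_def)
        ultimately show False using u1 by linarith
      qed
      have "1 < X powr (1 - \<epsilon>)" using u u1 by linarith
      have \<epsilon>1: "\<epsilon> < 1"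
      proof (rule ccontr)
        assume "\<not> \<epsilon> < 1"
        hence "X powr (1 - \<epsilon>) \<le> X powr 0" using X by (intro powr_mono) auto
        thus False using \<open>1 < X powr (1 - \<epsilon>)\<close> X by simp
      qed
      define Z where "Z = u powr (1 + a)"
      have Zu: "u \<le> Z" unfolding Z_def using u1 a powr_mono[of 1 "1 + a" u] by simp
      have Z1: "1 < Z" using Zu u1 by simp
      have ZX: "Z \<le> X powr (1 - \<epsilon>\<^sup>2)"
      proof -
        have "Z \<le> (X powr (1 - \<epsilon>)) powr (1 + a)" unfolding Z_def using u u1 a by (intro powr_mono2) auto
        also have "\<dots> = X powr ((1 - \<epsilon>) * (1 + a))" by (simp add: powr_powr)
        also have "\<dots> \<le> X powr (1 - \<epsilon>\<^sup>2)"
        proof (intro powr_mono)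
          have "(1 - \<epsilon>) * (1 + a) \<le> (1 - \<epsilon>) * (1 + \<epsilon>)" using a \<epsilon>1 by (intro mult_left_mono) auto
          thus "(1 - \<epsilon>) * (1 + a) \<le> 1 - \<epsilon>\<^sup>2" by (simp add: algebra_simps power2_eq_square)
        qed (use X in auto)
        finally show ?thesis .
      qed
      have X2Z: "(1 + 1 / \<eta>') * (2 * Z) \<le> X"
      proof -
        have "(1 + 1 / \<eta>') * (2 * Z) \<le> (1 + 1 / \<eta>') * (2 * X powr (1 - \<epsilon>\<^sup>2))"
          using ZX \<eta>' by (intro mult_left_mono) auto
        thus ?thesis using elim(4) by linarith
      qed
      have "0 \<le> 1 / \<eta>' * (2 * Z)" using \<eta>' Z1 by simp
      hence ZltX: "2 * Z \<le> X" using X2Z by (simp add: algebra_simps)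
      \<comment> \<open>Below \<open>Z\<close> the tail bound takes over; above it every slice is in the admissible range.\<close>
      define n where "n = nat \<lfloor>log \<rho> (X / Z)\<rfloor>"
      define Y where "Y = X / \<rho> ^ n"
      have \<rho>n: "0 < \<rho> ^ n" using \<rho> by simp
      have lg: "0 \<le> log \<rho> (X / Z)" using \<rho> ZltX Z1 by (subst zero_le_log_cancel_iff) (auto simp: field_simps)
      have "real n \<le> log \<rho> (X / Z)" "log \<rho> (X / Z) < real n + 1" using lg unfolding n_def by linarith+
      hence "\<rho> powr real n \<le> X / Z" "X / Z < \<rho> powr (real n + 1)"
        using \<rho> X Z1 by (auto simp: le_log_iff log_less_iff)
      hence "\<rho> ^ n \<le> X / Z" "X / Z < \<rho> ^ n * \<rho>" using \<rho> by (auto simp: powr_realpow powr_add)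
      hence YZ: "Z \<le> Y" "Y < \<rho> * Z" using \<rho>n Z1 by (auto simp: Y_def field_simps)
      have "\<rho> * Z \<le> 2 * Z" using \<rho> Z1 by (intro mult_right_mono) auto
      hence Y2Z: "Y \<le> 2 * Z" using YZ by simp
      have XY: "X = Y * \<rho> ^ n" using \<rho> by (simp add: Y_def)
      have good: "1 \<le> W \<and> Y0 \<le> W \<and> t * W ^ p \<in> {W powr e..W powr (1 - e)}" if W: "Z \<le> W" "W \<le> X" for W
      proof -
        have W1: "1 \<le> W" using W Z1 by simp
        have "W powr e \<le> X powr e" using W1 W e by (intro powr_mono2) auto
        also have "\<dots> \<le> X powr \<epsilon>" using X e by (intro powr_mono) auto
        finally have r1: "W powr e \<le> u" using u by simp
        have "u = u powr 1" using u1 by simp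
        also have "\<dots> \<le> u powr ((1 + a) * (1 - e))"
        proof (intro powr_mono)
          have "(1 + a) * (1 - a / 2) \<le> (1 + a) * (1 - e)" using e a by (intro mult_left_mono) auto
          moreover have "(1 + a) * (1 - a / 2) = 1 + a / 2 * (1 - a)" by (simp add: field_simps)
          moreover have "0 \<le> a / 2 * (1 - a)" using a by auto
          ultimately show "1 \<le> (1 + a) * (1 - e)" by linarith
        qed (use u1 in auto)
        also have "\<dots> = Z powr (1 - e)" by (simp add: Z_def powr_powr)
        also have "\<dots> \<le> W powr (1 - e)" using W Z1 e a by (intro powr_mono2) auto
        finally have r2: "u \<le> W powr (1 - e)" .
        have "Y0 \<le> W" using elim(3) u Zu W by linarith
        moreover have "t * W ^ p \<in> {W powr e..W powr (1 - e)}"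
          using scale_range[of W p t e] W1 p r1 r2 by (simp add: u_def)
        ultimately show ?thesis using W1 by simp
      qed
      have Y: "1 \<le> Y" "Y \<le> X" "0 < Y" using YZ Z1 Y2Z ZltX by auto
      have "\<bar>moment p t 1 (Y * \<rho> ^ n) - moment p t 1 Y - (model p (Y * \<rho> ^ n) t - model p Y t)\<bar>
           \<le> 2 * \<eta>' * (model p (Y * \<rho> ^ n) t - model p Y t)"
      proof (rule telescoping_slices)
        fix i assume i: "i < n"
        define W where "W = Y * \<rho> ^ i"
        have "\<rho> ^ i \<le> \<rho> ^ n" "1 \<le> \<rho> ^ i" using i \<rho> by (auto intro: power_increasing one_le_power)
        hence "Y * 1 \<le> W" "W \<le> X" using Y unfolding XY W_def by (auto intro: mult_left_mono)
        hence "1 \<le> W \<and> Y0 \<le> W \<and> t * W ^ p \<in> {W powr e..W powr (1 - e)}" using YZ by (intro good) auto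
        hence st: "\<bar>slice p W \<rho> (t * W ^ p) - (model p (\<rho> * W) t - model p W t)\<bar> \<le> 2 * \<eta>' * (model p (\<rho> * W) t - model p W t)"
          using step t by blast
        have eqW: "\<rho> * W = Y * \<rho> ^ Suc i" by (simp add: W_def)
        show "\<bar>slice p (Y * \<rho> ^ i) \<rho> (t * (Y * \<rho> ^ i) ^ p) -
            (model p (Y * \<rho> ^ Suc i) t - model p (Y * \<rho> ^ i) t)\<bar> \<le> 2 * \<eta>' * (model p (Y * \<rho> ^ Suc i) t - model p (Y * \<rho> ^ i) t)"
          using st unfolding eqW W_def[symmetric] .
      qed (use Y \<rho> t \<eta>' in auto)
      hence main: "\<bar>moment p t 1 X - moment p t 1 Y - (model p X t - model p Y t)\<bar> \<le> 2 * \<eta>' * (model p X t - model p Y t)"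
        unfolding XY[symmetric] .
      have EY: "E * (t * Y ^ p) < Y" using step good[of Y] YZ Y t by blast
      have gY: "0 \<le> model p Y t" using EY Y t p by (intro model_bounds) auto
      have mY: "moment p t 1 Y \<le> \<eta>' * model p X t"
      proof -
        have "moment p t 1 Y \<le> moment p t 1 (2 * Z)" using Y Y2Z t by (intro moment_mono) auto
        also have "\<dots> \<le> \<eta>' * model p X t" using elim(1) range by (simp add: Z_def u_def)
        finally show ?thesis .
      qed
      have mY0: "0 \<le> moment p t 1 Y" using t by (intro moment_nonneg) auto
      have "Y < X"
      proof -
        have "0 < 1 / \<eta>' * (2 * Z)" using \<eta>' Z1 by simp
        hence "2 * Z < X" using X2Z by (simp add: algebra_simps)
        thus ?thesis using Y2Z by simp
      qed
      hence gXpos: "0 < model p X t"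
      proof -
        have "0 < ln (Y / (E * (t * Y ^ p)))" using EY E_pos t Y by (intro ln_gt_zero) (simp add: field_simps)
        hence "0 < model_density Y (t * Y ^ p)" using \<mu>_pos t Y by (simp add: model_density_def)
        hence "0 < (X - Y) * model_density Y (t * Y ^ p)" using \<open>Y < X\<close> by simp
        also have "\<dots> \<le> model p X t - model p Y t" using Y t p EY by (intro model_increment) auto
        finally show ?thesis using gY by simp
      qed
      have "model p Y t \<le> \<eta>' * model p X t"
      proof -
        have "(1 + 1 / \<eta>') * Y \<le> (1 + 1 / \<eta>') * (2 * Z)" using Y2Z \<eta>' by (intro mult_left_mono) auto
        hence "(1 + 1 / \<eta>') * Y \<le> X" using X2Z by linarith
        hence "1 / \<eta>' * Y \<le> X - Y" by (simp add: algebra_simps)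
        hence "1 / \<eta>' * Y * model p Y t \<le> (X - Y) * model p Y t" using gY by (intro mult_right_mono) auto
        also have "\<dots> \<le> Y * model p X t" using Y t p EY by (intro model_ratio) auto
        finally have "Y * (model p Y t / \<eta>') \<le> Y * model p X t" by (simp add: mult_ac)
        hence "model p Y t / \<eta>' \<le> model p X t" using Y(3) by (simp only: mult_le_cancel_left_pos)
        thus ?thesis using \<eta>' by (simp add: field_simps)
      qed
      moreover have "0 \<le> \<eta>' * model p Y t" using gY \<eta>' by simp
      ultimately have "\<bar>moment p t 1 X - model p X t\<bar> \<le> 4 * (\<eta>' * model p X t)"
        using main mY mY0 gY by (simp add: algebra_simps)
      also have "\<dots> < \<eta> * model p X t"
      proof -
        have "4 * \<eta>' < \<eta>" using \<eta>' \<eta> by linarith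
        hence "4 * \<eta>' * model p X t < \<eta> * model p X t" using gXpos by (intro mult_strict_right_mono) auto
        thus ?thesis by simp
      qed
      finally have "\<bar>moment p t 1 X - model p X t\<bar> < \<eta> * model p X t" .
      moreover have "moment p t 1 X / model p X t - 1 = (moment p t 1 X - model p X t) / model p X t"
        using gXpos by (simp add: field_simps)
      ultimately show "\<bar>moment p t 1 X / model p X t - 1\<bar> < \<eta>"
        using gXpos by (simp add: abs_divide divide_less_eq)
    qed
  qed
qed

section \<open>The tails\<close>

text \<open>The upper half of the range already gives this size, because the logarithm in the density exceeds \<open>1\<close> there.\<close>

lemma model_lower_bound:
  assumes p: "p \<le> 1" and \<epsilon>: "\<epsilon> > 0"
  shows "\<forall>\<^sub>F X in at_top. \<forall>t. t * X ^ p \<in> {X powr \<epsilon>..X powr (1 - \<epsilon>)} \<longrightarrow>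
     \<mu> / 2 ^ (m + 1) * X * (t * X ^ p) ^ m \<le> model p X t"
proof -
  have "\<forall>\<^sub>F X in at_top. (1::real) < X" by (rule eventually_gt_at_top)
  moreover have "\<forall>\<^sub>F X in at_top. E * X powr (1 - \<epsilon>) \<le> X / 2" using \<epsilon> E_pos by real_asymp
  moreover have "\<forall>\<^sub>F X in at_top. 1 \<le> ln (X / 2 / (E * X powr (1 - \<epsilon>)))" using \<epsilon> E_pos by real_asymp
  ultimately show ?thesis
  proof eventually_elim
    case (elim X)
    show ?case
    proof (intro allI impI)
      fix t assume range: "t * X ^ p \<in> {X powr \<epsilon>..X powr (1 - \<epsilon>)}"
      define s where "s = t * X ^ p"
      have X: "0 < X" using elim by simp
      have "0 < X powr \<epsilon>" using X by simp
      hence s: "0 < s" using range unfolding s_def by (metis atLeastAtMost_iff less_le_trans)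
      hence t: "0 < t" using X by (simp add: s_def zero_less_mult_iff)
      define Y where "Y = X / 2"
      have Y: "0 < Y" "Y \<le> X" using X by (auto simp: Y_def)
      have eq: "t * Y ^ p = s / 2 ^ p" by (simp add: Y_def s_def power_divide)
      have "(1::real) \<le> 2 ^ p" "(2::real) ^ p \<le> 2" using power_le_one_bounds[of 2 p] p by auto
      hence s': "s / 2 \<le> t * Y ^ p" "t * Y ^ p \<le> s" "0 < t * Y ^ p"
        unfolding eq using s by (auto simp: field_simps intro: divide_left_mono)
      have "E * (t * Y ^ p) \<le> E * X powr (1 - \<epsilon>)"
        using s' range E_pos by (intro mult_left_mono) (auto simp: s_def)
      hence EY: "E * (t * Y ^ p) \<le> Y" using elim(2) by (simp add: Y_def)
      have "ln (X / 2 / (E * X powr (1 - \<epsilon>))) \<le> ln (Y / (E * (t * Y ^ p)))"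
        using s' range X E_pos unfolding Y_def[symmetric] s_def[symmetric]
        by (subst ln_le_cancel_iff) (auto intro!: divide_left_mono mult_left_mono mult_pos_pos simp: Y_def)
      hence L: "1 \<le> ln (Y / (E * (t * Y ^ p)))" using elim(3) by linarith
      have "s / 2 * 1 \<le> (t * Y ^ p) * ln (Y / (E * (t * Y ^ p)))"
        using s' L s by (intro mult_mono) auto
      hence "(s / 2) ^ m \<le> ((t * Y ^ p) * ln (Y / (E * (t * Y ^ p)))) ^ m" using s by (intro power_mono) auto
      hence "(X - Y) * (\<mu> * (s / 2) ^ m) \<le> (X - Y) * model_density Y (t * Y ^ p)"
        unfolding model_density_def using \<mu>_pos Y by (intro mult_left_mono) auto
      also have "\<dots> \<le> model p X t - model p Y t" using Y t p EY by (intro model_increment) auto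
      also have "\<dots> \<le> model p X t" using model_bounds(1)[OF Y(1) t p EY] by simp
      also have "(X - Y) * (\<mu> * (s / 2) ^ m) = \<mu> / 2 ^ (m + 1) * X * s ^ m"
        by (simp add: Y_def power_divide)
      finally show "\<mu> / 2 ^ (m + 1) * X * (t * X ^ p) ^ m \<le> model p X t" by (simp add: s_def)
    qed
  qed
qed

text \<open>Since \<open>scale p t \<le> X powr (1 - \<epsilon>)\<close>, the exponent \<open>1 + \<epsilon> / 2\<close> of the scale still gives a power of \<open>X\<close> below the
  first, whereas the main term is at least a constant times \<open>X (t X\<^sup>p)\<^sup>m\<close>.\<close>

lemma tail_negligibleI:
  assumes p: "p \<le> 1"
    and bound: "\<And>\<epsilon>. \<epsilon> > 0 \<Longrightarrow> \<exists>a>0. a \<le> 1 \<and> a \<le> \<epsilon> \<and>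
      (\<exists>C. \<forall>\<^sub>F X in at_top. \<forall>t. t * X ^ p \<in> {X powr \<epsilon>..X powr (1 - \<epsilon>)} \<longrightarrow>
       moment p t 1 (2 * scale p t powr (1 + a)) \<le> C * ((t * X ^ p) ^ m * scale p t powr (1 + \<epsilon> / 2)))"
  shows "tail_negligible p"
  unfolding tail_negligible_def
proof (intro allI impI)
  fix \<epsilon> :: real assume \<epsilon>: "\<epsilon> > 0"
  obtain a C where a: "0 < a" "a \<le> 1" "a \<le> \<epsilon>"
    and ev: "\<forall>\<^sub>F X in at_top. \<forall>t. t * X ^ p \<in> {X powr \<epsilon>..X powr (1 - \<epsilon>)} \<longrightarrow>
       moment p t 1 (2 * scale p t powr (1 + a)) \<le> C * ((t * X ^ p) ^ m * scale p t powr (1 + \<epsilon> / 2))"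
    using bound[OF \<epsilon>] by blast
  show "\<exists>a>0. a \<le> 1 \<and> a \<le> \<epsilon> \<and> (\<forall>\<eta>>0. \<forall>\<^sub>F X in at_top. \<forall>t. t * X ^ p \<in> {X powr \<epsilon>..X powr (1 - \<epsilon>)} \<longrightarrow>
     moment p t 1 (2 * scale p t powr (1 + a)) \<le> \<eta> * model p X t)"
  proof (intro exI[of _ a] conjI a allI impI)
    fix \<eta> :: real assume \<eta>: "\<eta> > 0"
    have "\<forall>\<^sub>F X in at_top. max C 0 * X powr (1 - \<epsilon> / 2) \<le> \<eta> * (\<mu> / 2 ^ (m + 1)) * X"
    proof -
      define k where "k = \<eta> * (\<mu> / 2 ^ (m + 1))"
      define C' where "C' = max C 0"
      have "0 < k" using \<eta> \<mu>_pos by (simp add: k_def)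
      thus ?thesis unfolding k_def[symmetric] C'_def[symmetric] using \<epsilon> by real_asymp
    qed
    moreover have "\<forall>\<^sub>F X in at_top. (1::real) < X" by (rule eventually_gt_at_top)
    moreover note ev model_lower_bound[OF p \<epsilon>]
    ultimately show "\<forall>\<^sub>F X in at_top. \<forall>t. t * X ^ p \<in> {X powr \<epsilon>..X powr (1 - \<epsilon>)} \<longrightarrow>
       moment p t 1 (2 * scale p t powr (1 + a)) \<le> \<eta> * model p X t"
    proof eventually_elim
      case (elim X)
      show ?case
      proof (intro allI impI)
        fix t assume range: "t * X ^ p \<in> {X powr \<epsilon>..X powr (1 - \<epsilon>)}"
        have X: "0 < X" using elim by simp
        define s where "s = t * X ^ p"
        define u where "u = scale p t"
        have "0 < X powr \<epsilon>" using X by simp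
        hence s: "0 < s" using range unfolding s_def by (metis atLeastAtMost_iff less_le_trans)
        have u: "X powr \<epsilon> \<le> u" "u \<le> X powr (1 - \<epsilon>)"
          using range scale_range[OF X p] by (auto simp: u_def)
        have u0: "0 < u" using u(1) \<open>0 < X powr \<epsilon>\<close> by linarith
        have "u powr (1 + \<epsilon> / 2) \<le> (X powr (1 - \<epsilon>)) powr (1 + \<epsilon> / 2)"
          using u u0 \<epsilon> by (intro powr_mono2) auto
        also have "\<dots> = X powr ((1 - \<epsilon>) * (1 + \<epsilon> / 2))" by (simp add: powr_powr)
        also have "\<dots> \<le> X powr (1 - \<epsilon> / 2)"
          using elim(2) \<epsilon> by (intro powr_mono) (auto simp: algebra_simps)
        finally have up: "u powr (1 + \<epsilon> / 2) \<le> X powr (1 - \<epsilon> / 2)" .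
        have "moment p t 1 (2 * u powr (1 + a)) \<le> C * (s ^ m * u powr (1 + \<epsilon> / 2))"
          using elim(3) range by (simp add: s_def u_def)
        also have "\<dots> \<le> max C 0 * (s ^ m * X powr (1 - \<epsilon> / 2))"
          using up s by (intro mult_mono) auto
        also have "\<dots> = s ^ m * (max C 0 * X powr (1 - \<epsilon> / 2))" by simp
        also have "\<dots> \<le> s ^ m * (\<eta> * (\<mu> / 2 ^ (m + 1)) * X)"
          using elim(1) s by (intro mult_left_mono) auto
        also have "\<dots> = \<eta> * (\<mu> / 2 ^ (m + 1) * X * s ^ m)" by simp
        also have "\<dots> \<le> \<eta> * model p X t"
          using elim(4) range \<eta> by (intro mult_left_mono) (auto simp: s_def)
        finally show "moment p t 1 (2 * scale p t powr (1 + a)) \<le> \<eta> * model p X t" by (simp add: u_def)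
      qed
    qed
  qed
qed

lemma moment_le:
  assumes "1 \<le> b" "0 \<le> t"
  shows "moment p t 1 b \<le> b * ((1 + t * b ^ p) * (1 + ln (b + t * b ^ p))) ^ (2 * m)"
proof -
  let ?B = "((1 + t * b ^ p) * (1 + ln (b + t * b ^ p))) ^ (2 * m)"
  have "moment p t 1 b \<le> integral {1..b} (\<lambda>x. ?B)"
    unfolding moment_def using assms by (intro integral_le incr_integrable incr_bounded) auto
  also have "\<dots> = (b - 1) * ?B" using assms by simp
  also have "\<dots> \<le> b * ?B" by (intro mult_right_mono) auto
  finally show ?thesis .
qed

text \<open>With \<open>u = 1 / t\<close>, the interval at \<open>x \<le> 2 u powr (1 + a)\<close> has length at most \<open>2 u\<^sup>a\<close>, so each increment is
  at most \<open>u powr (2 a)\<close> for large \<open>u\<close>, and the moment is at most \<open>u\<close> to a power slightly above \<open>1\<close>.\<close>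

lemma tail_negligible_1: "tail_negligible 1"
proof (rule tail_negligibleI)
  fix \<epsilon> :: real assume \<epsilon>: "\<epsilon> > 0"
  define a where "a = min 1 (\<epsilon> / (2 * (4 * real m + 2)))"
  have a: "0 < a" "a \<le> 1" "a \<le> \<epsilon> / (2 * (4 * real m + 2))" using \<epsilon> by (auto simp: a_def)
  have a2: "a * (4 * real m + 2) \<le> \<epsilon> / 2" using a(3) by (simp add: field_simps)
  have "\<epsilon> / (2 * (4 * real m + 2)) \<le> \<epsilon> / 1" using \<epsilon> by (intro divide_left_mono) auto
  hence a\<epsilon>: "a \<le> \<epsilon>" using a by simp
  have "\<forall>\<^sub>F u in at_top. (1 + 2 * u powr a) * (1 + ln (2 * u powr (1 + a) + 2 * u powr a)) \<le> u powr (2 * a)"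
    using a by real_asymp
  moreover have "\<forall>\<^sub>F u in at_top. 2 * u powr (1 + a) \<le> u powr (1 + 2 * a)" using a by real_asymp
  moreover have "\<forall>\<^sub>F u in at_top. (1::real) \<le> u" by (rule eventually_ge_at_top)
  ultimately have "\<forall>\<^sub>F u in at_top. (1 + 2 * u powr a) * (1 + ln (2 * u powr (1 + a) + 2 * u powr a)) \<le> u powr (2 * a) \<and>
      2 * u powr (1 + a) \<le> u powr (1 + 2 * a) \<and> 1 \<le> u"
    by eventually_elim auto
  then obtain U where U: "\<And>u. U \<le> u \<Longrightarrow> (1 + 2 * u powr a) * (1 + ln (2 * u powr (1 + a) + 2 * u powr a)) \<le> u powr (2 * a) \<and>
      2 * u powr (1 + a) \<le> u powr (1 + 2 * a) \<and> 1 \<le> u"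
    unfolding eventually_at_top_linorder by blast
  have "\<forall>\<^sub>F X in at_top. (1::real) < X" by (rule eventually_gt_at_top)
  moreover have "\<forall>\<^sub>F X in at_top. U \<le> X powr \<epsilon>" using \<epsilon> by real_asymp
  ultimately have "\<forall>\<^sub>F X in at_top. \<forall>t. t * X ^ 1 \<in> {X powr \<epsilon>..X powr (1 - \<epsilon>)} \<longrightarrow>
       moment 1 t 1 (2 * scale 1 t powr (1 + a)) \<le> 1 * ((t * X ^ 1) ^ m * scale 1 t powr (1 + \<epsilon> / 2))"
  proof eventually_elim
    case (elim X)
    show ?case
    proof (intro allI impI)
      fix t assume range: "t * X ^ 1 \<in> {X powr \<epsilon>..X powr (1 - \<epsilon>)}"
      have X: "0 < X" using elim by simp
      have s1: "1 \<le> t * X ^ 1" using range elim \<epsilon> ge_one_powr_ge_zero[of X \<epsilon>] by auto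
      have t: "0 < t" using s1 X by (metis less_le_trans less_numeral_extra(1) mult.commute power_one_right zero_less_mult_pos)
      define u where "u = scale 1 t"
      have ut: "u = 1 / t" by (simp add: u_def scale_def)
      have "X powr \<epsilon> \<le> u" using range scale_range[OF X, of 1 t \<epsilon>] by (auto simp: u_def)
      hence "U \<le> u" using elim by linarith
      note u = U[OF this]
      define b where "b = 2 * u powr (1 + a)"
      have "1 \<le> u powr (1 + a)" using u a by (intro ge_one_powr_ge_zero) auto
      hence b1: "1 \<le> b" by (simp add: b_def)
      have tb: "t * b = 2 * u powr a"
        using u t by (simp add: b_def powr_add ut)
      have "moment 1 t 1 b \<le> b * ((1 + t * b ^ 1) * (1 + ln (b + t * b ^ 1))) ^ (2 * m)"
        using b1 t by (intro moment_le) auto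
      also have "\<dots> = b * ((1 + 2 * u powr a) * (1 + ln (b + 2 * u powr a))) ^ (2 * m)"
        using tb by simp
      also have "\<dots> \<le> u powr (1 + 2 * a) * (u powr (2 * a)) ^ (2 * m)"
      proof (intro mult_mono power_mono)
        show "b \<le> u powr (1 + 2 * a)" using u by (simp add: b_def)
        show "(1 + 2 * u powr a) * (1 + ln (b + 2 * u powr a)) \<le> u powr (2 * a)" using u by (simp add: b_def)
        have "1 \<le> b + 2 * u powr a" using b1 by (simp add: add_increasing2)
        hence "0 \<le> ln (b + 2 * u powr a)" by (rule ln_ge_zero)
        thus "0 \<le> (1 + 2 * u powr a) * (1 + ln (b + 2 * u powr a))" by (intro mult_nonneg_nonneg) auto
      qed auto
      also have "(u powr (2 * a)) ^ (2 * m) = u powr (4 * a * real m)"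
        using u by (simp add: powr_power mult_ac)
      also have "u powr (1 + 2 * a) * u powr (4 * a * real m) = u powr (1 + a * (4 * real m + 2))"
        by (simp add: powr_add[symmetric] algebra_simps)
      also have "\<dots> \<le> u powr (1 + \<epsilon> / 2)" using u a2 by (intro powr_mono) auto
      also have "\<dots> = 1 * u powr (1 + \<epsilon> / 2)" by simp
      also have "\<dots> \<le> (t * X ^ 1) ^ m * u powr (1 + \<epsilon> / 2)"
        using s1 by (intro mult_right_mono one_le_power) auto
      finally show "moment 1 t 1 (2 * scale 1 t powr (1 + a)) \<le> 1 * ((t * X ^ 1) ^ m * scale 1 t powr (1 + \<epsilon> / 2))"
        by (simp add: b_def u_def)
    qed
  qed
  thus "\<exists>a>0. a \<le> 1 \<and> a \<le> \<epsilon> \<and>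
      (\<exists>C. \<forall>\<^sub>F X in at_top. \<forall>t. t * X ^ 1 \<in> {X powr \<epsilon>..X powr (1 - \<epsilon>)} \<longrightarrow>
       moment 1 t 1 (2 * scale 1 t powr (1 + a)) \<le> C * ((t * X ^ 1) ^ m * scale 1 t powr (1 + \<epsilon> / 2)))"
    using a a\<epsilon> by blast
qed simp

lemma R_power_integrable:
  assumes "1 \<le> a"
  shows "(\<lambda>x. R x ^ (2 * m)) integrable_on {a..b}"
proof (rule nn_integral_eq_integral_interval(1))
  fix x assume x: "x \<in> {a..b}"
  have "\<bar>R (1 + (x - 1)) - R 1\<bar> \<le> (1 + (x - 1)) * (1 + ln (1 + (x - 1)))"
    using x assms by (intro R_increment) auto
  also have "\<dots> \<le> b * (1 + ln b)" using x assms by (intro mult_mono) auto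
  finally have "\<bar>R x\<bar> \<le> \<bar>R 1\<bar> + b * (1 + ln b)" by simp
  hence "\<bar>R x\<bar> ^ (2 * m) \<le> (\<bar>R 1\<bar> + b * (1 + ln b)) ^ (2 * m)" by (intro power_mono) auto
  thus "R x ^ (2 * m) \<le> (\<bar>R 1\<bar> + b * (1 + ln b)) ^ (2 * m)" by (simp add: power_even_abs)
qed auto

definition remainder_moment :: "real \<Rightarrow> real" where
  "remainder_moment X = integral {1..X} (\<lambda>x. R x ^ (2 * m))"

lemma remainder_moment_split:
  "1 \<le> a \<Longrightarrow> a \<le> b \<Longrightarrow> remainder_moment a + integral {a..b} (\<lambda>x. R x ^ (2 * m)) = remainder_moment b"
  unfolding remainder_moment_def by (intro Henstock_Kurzweil_Integration.integral_combine R_power_integrable) auto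

lemma remainder_moment_nonneg: "0 \<le> remainder_moment a"
  unfolding remainder_moment_def by (intro integral_nonneg R_power_integrable) auto

lemma remainder_moment_mono: "1 \<le> a \<Longrightarrow> a \<le> b \<Longrightarrow> remainder_moment a \<le> remainder_moment b"
  using remainder_moment_split[of a b] integral_nonneg[OF R_power_integrable[of a b]] by force

text \<open>Here \<open>R (x + t)\<close> and \<open>R x\<close> are estimated separately. With \<open>Z = t powr (1 + a)\<close> the moment is \<open>O(Z powr (m + 1 + a))\<close>,
  which is \<open>t\<^sup>m\<close> times \<open>t\<close> to a power slightly above \<open>1\<close>.\<close>

lemma tail_negligible_0:
  assumes growth: "\<And>b. b > 0 \<Longrightarrow> \<exists>K. \<forall>X\<ge>1. remainder_moment X \<le> K * X powr (real m + 1 + b)"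
  shows "tail_negligible 0"
proof (rule tail_negligibleI)
  fix \<epsilon> :: real assume \<epsilon>: "\<epsilon> > 0"
  define a where "a = min 1 (\<epsilon> / (2 * (real m + 3)))"
  have a: "0 < a" "a \<le> 1" "a \<le> \<epsilon> / (2 * (real m + 3))" using \<epsilon> by (auto simp: a_def)
  have a2: "a * (real m + 3) \<le> \<epsilon> / 2" using a(3) by (simp add: field_simps)
  have "\<epsilon> / (2 * (real m + 3)) \<le> \<epsilon> / 1" using \<epsilon> by (intro divide_left_mono) auto
  hence a\<epsilon>: "a \<le> \<epsilon>" using a by simp
  obtain K where K: "\<And>X. 1 \<le> X \<Longrightarrow> remainder_moment X \<le> K * X powr (real m + 1 + a)"
    using growth[OF a(1)] by blast
  define C where "C = 2 ^ (2 * m) * (2 * (K * 3 powr (real m + 1 + a)))"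
  have "\<forall>\<^sub>F X in at_top. (1::real) < X" by (rule eventually_gt_at_top)
  hence "\<forall>\<^sub>F X in at_top. \<forall>t. t * X ^ 0 \<in> {X powr \<epsilon>..X powr (1 - \<epsilon>)} \<longrightarrow>
       moment 0 t 1 (2 * scale 0 t powr (1 + a)) \<le> C * ((t * X ^ 0) ^ m * scale 0 t powr (1 + \<epsilon> / 2))"
  proof eventually_elim
    case (elim X)
    show ?case
    proof (intro allI impI)
      fix t assume range: "t * X ^ 0 \<in> {X powr \<epsilon>..X powr (1 - \<epsilon>)}"
      have t1: "1 \<le> t" using range elim \<epsilon> ge_one_powr_ge_zero[of X \<epsilon>] by auto
      define Z where "Z = t powr (1 + a)"
      have tZ: "t \<le> Z" unfolding Z_def using t1 a powr_mono[of 1 "1 + a" t] by simp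
      have Z1: "1 \<le> Z" using tZ t1 by simp
      have K0: "0 \<le> K" using K[of 1] remainder_moment_nonneg[of 1] by simp
      have int: "(\<lambda>x. R (1 * x + t) ^ (2 * m)) integrable_on {1..2 * Z}"
        "1 * integral {1..2 * Z} (\<lambda>x. R (1 * x + t) ^ (2 * m)) = integral {1 * 1 + t..1 * (2 * Z) + t} (\<lambda>x. R x ^ (2 * m))"
        using t1 by (intro integral_affine_real[of "\<lambda>x. R x ^ (2 * m)"] R_power_integrable; simp)+
      have shift: "integral {1..2 * Z} (\<lambda>x. R (x + t) ^ (2 * m)) \<le> remainder_moment (3 * Z)"
      proof -
        have "integral {1..2 * Z} (\<lambda>x. R (x + t) ^ (2 * m)) = integral {1 + t..2 * Z + t} (\<lambda>x. R x ^ (2 * m))"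
          using int(2) by simp
        also have "\<dots> \<le> remainder_moment (2 * Z + t)"
          using remainder_moment_split[of "1 + t" "2 * Z + t"] remainder_moment_nonneg[of "1 + t"] t1 Z1 by simp
        also have "\<dots> \<le> remainder_moment (3 * Z)" using tZ Z1 t1 by (intro remainder_moment_mono) auto
        finally show ?thesis .
      qed
      have pt: "incr x (t * x ^ 0) \<le> 2 ^ (2 * m) * R (1 * x + t) ^ (2 * m) + 2 ^ (2 * m) * R x ^ (2 * m)" for x
      proof -
        have "incr x (t * x ^ 0) = (R (x + t) + - R x) ^ (2 * m)" by (simp add: incr_def)
        also have "\<dots> \<le> (1 + 1) ^ (2 * m) * R (x + t) ^ (2 * m) + (1 + 1 / 1) ^ (2 * m) * (- R x) ^ (2 * m)"
          by (rule even_power_add_le) simp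
        finally show ?thesis by simp
      qed
      have "moment 0 t 1 (2 * Z) \<le> integral {1..2 * Z} (\<lambda>x. 2 ^ (2 * m) * R (1 * x + t) ^ (2 * m) + 2 ^ (2 * m) * R x ^ (2 * m))"
        unfolding moment_def using t1
        by (intro integral_le incr_integrable pt integrable_add integrable_on_mult_right int R_power_integrable) auto
      also have "\<dots> = integral {1..2 * Z} (\<lambda>x. 2 ^ (2 * m) * R (1 * x + t) ^ (2 * m)) + integral {1..2 * Z} (\<lambda>x. 2 ^ (2 * m) * R x ^ (2 * m))"
        by (intro Henstock_Kurzweil_Integration.integral_add integrable_on_mult_right int R_power_integrable) auto
      also have "\<dots> = 2 ^ (2 * m) * (integral {1..2 * Z} (\<lambda>x. R (x + t) ^ (2 * m)) + remainder_moment (2 * Z))"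
        by (simp add: remainder_moment_def distrib_left)
      also have "\<dots> \<le> 2 ^ (2 * m) * (2 * remainder_moment (3 * Z))"
        using shift remainder_moment_mono[of "2 * Z" "3 * Z"] Z1 by (intro mult_left_mono) auto
      also have "\<dots> \<le> 2 ^ (2 * m) * (2 * (K * (3 * Z) powr (real m + 1 + a)))"
        using K[of "3 * Z"] Z1 by (intro mult_left_mono) auto
      also have "\<dots> = C * Z powr (real m + 1 + a)" using Z1 by (simp add: C_def powr_mult)
      also have "Z powr (real m + 1 + a) = t powr ((1 + a) * (real m + 1 + a))" by (simp add: Z_def powr_powr)
      also have "C * \<dots> \<le> C * t powr (real m + (1 + \<epsilon> / 2))"
      proof (intro mult_left_mono powr_mono)
        have "(1 + a) * (real m + 1 + a) = real m + 1 + a * (real m + 2 + a)" by (simp add: algebra_simps)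
        also have "\<dots> \<le> real m + 1 + a * (real m + 3)" using a by (intro add_left_mono mult_left_mono) auto
        finally show "(1 + a) * (real m + 1 + a) \<le> real m + (1 + \<epsilon> / 2)" using a2 by simp
        show "0 \<le> C" using K0 by (simp add: C_def)
      qed (use t1 in auto)
      also have "t powr (real m + (1 + \<epsilon> / 2)) = (t * X ^ 0) ^ m * t powr (1 + \<epsilon> / 2)"
        using t1 by (simp add: powr_add powr_realpow)
      finally show "moment 0 t 1 (2 * scale 0 t powr (1 + a)) \<le> C * ((t * X ^ 0) ^ m * scale 0 t powr (1 + \<epsilon> / 2))"
        by (simp add: Z_def scale_def)
    qed
  qed
  thus "\<exists>a>0. a \<le> 1 \<and> a \<le> \<epsilon> \<and>
      (\<exists>C. \<forall>\<^sub>F X in at_top. \<forall>t. t * X ^ 0 \<in> {X powr \<epsilon>..X powr (1 - \<epsilon>)} \<longrightarrow>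
       moment 0 t 1 (2 * scale 0 t powr (1 + a)) \<le> C * ((t * X ^ 0) ^ m * scale 0 t powr (1 + \<epsilon> / 2)))"
    using a a\<epsilon> by blast
qed simp

section \<open>Mean growth of the remainder\<close>

text \<open>The points \<open>\<theta>\<^sup>j x\<close> with \<open>\<theta> = 2 powr (1 / n)\<close> split \<open>[x, 2 x]\<close> into \<open>n\<close> intervals of the same relative length \<open>\<delta>\<close>.\<close>

lemma doubling_increment_le:
  assumes X: "1 \<le> X" and n: "0 < n" and \<delta>: "\<delta> = 2 powr (1 / real n) - 1"
  shows "(\<lambda>x. (R (2 * x) - R x) ^ (2 * m)) integrable_on {1..X}"
    and "integral {1..X} (\<lambda>x. (R (2 * x) - R x) ^ (2 * m)) \<le> real n ^ (2 * m) * (real n * moment 1 \<delta> 1 (2 * X))"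
proof -
  define \<theta> where "\<theta> = (2::real) powr (1 / real n)"
  have \<theta>1: "1 \<le> \<theta>" unfolding \<theta>_def by (intro ge_one_powr_ge_zero) auto
  have \<theta>n: "\<theta> ^ n = 2" unfolding \<theta>_def using n by (simp add: powr_power)
  have \<delta>0: "0 \<le> \<delta>" and \<theta>\<delta>: "\<theta> = 1 + \<delta>" using \<theta>1 by (auto simp: \<delta> \<theta>_def)
  define f where "f = (\<lambda>y. incr y (\<delta> * y ^ 1))"
  have aff: "(\<lambda>x. f (\<theta> ^ j * x + 0)) integrable_on {1..X}"
    "integral {1..X} (\<lambda>x. f (\<theta> ^ j * x + 0)) \<le> moment 1 \<delta> 1 (2 * X)" if j: "j < n" for j
  proof -
    have \<theta>j: "1 \<le> \<theta> ^ j" "\<theta> ^ j \<le> 2"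
      using \<theta>1 j \<theta>n power_increasing[of j n \<theta>] by (auto intro: one_le_power)
    have f: "f integrable_on {\<theta> ^ j * 1 + 0..\<theta> ^ j * X + 0}"
      unfolding f_def using \<theta>j \<delta>0 by (intro incr_integrable) auto
    note a = integral_affine_real[OF f] 
    show int: "(\<lambda>x. f (\<theta> ^ j * x + 0)) integrable_on {1..X}" using a(1) \<theta>j by simp
    have "0 \<le> integral {1..X} (\<lambda>x. f (\<theta> ^ j * x + 0))"
      by (intro integral_nonneg int) (simp add: f_def incr_nonneg)
    hence "1 * integral {1..X} (\<lambda>x. f (\<theta> ^ j * x + 0)) \<le> \<theta> ^ j * integral {1..X} (\<lambda>x. f (\<theta> ^ j * x + 0))"
      using \<theta>j by (intro mult_right_mono)
    also have "\<dots> = moment 1 \<delta> (\<theta> ^ j) (\<theta> ^ j * X)" using a(2) \<theta>j by (simp add: moment_def f_def)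
    also have "\<dots> \<le> moment 1 \<delta> 1 (\<theta> ^ j * X)"
      using moment_combine[of 1 "\<theta> ^ j" "\<theta> ^ j * X" \<delta> 1] moment_nonneg[of 1 \<delta> 1 "\<theta> ^ j"] \<theta>j \<delta>0 X by simp
    also have "\<dots> \<le> moment 1 \<delta> 1 (2 * X)"
      using \<theta>j \<delta>0 X mult_mono[of 1 "\<theta> ^ j" 1 X] by (intro moment_mono mult_right_mono) auto
    finally show "integral {1..X} (\<lambda>x. f (\<theta> ^ j * x + 0)) \<le> moment 1 \<delta> 1 (2 * X)" by simp
  qed
  have pt: "(R (2 * x) - R x) ^ (2 * m) \<le> real n ^ (2 * m) * (\<Sum>j<n. f (\<theta> ^ j * x + 0))" for x
  proof -
    have "(\<Sum>j<n. R (\<theta> ^ Suc j * x) - R (\<theta> ^ j * x)) = R (\<theta> ^ n * x) - R (\<theta> ^ 0 * x)"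
      by (rule sum_lessThan_telescope)
    hence "R (2 * x) - R x = (\<Sum>j<n. R (\<theta> ^ Suc j * x) - R (\<theta> ^ j * x))" by (simp add: \<theta>n)
    hence le: "(R (2 * x) - R x) ^ (2 * m) \<le> real n ^ (2 * m) * (\<Sum>j<n. (R (\<theta> ^ Suc j * x) - R (\<theta> ^ j * x)) ^ (2 * m))"
      using even_power_sum_le[OF n] by simp
    have eq: "(R (\<theta> ^ Suc j * x) - R (\<theta> ^ j * x)) ^ (2 * m) = f (\<theta> ^ j * x + 0)" for j
    proof -
      have "\<theta> ^ Suc j * x = \<theta> ^ j * x + \<delta> * (\<theta> ^ j * x)" by (simp add: \<theta>\<delta> algebra_simps)
      thus ?thesis by (simp add: f_def incr_def)
    qed
    show ?thesis using le unfolding eq .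
  qed
  have bnd: "\<bar>R (2 * x) - R x\<bar> \<le> (1 + X) * (1 + ln (2 * X))" if "x \<in> {1..X}" for x
  proof -
    have 1: "\<bar>R (x + x) - R x\<bar> \<le> (1 + x) * (1 + ln (x + x))" using that by (intro R_increment) auto
    have "ln (x + x) \<le> ln (2 * X)" using that by (subst ln_le_cancel_iff) auto
    moreover have "0 \<le> ln (x + x)" using that by (intro ln_ge_zero) auto
    ultimately have 2: "(1 + x) * (1 + ln (x + x)) \<le> (1 + X) * (1 + ln (2 * X))"
      using that by (intro mult_mono) (auto simp del: ln_mult)
    show ?thesis using order_trans[OF 1 2] by simp
  qed
  show int: "(\<lambda>x. (R (2 * x) - R x) ^ (2 * m)) integrable_on {1..X}"
  proof (rule nn_integral_eq_integral_interval(1))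
    fix x assume "x \<in> {1..X}"
    from power_mono[OF bnd[OF this], of "2 * m"]
    show "(R (2 * x) - R x) ^ (2 * m) \<le> ((1 + X) * (1 + ln (2 * X))) ^ (2 * m)" by (simp add: power_even_abs)
  qed auto
  have "integral {1..X} (\<lambda>x. (R (2 * x) - R x) ^ (2 * m)) \<le> integral {1..X} (\<lambda>x. real n ^ (2 * m) * (\<Sum>j<n. f (\<theta> ^ j * x + 0)))"
    using aff by (intro integral_le int pt integrable_on_mult_right integrable_sum) auto
  also have "\<dots> = real n ^ (2 * m) * (\<Sum>j<n. integral {1..X} (\<lambda>x. f (\<theta> ^ j * x + 0)))"
    using aff by (subst integral_mult_right, subst integral_sum) auto
  also have "\<dots> \<le> real n ^ (2 * m) * (\<Sum>j<n. moment 1 \<delta> 1 (2 * X))"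
    using aff by (intro mult_left_mono sum_mono) auto
  finally show "integral {1..X} (\<lambda>x. (R (2 * x) - R x) ^ (2 * m)) \<le> real n ^ (2 * m) * (real n * moment 1 \<delta> 1 (2 * X))"
    by simp
qed

text \<open>Choose \<open>n\<close> of order \<open>X\<^sup>e\<close>. Then \<open>\<delta>\<close> is of order \<open>X powr (- e)\<close>, which is admissible at \<open>2 X\<close>, and the loss
  \<open>n powr (2 m + 1)\<close> is at most a constant times \<open>X\<^sup>b\<close>. The main term is \<open>O(X powr (m + 1))\<close>, since \<open>\<delta> log (1 / (E \<delta>))\<close> is bounded.\<close>

lemma doubling_moment_growth:
  assumes P: "moment_asymp 1" and b: "b > 0"
  shows "\<exists>C\<ge>0. \<forall>\<^sub>F X in at_top. integral {1..X} (\<lambda>x. (R (2 * x) - R x) ^ (2 * m)) \<le> C * X powr (real m + 1 + b)"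
proof -
  define e where "e = min (1 / 4) (b / (2 * real m + 1))"
  have e: "0 < e" "e \<le> 1 / 4" "e * (2 * real m + 1) \<le> b"
  proof -
    show "0 < e" using b by (simp add: e_def)
    show "e \<le> 1 / 4" unfolding e_def by (rule min.cobounded1)
    have "e \<le> b / (2 * real m + 1)" by (simp add: e_def)
    thus "e * (2 * real m + 1) \<le> b" by (simp add: field_simps)
  qed
  define C where "C = 2 ^ (2 * m + 1) * (2 * (\<mu> * (2 ^ (m + 1) * (1 / E) ^ m)))"
  have C: "0 \<le> C" using \<mu>_pos E_pos by (simp add: C_def)
  have "\<forall>\<^sub>F X in at_top. \<forall>t. t * X ^ 1 \<in> {X powr (e / 2)..X powr (1 - e / 2)} \<longrightarrow> \<bar>moment 1 t 1 X / model 1 X t - 1\<bar> < 1"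
    using P e unfolding moment_asymp_def by (meson half_gt_zero zero_less_one)
  moreover have "filterlim (\<lambda>X::real. 2 * X) at_top at_top" by real_asymp
  ultimately have "\<forall>\<^sub>F X in at_top. \<forall>t. t * (2 * X) ^ 1 \<in> {(2 * X) powr (e / 2)..(2 * X) powr (1 - e / 2)} \<longrightarrow>
      \<bar>moment 1 t 1 (2 * X) / model 1 (2 * X) t - 1\<bar> < 1"
    by (rule eventually_compose_filterlim)
  moreover have "\<forall>\<^sub>F X in at_top. (1::real) \<le> X" by (rule eventually_ge_at_top)
  moreover have "\<forall>\<^sub>F X in at_top. (2 * X) powr (e / 2) \<le> ln 2 * X powr (1 - e)" using e by real_asymp
  moreover have "\<forall>\<^sub>F X in at_top. 2 * X powr (1 - e) \<le> (2 * X) powr (1 - e / 2)" using e by real_asymp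
  moreover have "\<forall>\<^sub>F X in at_top. E \<le> X powr e" using e by real_asymp
  ultimately have "\<forall>\<^sub>F X in at_top. integral {1..X} (\<lambda>x. (R (2 * x) - R x) ^ (2 * m)) \<le> C * X powr (real m + 1 + b)"
  proof eventually_elim
    case (elim X)
    have Xe1: "1 \<le> X powr e" using elim e by (intro ge_one_powr_ge_zero) auto
    define n where "n = nat \<lceil>X powr e\<rceil>"
    have "X powr e \<le> real n" "real n \<le> X powr e + 1" unfolding n_def using Xe1 by linarith+
    hence n: "X powr e \<le> real n" "real n \<le> 2 * X powr e" using Xe1 by auto
    have n0: "0 < n" using n Xe1 by (cases n) auto
    define \<delta> where "\<delta> = 2 powr (1 / real n) - 1"
    have Xe0: "0 < X powr e" using Xe1 by linarith
    have \<delta>n: "ln 2 / real n \<le> \<delta>" "\<delta> \<le> 1 / real n" using root_two_bounds[OF n0] by (auto simp: \<delta>_def)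
    have "ln 2 / (2 * X powr e) \<le> ln 2 / real n" 
      by (rule divide_left_mono[OF n(2)]) (use n0 Xe0 in auto)
    hence \<delta>lo: "ln 2 / (2 * X powr e) \<le> \<delta>" using \<delta>n by linarith
    have "1 / real n \<le> 1 / X powr e" 
      by (rule divide_left_mono[OF n(1)]) (use n0 Xe0 in \<open>auto intro!: mult_pos_pos\<close>)
    hence \<delta>hi: "\<delta> \<le> 1 / X powr e" using \<delta>n by linarith
    have "0 < ln 2 / (2 * X powr e)" using Xe0 by (intro divide_pos_pos) auto
    hence \<delta>0: "0 < \<delta>" using \<delta>lo by linarith
    have X1e: "X powr (1 - e) = X / X powr e" using elim by (simp add: powr_diff)
    have "ln 2 / (2 * X powr e) * (2 * X) \<le> \<delta> * (2 * X)" "\<delta> * (2 * X) \<le> 1 / X powr e * (2 * X)"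
      using \<delta>lo \<delta>hi elim by (intro mult_right_mono; simp)+
    moreover have "ln 2 / (2 * X powr e) * (2 * X) = ln 2 * X powr (1 - e)" "1 / X powr e * (2 * X) = 2 * X powr (1 - e)"
      using Xe0 unfolding X1e by (auto simp: field_simps)
    ultimately have range: "\<delta> * (2 * X) ^ 1 \<in> {(2 * X) powr (e / 2)..(2 * X) powr (1 - e / 2)}"
      using elim(3,4) by auto
    have "E * \<delta> \<le> E * (1 / X powr e)" using \<delta>hi E_pos by (intro mult_left_mono) auto
    also have "\<dots> \<le> 1" using elim(5) Xe0 by simp
    finally have E\<delta>: "E * \<delta> \<le> 1" .
    have g0: "0 \<le> model 1 (2 * X) \<delta>"
    proof (rule model_bounds)
      have "E * \<delta> * (2 * X) \<le> 1 * (2 * X)" using E\<delta> elim by (intro mult_right_mono) auto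
      thus "E * (\<delta> * (2 * X) ^ 1) \<le> 2 * X" by (simp add: mult_ac)
    qed (use elim \<delta>0 in auto)
    have "\<bar>moment 1 \<delta> 1 (2 * X) - model 1 (2 * X) \<delta>\<bar> \<le> 1 * model 1 (2 * X) \<delta>"
      using elim(1) range g0 by (intro relative_error_le) auto
    hence m2: "moment 1 \<delta> 1 (2 * X) \<le> 2 * model 1 (2 * X) \<delta>" by linarith
    have L: "0 \<le> ln (1 / (E * \<delta>))" using E\<delta> E_pos \<delta>0 by (intro ln_ge_zero) auto
    have "ln (1 / (E * \<delta>)) \<le> 1 / (E * \<delta>)" using E_pos \<delta>0 ln_le_minus_one[of "1 / (E * \<delta>)"] by simp
    hence "\<delta> * ln (1 / (E * \<delta>)) \<le> \<delta> * (1 / (E * \<delta>))" using \<delta>0 by (intro mult_left_mono) auto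
    also have "\<dots> = 1 / E" using \<delta>0 by simp
    finally have "(\<delta> * ln (1 / (E * \<delta>))) ^ m \<le> (1 / E) ^ m" using L \<delta>0 by (intro power_mono) auto
    hence "\<mu> / (real m + 1) * (2 * X) ^ (m + 1) * (\<delta> * ln (1 / (E * \<delta>))) ^ m \<le> \<mu> / 1 * (2 * X) ^ (m + 1) * (1 / E) ^ m"
      using \<mu>_pos elim L \<delta>0 by (intro mult_mono divide_left_mono mult_nonneg_nonneg) auto
    also have "\<mu> / (real m + 1) * (2 * X) ^ (m + 1) * (\<delta> * ln (1 / (E * \<delta>))) ^ m = model 1 (2 * X) \<delta>"
      unfolding model_def power_mult_distrib by simp
    finally have g: "model 1 (2 * X) \<delta> \<le> \<mu> * (2 ^ (m + 1) * (1 / E) ^ m) * X ^ (m + 1)"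
      by (simp add: power_mult_distrib mult_ac)
    have "integral {1..X} (\<lambda>x. (R (2 * x) - R x) ^ (2 * m)) \<le> real n ^ (2 * m) * (real n * moment 1 \<delta> 1 (2 * X))"
      by (rule doubling_increment_le[OF elim(2) n0 \<delta>_def])
    also have "\<dots> = real n ^ (2 * m + 1) * moment 1 \<delta> 1 (2 * X)" by simp
    also have "\<dots> \<le> (2 * X powr e) ^ (2 * m + 1) * (2 * (\<mu> * (2 ^ (m + 1) * (1 / E) ^ m) * X ^ (m + 1)))"
    proof (intro mult_mono power_mono n)
      show "moment 1 \<delta> 1 (2 * X) \<le> 2 * (\<mu> * (2 ^ (m + 1) * (1 / E) ^ m) * X ^ (m + 1))" using m2 g by linarith
      show "0 \<le> moment 1 \<delta> 1 (2 * X)" using \<delta>0 by (intro moment_nonneg) auto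
    qed auto
    also have "\<dots> = C * (X powr (e * (2 * real m + 1)) * X ^ (m + 1))"
    proof -
      have "(X powr e) ^ (2 * m + 1) = X powr (e * (2 * real m + 1))"
        using elim by (subst powr_power) (auto simp: algebra_simps)
      thus ?thesis by (simp add: C_def power_mult_distrib del: power_Suc power_mult)
    qed
    also have "X powr (e * (2 * real m + 1)) * X ^ (m + 1) = X powr (e * (2 * real m + 1) + (real m + 1))"
      using elim powr_realpow[of X "m + 1"] by (simp add: powr_add add_ac)
    also have "C * \<dots> \<le> C * X powr (real m + 1 + b)"
      using C e elim by (intro mult_left_mono powr_mono) auto
    finally show ?case .
  qed
  thus ?thesis using C by blast
qed

text \<open>Let \<open>M X\<close> be the moment and \<open>B = m + 1 + b\<close>. Splitting \<open>R (2 x)\<close> into \<open>R x\<close> and the increment gives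
  \<open>M (2 X) \<le> 2 ^ (m + 1) * M X + D * X powr B\<close>, and \<open>2 ^ (m + 1) < 2 powr B\<close>; so the bound \<open>K * X powr B\<close> reproduces
  itself under doubling when \<open>K\<close> is large.\<close>

lemma remainder_moment_growth:
  assumes P: "moment_asymp 1" and b: "b > 0"
  shows "\<exists>K. \<forall>X\<ge>1. remainder_moment X \<le> K * X powr (real m + 1 + b)"
proof -
  define B where "B = real m + 1 + b"
  obtain C X0 where C: "0 \<le> C" and X0: "\<And>X. X0 \<le> X \<Longrightarrow> integral {1..X} (\<lambda>x. (R (2 * x) - R x) ^ (2 * m)) \<le> C * X powr B"
    using doubling_moment_growth[OF P b] unfolding eventually_at_top_linorder B_def by blast
  define X1 where "X1 = max X0 1"
  have X1: "1 \<le> X1" "X0 \<le> X1" by (auto simp: X1_def)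
  \<comment> \<open>This weight gives \<open>2 ^ m\<close> in front of \<open>R x\<close>; another factor \<open>2\<close> comes from the substitution \<open>x \<mapsto> 2 x\<close>.\<close>
  define c :: real where "c = sqrt 2 - 1"
  have c: "0 < c" by (simp add: c_def)
  have c2: "(1 + c) ^ (2 * m) = 2 ^ m" by (simp add: c_def power_mult)
  define q where "q = (1 + 1 / c) ^ (2 * m)"
  have q: "0 \<le> q" using c by (simp add: q_def)
  define D where "D = remainder_moment 2 + 2 * q * C"
  have double: "remainder_moment (2 * X) \<le> 2 ^ (m + 1) * remainder_moment X + D * X powr B" if X: "X1 \<le> X" for X
  proof -
    have X1': "1 \<le> X" "X0 \<le> X" using X X1 by auto
    have int: "(\<lambda>x. R (2 * x + 0) ^ (2 * m)) integrable_on {1..X}"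
      "2 * integral {1..X} (\<lambda>x. R (2 * x + 0) ^ (2 * m)) = integral {2 * 1 + 0..2 * X + 0} (\<lambda>x. R x ^ (2 * m))"
      by (intro integral_affine_real[of "\<lambda>x. R x ^ (2 * m)"] R_power_integrable; simp)+
    note int3 = doubling_increment_le(1)[OF X1'(1) zero_less_one refl]
    have pt: "R (2 * x + 0) ^ (2 * m) \<le> 2 ^ m * R x ^ (2 * m) + q * (R (2 * x) - R x) ^ (2 * m)" for x
      using even_power_add_le[OF c, of "R x" "R (2 * x) - R x" m] by (simp add: c2 q_def)
    have "integral {1..X} (\<lambda>x. R (2 * x + 0) ^ (2 * m)) \<le>
        integral {1..X} (\<lambda>x. 2 ^ m * R x ^ (2 * m) + q * (R (2 * x) - R x) ^ (2 * m))"
      by (intro integral_le int pt integrable_add integrable_on_mult_right R_power_integrable int3) auto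
    also have "\<dots> = integral {1..X} (\<lambda>x. 2 ^ m * R x ^ (2 * m)) + integral {1..X} (\<lambda>x. q * (R (2 * x) - R x) ^ (2 * m))"
      by (intro Henstock_Kurzweil_Integration.integral_add integrable_on_mult_right R_power_integrable int3) auto
    also have "\<dots> = 2 ^ m * remainder_moment X + q * integral {1..X} (\<lambda>x. (R (2 * x) - R x) ^ (2 * m))"
      by (simp add: remainder_moment_def)
    also have "\<dots> \<le> 2 ^ m * remainder_moment X + q * (C * X powr B)"
      using X0[OF X1'(2)] q by (intro add_left_mono mult_left_mono) auto
    finally have half: "integral {1..X} (\<lambda>x. R (2 * x + 0) ^ (2 * m)) \<le> 2 ^ m * remainder_moment X + q * (C * X powr B)" .
    have "remainder_moment (2 * X) = remainder_moment 2 + 2 * integral {1..X} (\<lambda>x. R (2 * x + 0) ^ (2 * m))"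
      using remainder_moment_split[of 2 "2 * X"] int(2) X1' by simp
    also have "\<dots> \<le> remainder_moment 2 + 2 * (2 ^ m * remainder_moment X + q * (C * X powr B))"
      by (intro add_left_mono mult_left_mono half) simp
    also have "remainder_moment 2 * 1 \<le> remainder_moment 2 * X powr B"
      using X1' b remainder_moment_nonneg[of 2] by (intro mult_left_mono ge_one_powr_ge_zero) (auto simp: B_def)
    hence "remainder_moment 2 + 2 * (2 ^ m * remainder_moment X + q * (C * X powr B)) \<le>
       2 ^ (m + 1) * remainder_moment X + D * X powr B"
      by (simp add: D_def algebra_simps)
    finally show ?thesis .
  qed
  have gap: "0 < 2 powr B - 2 ^ (m + 1)"
  proof -
    have "2 ^ (m + 1) = 2 powr (real m + 1)" using powr_realpow[of 2 "m + 1"] by (simp add: add_ac)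
    also have "\<dots> < 2 powr B" using b by (intro powr_less_mono) (auto simp: B_def)
    finally show ?thesis by simp
  qed
  define K where "K = max (remainder_moment (2 * X1)) (D / (2 powr B - 2 ^ (m + 1)))"
  have K0: "0 \<le> K" using remainder_moment_nonneg[of "2 * X1"] by (simp add: K_def)
  have "D / (2 powr B - 2 ^ (m + 1)) \<le> K" by (simp add: K_def)
  hence "D \<le> K * (2 powr B - 2 ^ (m + 1))" by (simp only: pos_divide_le_eq[OF gap])
  hence K: "2 ^ (m + 1) * K + D \<le> 2 powr B * K" by (simp add: algebra_simps)
  have base: "remainder_moment X \<le> K * X powr B" if X: "1 \<le> X" "X \<le> 2 * X1" for X
  proof -
    have "remainder_moment X \<le> remainder_moment (2 * X1)" using X by (intro remainder_moment_mono)
    also have "\<dots> \<le> K * 1" by (simp add: K_def)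
    also have "\<dots> \<le> K * X powr B" using X b K0 by (intro mult_left_mono ge_one_powr_ge_zero) (auto simp: B_def)
    finally show ?thesis .
  qed
  have step: "remainder_moment X \<le> K * X powr B" if "1 \<le> X" "X \<le> 2 ^ Suc i * X1" for X i
    using that
  proof (induction i arbitrary: X)
    case 0
    thus ?case by (intro base) auto
  next
    case (Suc i)
    show ?case
    proof (cases "X \<le> 2 * X1")
      case False
      define W where "W = X / 2"
      have W: "X1 \<le> W" "1 \<le> W" "W \<le> 2 ^ Suc i * X1" "X = 2 * W" using False X1 Suc.prems by (auto simp: W_def)
      have "remainder_moment X \<le> 2 ^ (m + 1) * remainder_moment W + D * W powr B" using double[OF W(1)] W(4) by simp
      also have "\<dots> \<le> 2 ^ (m + 1) * (K * W powr B) + D * W powr B"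
        using Suc.IH[OF W(2,3)] by (intro add_right_mono mult_left_mono) auto
      also have "\<dots> = (2 ^ (m + 1) * K + D) * W powr B" by (simp add: algebra_simps)
      also have "\<dots> \<le> (2 powr B * K) * W powr B" using K by (intro mult_right_mono) auto
      also have "\<dots> = K * X powr B" using W by (simp add: powr_mult)
      finally show ?thesis .
    qed (use Suc.prems base in auto)
  qed
  have "remainder_moment X \<le> K * X powr B" if X: "1 \<le> X" for X
  proof -
    obtain i where "X < 2 ^ i" using real_arch_pow[of 2 X] by auto
    also have "(2::real) ^ i \<le> 2 ^ Suc i * X1" using X1 by (intro order_trans[OF _ mult_mono[of "2 ^ i" "2 ^ Suc i" 1 X1]]) auto
    finally show ?thesis using X by (intro step[of X i]) auto
  qed
  thus ?thesis by (auto simp: B_def)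
qed

text \<open>The growth estimate for the tail at \<open>p = 0\<close> is derived from the formula for \<open>p = 1\<close>, which is
  the hypothesis of the direction in which this tail occurs.\<close>

theorem moment_asymp_iff: "moment_asymp 0 \<longleftrightarrow> moment_asymp 1"
proof
  assume "moment_asymp 0"
  hence "slice_asymp 1"
    using slice_asymp_transfer[of 0 1] moment_asymp_imp_slice_asymp[of 0] by simp
  thus "moment_asymp 1" using slice_asymp_imp_moment_asymp[of 1] tail_negligible_1 by simp
next
  assume 1: "moment_asymp 1"
  hence "slice_asymp 0"
    using slice_asymp_transfer[of 1 0] moment_asymp_imp_slice_asymp[of 1] by simp
  moreover have "tail_negligible 0" using remainder_moment_growth[OF 1] by (rule tail_negligible_0)
  ultimately show "moment_asymp 0" using slice_asymp_imp_moment_asymp[of 0] by simp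
qed

end

section \<open>The Chebyshev function\<close>

lemma finite_psi_index: "finite {n. 1 \<le> n \<and> real n \<le> x}"
  by (rule finite_subset[of _ "{..nat \<lfloor>x\<rfloor>}"]) (auto simp: le_nat_floor)

lemma mono_chebyshev_psi: "mono chebyshev_psi"
  unfolding chebyshev_psi_def
  by (intro monoI sum_mono2 finite_psi_index) (auto simp: mangoldt_nonneg)

text \<open>There are at most \<open>1 + h\<close> integers in \<open>(x, x + h]\<close>, each with \<open>\<Lambda> n \<le> log n\<close>.\<close>

lemma chebyshev_psi_increment_le:
  assumes x: "1 \<le> x" and h: "0 \<le> h"
  shows "chebyshev_psi (x + h) - chebyshev_psi x \<le> (1 + h) * ln (x + h)"
proof -
  let ?A = "{n. 1 \<le> n \<and> real n \<le> x}" and ?B = "{n. 1 \<le> n \<and> real n \<le> x + h}"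
  have sub: "?A \<subseteq> ?B" using h by auto
  have BA: "?B - ?A \<subseteq> {nat \<lfloor>x\<rfloor> + 1..nat \<lfloor>x + h\<rfloor>}"
  proof
    fix n assume "n \<in> ?B - ?A"
    hence n: "x < real n" "real n \<le> x + h" by auto
    have "\<lfloor>x\<rfloor> < int n" using n x by (simp add: floor_less_iff)
    moreover have "int n \<le> \<lfloor>x + h\<rfloor>" using n by (simp add: le_floor_iff)
    moreover have "1 \<le> \<lfloor>x\<rfloor>" using x by simp
    ultimately have "nat \<lfloor>x\<rfloor> + 1 \<le> n" "n \<le> nat \<lfloor>x + h\<rfloor>" by linarith+
    thus "n \<in> {nat \<lfloor>x\<rfloor> + 1..nat \<lfloor>x + h\<rfloor>}" by simp
  qed
  have ln0: "0 \<le> ln (x + h)" using x h by (intro ln_ge_zero) auto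
  have "chebyshev_psi (x + h) - chebyshev_psi x = (\<Sum>n\<in>?B - ?A. mangoldt n)"
    unfolding chebyshev_psi_def by (rule sum_diff[OF finite_psi_index sub, symmetric])
  also have "\<dots> \<le> (\<Sum>n\<in>?B - ?A. ln (x + h))"
  proof (rule sum_mono)
    fix n assume n: "n \<in> ?B - ?A"
    hence "mangoldt n \<le> ln (real n)" by (intro mangoldt_le) auto
    also have "\<dots> \<le> ln (x + h)" using n x by (subst ln_le_cancel_iff) auto
    finally show "mangoldt n \<le> ln (x + h)" .
  qed
  also have "\<dots> = real (card (?B - ?A)) * ln (x + h)" by simp
  also have "\<dots> \<le> (1 + h) * ln (x + h)"
  proof (intro mult_right_mono ln0)
    have "card (?B - ?A) \<le> card {nat \<lfloor>x\<rfloor> + 1..nat \<lfloor>x + h\<rfloor>}" by (rule card_mono[OF _ BA]) simp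
    hence "card (?B - ?A) \<le> nat \<lfloor>x + h\<rfloor> - nat \<lfloor>x\<rfloor>" by simp
    hence "real (card (?B - ?A)) \<le> real (nat \<lfloor>x + h\<rfloor> - nat \<lfloor>x\<rfloor>)" by simp
    also have "\<dots> \<le> 1 + h" using x h by linarith
    finally show "real (card (?B - ?A)) \<le> 1 + h" .
  qed
  finally show ?thesis .
qed

lemma chebyshev_remainder_increment:
  assumes x: "1 \<le> x" and h: "0 \<le> h"
  shows "\<bar>(chebyshev_psi (x + h) - (x + h)) - (chebyshev_psi x - x)\<bar> \<le> (1 + h) * (1 + ln (x + h))"
proof -
  have "0 \<le> chebyshev_psi (x + h) - chebyshev_psi x" using monoD[OF mono_chebyshev_psi, of x "x + h"] h by simp
  moreover have "0 \<le> ln (x + h)" using x h by (intro ln_ge_zero) auto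
  hence "0 \<le> (1 + h) * ln (x + h)" using h by simp
  ultimately show ?thesis
    using chebyshev_psi_increment_le[OF x h] h by (simp add: algebra_simps)
qed

lemma gauss_moment_pos: "0 < gauss_moment k"
  unfolding gauss_moment_def by (intro prod_pos) (auto elim: oddE)

lemma short_increments_psi:
  assumes "0 < m"
  shows "short_increments (\<lambda>x. chebyshev_psi x - x) m (gauss_moment k) const_E"
proof
  have [measurable]: "chebyshev_psi \<in> borel_measurable borel"
    by (intro borel_measurable_mono mono_chebyshev_psi)
  show "(\<lambda>x. chebyshev_psi x - x) \<in> borel_measurable borel" by measurable
qed (use assms chebyshev_remainder_increment gauss_moment_pos in \<open>auto simp: const_E_def\<close>)

theorem theorem1p1:
  fixes k :: nat
  assumes RH: "Riemann_Hypothesis"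
    and k: "k > 0" "even k"
  shows
    "(\<forall>\<epsilon>>0. asymp_equiv_uniformly (\<lambda>X. {X powr \<epsilon> .. X powr (1 - \<epsilon>)})
        (\<lambda>X h. integral {1..X} (\<lambda>x. (chebyshev_psi (x + h) - chebyshev_psi x - h) ^ k))
        (\<lambda>X h. gauss_moment k * h ^ (k div 2 + 1) *
                 integral {const_E..X / h} (\<lambda>x. (ln (x / const_E)) ^ (k div 2))))
     \<longleftrightarrow>
     (\<forall>\<epsilon>>0. asymp_equiv_uniformly (\<lambda>X. {X powr (- 1 + \<epsilon>) .. X powr (- \<epsilon>)})
        (\<lambda>X \<delta>. integral {1..X}
                 (\<lambda>x. (chebyshev_psi (x + \<delta> * x) - chebyshev_psi x - \<delta> * x) ^ k))
        (\<lambda>X \<delta>. gauss_moment k / (real k / 2 + 1) * X ^ (k div 2 + 1) * \<delta> ^ (k div 2) *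
                 (ln (1 / (const_E * \<delta>))) ^ (k div 2)))"
    (is "?i \<longleftrightarrow> ?ii")
proof -
  define m where "m = k div 2"
  have km: "k = 2 * m" using k by (simp add: m_def)
  have "0 < m" using k km by simp
  then interpret short_increments "\<lambda>x. chebyshev_psi x - x" m "gauss_moment k" const_E
    by (rule short_increments_psi)
  have incr: "incr x h = (chebyshev_psi (x + h) - chebyshev_psi x - h) ^ k" for x h
    by (simp add: incr_def km algebra_simps)
  have "?i \<longleftrightarrow> moment_asymp 0"
    by (simp add: asymp_equiv_uniformly_def moment_asymp_def moment_def model_def incr m_def[symmetric] Ball_def)
  also have "moment_asymp 0 \<longleftrightarrow> moment_asymp 1"
    by (rule moment_asymp_iff)
  also have "moment_asymp 1 \<longleftrightarrow> ?ii"
  proof -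
    have range: "t * X \<in> {X powr \<epsilon>..X powr (1 - \<epsilon>)} \<longleftrightarrow> t \<in> {X powr (- 1 + \<epsilon>)..X powr (- \<epsilon>)}"
      if "0 < X" for X t \<epsilon> :: real
    proof -
      have "X powr \<epsilon> = X powr (- 1 + \<epsilon>) * X" "X powr (1 - \<epsilon>) = X powr (- \<epsilon>) * X"
        using that by (auto simp: powr_add powr_diff powr_minus field_simps)
      thus ?thesis using that by simp
    qed
    have "(\<forall>\<^sub>F X in at_top. \<forall>t. t * X ^ 1 \<in> {X powr \<epsilon>..X powr (1 - \<epsilon>)} \<longrightarrow> \<bar>moment 1 t 1 X / model 1 X t - 1\<bar> < \<eta>) \<longleftrightarrow>
       (\<forall>\<^sub>F X in at_top. \<forall>t\<in>{X powr (- 1 + \<epsilon>)..X powr (- \<epsilon>)}. \<bar>moment 1 t 1 X / model 1 X t - 1\<bar> < \<eta>)" for \<epsilon> \<eta>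
      by (intro eventually_cong[OF eventually_gt_at_top[of 0]]) (simp only: power_one_right range Ball_def)
    hence "moment_asymp 1 \<longleftrightarrow> (\<forall>\<epsilon>>0. \<forall>\<eta>>0. \<forall>\<^sub>F X in at_top.
        \<forall>t\<in>{X powr (- 1 + \<epsilon>)..X powr (- \<epsilon>)}. \<bar>moment 1 t 1 X / model 1 X t - 1\<bar> < \<eta>)"
      unfolding moment_asymp_def by simp
    moreover have "moment 1 t 1 X = integral {1..X} (\<lambda>x. (chebyshev_psi (x + t * x) - chebyshev_psi x - t * x) ^ k)" for t X
      by (simp add: moment_def incr)
    moreover have "model 1 X t = gauss_moment k / (real k / 2 + 1) * X ^ (k div 2 + 1) * t ^ (k div 2) *
                 (ln (1 / (const_E * t))) ^ (k div 2)" for X t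
    proof -
      have "k div 2 = m" "real k / 2 = real m" by (auto simp: km)
      thus ?thesis by (simp only: model_def one_neq_zero if_False power_one_right)
    qed
    ultimately show ?thesis
      by (simp only: asymp_equiv_uniformly_def)
  qed
  finally show ?thesis .
qed

end
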